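(* Let $A$ be a finite dimensional associative algebra over an algebraically closed field $F$ of characteristic $0$. Suppose a connected reductive affine algebraic group $G$ over $F$ acts on $A$ rationally by automorphisms and anti-automorphisms. Then $\mathrm{PIexp}^G(A)=\mathrm{PIexp}(A)$.
   Context: Associative algebras $A$ are not assumed unital. An automorphism (anti-automorphism) of $A$ is $\psi\in\mathrm{GL}(A)$ with $\psi(ab)=\psi(a)\psi(b)$ (resp. $\psi(ab)=\psi(b)\psi(a)$) for all $a,b\in A$; an action by automorphisms and anti-automorphisms is a homomorphism from $G$ to the group of all automorphisms and anti-automorphisms of $A$. It is rational if $G\to\mathrm{GL}(A)$ is a morphism of affine algebraic groups. Let $F\langle X|G\rangle$ be the free associative algebra on free generators $x_j^g$, $j\in\mathbb N$, $g\in G$. An element $f\in F\langle X|G\rangle$ belongs to $\mathrm{Id}^G(A)$ if $f$ vanishes under every substitution $x_j^g\mapsto a_j^g$ with $a_j\in A$, where $a^g$ is the result of the action of $g$ on $a$. Let $P_n^G$ be the linear span of all $x_{\sigma(1)}^{g_1}\cdots x_{\sigma(n)}^{g_n}$, $g_i\in G$, $\sigma\in S_n$. Then $c_n^G(A):=\dim\bigl(P_n^G/(P_n^G\cap\mathrm{Id}^G(A))\bigr)$ and $\mathrm{PIexp}^G(A):=\lim_{n\to\infty}\sqrt[n]{c_n^G(A)}$. For the trivial group one obtains the ordinary codimensions $c_n(A)$ of polynomial identities of $A$ and $\mathrm{PIexp}(A):=\lim_{n\to\infty}\sqrt[n]{c_n(A)}$. *)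

theory Defs
  imports
    "HOL-Computational_Algebra.Polynomial"
    "HOL-Combinatorics.Permutations"
    "HOL-Library.Poly_Mapping"
    "HOL-Algebra.Elementary_Groups"
    "HOL-Analysis.Abstract_Topology"
begin

section \<open>Affine algebraic groups over an algebraically closed field\<close>

definition affine_space :: "nat \<Rightarrow> (nat \<Rightarrow> 'f) set" where
  "affine_space n = {..<n} \<rightarrow>\<^sub>E UNIV"

inductive_set polynomial_functions :: "nat \<Rightarrow> ((nat \<Rightarrow> 'f::field) \<Rightarrow> 'f) set" for n :: nat where
  const: "(\<lambda>x. c) \<in> polynomial_functions n"
| coord: "i < n \<Longrightarrow> (\<lambda>x. x i) \<in> polynomial_functions n"
| add: "p \<in> polynomial_functions n \<Longrightarrow> q \<in> polynomial_functions n
    \<Longrightarrow> (\<lambda>x. p x + q x) \<in> polynomial_functions n"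
| mult: "p \<in> polynomial_functions n \<Longrightarrow> q \<in> polynomial_functions n
    \<Longrightarrow> (\<lambda>x. p x * q x) \<in> polynomial_functions n"

definition zero_locus :: "nat \<Rightarrow> ((nat \<Rightarrow> 'f::field) \<Rightarrow> 'f) set \<Rightarrow> (nat \<Rightarrow> 'f) set" where
  "zero_locus n S = {x \<in> affine_space n. \<forall>p\<in>S. p x = 0}"

definition zariski :: "nat \<Rightarrow> (nat \<Rightarrow> 'f::field) topology" where
  "zariski n = topology (\<lambda>U. \<exists>S \<subseteq> polynomial_functions n. U = affine_space n - zero_locus n S)"

lemma istopology_zariski:
  "istopology (\<lambda>U. \<exists>S \<subseteq> polynomial_functions n.
     U = affine_space n - zero_locus n (S :: ((nat \<Rightarrow> 'f::field) \<Rightarrow> 'f) set))"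
proof -
  let ?D = "\<lambda>S. affine_space n - zero_locus n (S :: ((nat \<Rightarrow> 'f) \<Rightarrow> 'f) set)"
  have D: "x \<in> ?D S \<longleftrightarrow> x \<in> affine_space n \<and> (\<exists>p\<in>S. p x \<noteq> 0)" for x S
    unfolding zero_locus_def by blast
  have int: "\<exists>R \<subseteq> polynomial_functions n. ?D S \<inter> ?D T = ?D R"
    if S: "S \<subseteq> polynomial_functions n" and T: "T \<subseteq> polynomial_functions n" for S T
  proof (intro exI conjI)
    let ?R = "(\<lambda>(p, q) x. p x * q x) ` (S \<times> T)"
    show "?R \<subseteq> polynomial_functions n"
      using S T by (auto intro: polynomial_functions.mult)
    show "?D S \<inter> ?D T = ?D ?R"
      by (rule Set.set_eqI, unfold Int_iff D) auto
  qed
  have un: "\<exists>R \<subseteq> polynomial_functions n. \<Union>K = ?D R"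
    if K: "\<forall>U\<in>K. \<exists>S \<subseteq> polynomial_functions n. U = ?D S" for K
  proof (intro exI conjI)
    let ?R = "{p \<in> polynomial_functions n. \<forall>x \<in> affine_space n. p x \<noteq> 0 \<longrightarrow> x \<in> \<Union>K}"
    show "?R \<subseteq> polynomial_functions n" by (rule Collect_restrict)
    show "\<Union>K = ?D ?R"
    proof (rule Set.set_eqI, unfold D, rule iffI)
      fix x assume "x \<in> \<Union>K"
      then obtain U where U: "U \<in> K" "x \<in> U" by (rule UnionE)
      with K obtain S where S: "S \<subseteq> polynomial_functions n" "U = ?D S"
        by meson
      with U D obtain p where p: "p \<in> S" "p x \<noteq> 0" and x: "x \<in> affine_space n"
        by metis
      have "y \<in> \<Union>K" if "y \<in> affine_space n" "p y \<noteq> 0" for y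
        using U(1) S(2) D[of y S] p(1) that by (intro UnionI[of U]) blast+
      with S(1) p have "p \<in> ?R" by blast
      with p(2) x show "x \<in> affine_space n \<and> (\<exists>p\<in>?R. p x \<noteq> 0)" by blast
    next
      fix x assume "x \<in> affine_space n \<and> (\<exists>p\<in>?R. p x \<noteq> 0)"
      then show "x \<in> \<Union>K" by blast
    qed
  qed
  show ?thesis
    unfolding istopology_def
  proof (intro conjI allI impI)
    fix U V assume "\<exists>S \<subseteq> polynomial_functions n. U = ?D S" "\<exists>S \<subseteq> polynomial_functions n. V = ?D S"
    then show "\<exists>S \<subseteq> polynomial_functions n. U \<inter> V = ?D S"
      by (elim exE conjE) (simp only: int)
  next
    fix K assume "\<forall>U\<in>K. \<exists>S \<subseteq> polynomial_functions n. U = ?D S"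
    then show "\<exists>S \<subseteq> polynomial_functions n. \<Union>K = ?D S" by (rule un)
  qed
qed

lemma closedin_zariski:
  "closedin (zariski n) V \<longleftrightarrow> (\<exists>S \<subseteq> polynomial_functions n. V = zero_locus n S)"
proof -
  have op: "openin (zariski n) U \<longleftrightarrow>
      (\<exists>S \<subseteq> polynomial_functions n. U = affine_space n - zero_locus n S)" for U :: "(nat \<Rightarrow> 'a) set"
    unfolding zariski_def by (simp add: topology_inverse'[OF istopology_zariski])
  have sub: "zero_locus n S \<subseteq> affine_space n" for S :: "((nat \<Rightarrow> 'a) \<Rightarrow> 'a) set"
    by (auto simp: zero_locus_def)
  have "affine_space n = affine_space n - zero_locus n {\<lambda>x. 1 :: 'a}"
    by (auto simp: zero_locus_def)
  moreover have "{\<lambda>x. 1 :: 'a} \<subseteq> polynomial_functions n"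
    by (simp add: polynomial_functions.const)
  ultimately have "openin (zariski n) (affine_space n :: (nat \<Rightarrow> 'a) set)"
    unfolding op by blast
  moreover have "topspace (zariski n) \<subseteq> (affine_space n :: (nat \<Rightarrow> 'a) set)"
    using op[of "topspace (zariski n)"] by auto
  ultimately have top: "topspace (zariski n) = (affine_space n :: (nat \<Rightarrow> 'a) set)"
    by (simp add: openin_subset subset_antisym)
  show ?thesis
  proof
    assume "closedin (zariski n) V"
    then obtain S where "S \<subseteq> polynomial_functions n" "V \<subseteq> affine_space n"
      "affine_space n - V = affine_space n - zero_locus n S"
      unfolding closedin_def top op by blast
    moreover from this sub[of S] have "V = zero_locus n S" by blast
    ultimately show "\<exists>S \<subseteq> polynomial_functions n. V = zero_locus n S" by blast
  next
    assume "\<exists>S \<subseteq> polynomial_functions n. V = zero_locus n S"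
    then show "closedin (zariski n) V"
      unfolding closedin_def top op using sub by blast
  qed
qed

definition regular_function :: "nat \<Rightarrow> (nat \<Rightarrow> 'f::field) set \<Rightarrow> ((nat \<Rightarrow> 'f) \<Rightarrow> 'f) \<Rightarrow> bool" where
  "regular_function n V f \<longleftrightarrow> (\<exists>p\<in>polynomial_functions n. \<forall>x\<in>V. f x = p x)"

text \<open>The identification of pairs of points of affine \<open>n\<close>-space with points of affine
  \<open>2n\<close>-space, used to regard \<open>G \<times> G\<close> as an affine variety.\<close>

definition juxtapose :: "nat \<Rightarrow> (nat \<Rightarrow> 'f) \<Rightarrow> (nat \<Rightarrow> 'f) \<Rightarrow> nat \<Rightarrow> 'f" where
  "juxtapose n x y = (\<lambda>i. if i < n then x i else y (i - n))"

definition affine_algebraic_group :: "nat \<Rightarrow> (nat \<Rightarrow> 'f::field) monoid \<Rightarrow> bool" where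
  "affine_algebraic_group n G \<longleftrightarrow>
     group G \<and>
     closedin (zariski n) (carrier G) \<and>
     (\<forall>i<n. \<exists>p\<in>polynomial_functions (n + n). \<forall>x\<in>carrier G. \<forall>y\<in>carrier G.
        (x \<otimes>\<^bsub>G\<^esub> y) i = p (juxtapose n x y)) \<and>
     (\<forall>i<n. regular_function n (carrier G) (\<lambda>x. (inv\<^bsub>G\<^esub> x) i))"

definition connected_group :: "nat \<Rightarrow> (nat \<Rightarrow> 'f::field) monoid \<Rightarrow> bool" where
  "connected_group n G \<longleftrightarrow> connectedin (zariski n) (carrier G)"

text \<open>An element \<open>g\<close> is unipotent if its right translation \<open>(\<rho>\<^sub>g f) y = f (y g)\<close> is a locally
  unipotent operator on the coordinate ring of \<open>G\<close>, i.e. every regular function is annihilated by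
  some power of \<open>\<rho>\<^sub>g - 1\<close>. A regular function is represented by a polynomial function,
  considered only at points of \<open>G\<close>.\<close>

definition unipotent_element :: "nat \<Rightarrow> (nat \<Rightarrow> 'f::field) monoid \<Rightarrow> (nat \<Rightarrow> 'f) \<Rightarrow> bool" where
  "unipotent_element n G g \<longleftrightarrow> g \<in> carrier G \<and>
     (\<forall>p\<in>polynomial_functions n. \<exists>k. \<forall>x\<in>carrier G.
        ((\<lambda>f y. f (y \<otimes>\<^bsub>G\<^esub> g) - f y) ^^ k) p x = 0)"

text \<open>There is a largest closed connected normal unipotent subgroup, hence it is the union of all
  such subgroups.\<close>

definition unipotent_radical :: "nat \<Rightarrow> (nat \<Rightarrow> 'f::field) monoid \<Rightarrow> (nat \<Rightarrow> 'f) set" where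
  "unipotent_radical n G = \<Union>{N. N \<lhd> G \<and> closedin (zariski n) N \<and> connectedin (zariski n) N \<and>
     (\<forall>g\<in>N. unipotent_element n G g)}"

definition reductive_group :: "nat \<Rightarrow> (nat \<Rightarrow> 'f::field) monoid \<Rightarrow> bool" where
  "reductive_group n G \<longleftrightarrow> unipotent_radical n G = {\<one>\<^bsub>G\<^esub>}"


section \<open>Algebras and rational actions\<close>

locale assoc_algebra = vector_space scale
  for scale :: "'f::field \<Rightarrow> 'a::ring \<Rightarrow> 'a" +
  assumes scale_mult_left: "scale c (x * y) = scale c x * y"
    and scale_mult_right: "scale c (x * y) = x * scale c y"

definition GL :: "('f::field \<Rightarrow> 'v::ab_group_add \<Rightarrow> 'v) \<Rightarrow> ('v \<Rightarrow> 'v) monoid" where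
  "GL scale =
     \<lparr>carrier = {T. Vector_Spaces.linear scale scale T \<and> bij T}, mult = (\<circ>), one = id\<rparr>"

text \<open>The determinant of the matrix of \<open>T\<close> in the finite basis \<open>B\<close>.\<close>

definition endo_det ::
    "('f::field \<Rightarrow> 'v::ab_group_add \<Rightarrow> 'v) \<Rightarrow> 'v set \<Rightarrow> ('v \<Rightarrow> 'v) \<Rightarrow> 'f" where
  "endo_det scale B T = (\<Sum>\<pi> | \<pi> permutes B.
     of_int (sign \<pi>) * (\<Prod>b\<in>B. module.representation scale B (T b) (\<pi> b)))"

text \<open>The coordinate ring of the affine variety \<open>GL\<close> (of a finite dimensional space): it is
  generated by the matrix entries and the inverse of the determinant. The determinant does not
  depend on the basis, so the rule for it may range over all bases.\<close>

inductive_set GL_regular_functions ::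
    "('f::field \<Rightarrow> 'v::ab_group_add \<Rightarrow> 'v) \<Rightarrow> (('v \<Rightarrow> 'v) \<Rightarrow> 'f) set" for scale where
  const: "(\<lambda>T. c) \<in> GL_regular_functions scale"
| entry: "Vector_Spaces.linear scale (*) l \<Longrightarrow> (\<lambda>T. l (T v)) \<in> GL_regular_functions scale"
| inverse_det: "\<not> module.dependent scale B \<Longrightarrow> module.span scale B = UNIV
    \<Longrightarrow> (\<lambda>T. inverse (endo_det scale B T)) \<in> GL_regular_functions scale"
| add: "p \<in> GL_regular_functions scale \<Longrightarrow> q \<in> GL_regular_functions scale
    \<Longrightarrow> (\<lambda>T. p T + q T) \<in> GL_regular_functions scale"
| mult: "p \<in> GL_regular_functions scale \<Longrightarrow> q \<in> GL_regular_functions scale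
    \<Longrightarrow> (\<lambda>T. p T * q T) \<in> GL_regular_functions scale"

definition automorphism :: "('f::field \<Rightarrow> 'a::ring \<Rightarrow> 'a) \<Rightarrow> ('a \<Rightarrow> 'a) \<Rightarrow> bool" where
  "automorphism scale T \<longleftrightarrow> T \<in> carrier (GL scale) \<and> (\<forall>a b. T (a * b) = T a * T b)"

definition anti_automorphism :: "('f::field \<Rightarrow> 'a::ring \<Rightarrow> 'a) \<Rightarrow> ('a \<Rightarrow> 'a) \<Rightarrow> bool" where
  "anti_automorphism scale T \<longleftrightarrow> T \<in> carrier (GL scale) \<and> (\<forall>a b. T (a * b) = T b * T a)"

definition Aut_star :: "('f::field \<Rightarrow> 'a::ring \<Rightarrow> 'a) \<Rightarrow> ('a \<Rightarrow> 'a) monoid" where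
  "Aut_star scale =
     (GL scale)\<lparr>carrier := {T. automorphism scale T \<or> anti_automorphism scale T}\<rparr>"

definition acts_by_auts_and_anti_auts ::
    "('f::field \<Rightarrow> 'a::ring \<Rightarrow> 'a) \<Rightarrow> 'g monoid \<Rightarrow> ('g \<Rightarrow> 'a \<Rightarrow> 'a) \<Rightarrow> bool" where
  "acts_by_auts_and_anti_auts scale G \<psi> \<longleftrightarrow> \<psi> \<in> hom G (Aut_star scale)"

text \<open>A morphism of affine algebraic groups is a group homomorphism which pulls regular functions
  back to regular functions.\<close>

definition rational_action ::
    "('f::field \<Rightarrow> 'a::ring \<Rightarrow> 'a) \<Rightarrow> nat \<Rightarrow> (nat \<Rightarrow> 'f) monoid \<Rightarrow> ((nat \<Rightarrow> 'f) \<Rightarrow> 'a \<Rightarrow> 'a) \<Rightarrow> bool" where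
  "rational_action scale n G \<psi> \<longleftrightarrow> \<psi> \<in> hom G (GL scale) \<and>
     (\<forall>f\<in>GL_regular_functions scale. regular_function n (carrier G) (f \<circ> \<psi>))"


section \<open>Dimension of a quotient space\<close>

text \<open>A set \<open>B \<subseteq> V\<close> represents a basis of the quotient space \<open>V / W\<close>: its residue classes are
  distinct, linearly independent, and span \<open>V / W\<close>. The dimension is \<open>0\<close> by convention if
  \<open>V / W\<close> is infinite dimensional.\<close>

definition quotient_basis ::
    "('f::field \<Rightarrow> 'v::ab_group_add \<Rightarrow> 'v) \<Rightarrow> 'v set \<Rightarrow> 'v set \<Rightarrow> 'v set \<Rightarrow> bool" where
  "quotient_basis scale V W B \<longleftrightarrow> B \<subseteq> V \<and>
     (\<forall>S u. finite S \<and> S \<subseteq> B \<and> (\<Sum>v\<in>S. scale (u v) v) \<in> W \<longrightarrow> (\<forall>v\<in>S. u v = 0)) \<and>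
     (\<forall>v\<in>V. \<exists>b\<in>module.span scale B. v - b \<in> W)"

definition quotient_dim ::
    "('f::field \<Rightarrow> 'v::ab_group_add \<Rightarrow> 'v) \<Rightarrow> 'v set \<Rightarrow> 'v set \<Rightarrow> nat" where
  "quotient_dim scale V W = card (SOME B. quotient_basis scale V W B)"

lemma quotient_basis_card_le:
  assumes "vector_space scale" and W: "module.subspace scale W"
    and B: "quotient_basis scale V W B" "finite B" and B': "quotient_basis scale V W B'"
  shows "finite B' \<and> card B' \<le> card B"
proof -
  interpret vector_space scale by fact
  have B'_sub: "B' \<subseteq> V"
    and B'_indep: "\<And>S u. finite S \<Longrightarrow> S \<subseteq> B' \<Longrightarrow> (\<Sum>v\<in>S. scale (u v) v) \<in> W \<Longrightarrow> \<forall>v\<in>S. u v = 0"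
    using B' unfolding quotient_basis_def by simp_all
  have "\<forall>v\<in>V. \<exists>b\<in>span B. v - b \<in> W"
    using B(1) unfolding quotient_basis_def by simp
  then obtain f where f: "\<And>v. v \<in> B' \<Longrightarrow> f v \<in> span B" "\<And>v. v \<in> B' \<Longrightarrow> v - f v \<in> W"
    using B'_sub by (metis subsetD)
  have zero: "\<forall>v\<in>S. u v = 0"
    if S: "finite S" "S \<subseteq> B'" and eq: "(\<Sum>v\<in>S. scale (u v) (f v)) = 0" for S u
  proof -
    have "(\<Sum>v\<in>S. scale (u v) (v - f v)) \<in> W"
      by (rule subspace_sum[OF W]) (use S f(2) subspace_scale[OF W] in blast)
    then have "(\<Sum>v\<in>S. scale (u v) v) \<in> W"
      using eq by (simp add: scale_right_diff_distrib sum_subtractf)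
    then show ?thesis
      using S by (intro B'_indep)
  qed
  have inj: "inj_on f B'"
  proof (rule inj_onI, rule ccontr)
    fix v w assume vw: "v \<in> B'" "w \<in> B'" "f v = f w" "v \<noteq> w"
    then have "\<forall>x\<in>{v, w}. (if x = v then 1 else - 1 :: 'a) = 0"
      by (intro zero) auto
    then show False by auto
  qed
  have "independent (f ` B')"
    unfolding dependent_explicit
  proof clarify
    fix T u v assume T: "finite T" "T \<subseteq> f ` B'" and eq: "(\<Sum>x\<in>T. scale (u x) x) = 0"
      and v: "v \<in> T" "u v \<noteq> 0"
    obtain S where S: "S \<subseteq> B'" "T = f ` S"
      using T(2) by (meson subset_imageE)
    have inj': "inj_on f S" using inj S(1) inj_on_subset by blast
    have "finite S" using T(1) S(2) inj' finite_imageD by blast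
    moreover have "(\<Sum>x\<in>S. scale (u (f x)) (f x)) = 0"
      using eq unfolding S(2) by (simp add: sum.reindex[OF inj'])
    ultimately show False
      using zero[of S "u \<circ> f"] S v by auto
  qed
  moreover have "f ` B' \<subseteq> span B" using f(1) by blast
  ultimately have "finite (f ` B') \<and> card (f ` B') \<le> card B"
    using independent_span_bound[OF B(2)] by blast
  then show ?thesis
    using inj by (metis card_image finite_imageD)
qed

lemma quotient_dim_eq_card:
  assumes "vector_space scale" "module.subspace scale W" "quotient_basis scale V W B" "finite B"
  shows "quotient_dim scale V W = card B"
proof -
  let ?C = "SOME B. quotient_basis scale V W B"
  have C: "quotient_basis scale V W ?C"
    using assms(3) by (rule someI)
  have "finite ?C \<and> card ?C \<le> card B"
    by (rule quotient_basis_card_le[OF assms(1-4) C])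
  moreover from this have "card B \<le> card ?C"
    using quotient_basis_card_le[OF assms(1,2) C _ assms(3)] by blast
  ultimately show ?thesis
    by (simp add: quotient_dim_def)
qed


section \<open>Polynomial \<open>G\<close>-identities and codimensions\<close>

text \<open>The letter \<open>(j, g)\<close> stands for the free generator \<open>x\<^sub>j\<^sup>g\<close>. The free associative algebra
  has the nonempty words as a basis, since algebras are not assumed to be unital.\<close>

type_synonym ('g, 'f) gpoly = "(nat \<times> 'g) list \<Rightarrow>\<^sub>0 'f"

definition gpoly_scale :: "'f::field \<Rightarrow> ('g, 'f) gpoly \<Rightarrow> ('g, 'f) gpoly" where
  "gpoly_scale c f = Poly_Mapping.map ((*) c) f"

lemma lookup_gpoly_scale [simp]:
  "Poly_Mapping.lookup (gpoly_scale c f) w = c * Poly_Mapping.lookup f w"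
  by (simp add: gpoly_scale_def Poly_Mapping.map.rep_eq when_def)

lemma vector_space_gpoly_scale: "vector_space gpoly_scale"
  by unfold_locales (auto intro!: poly_mapping_eqI simp: lookup_add algebra_simps)

definition free_algebra :: "'g monoid \<Rightarrow> ('g, 'f::field) gpoly set" where
  "free_algebra G = {f. \<forall>w \<in> Poly_Mapping.keys f. w \<noteq> [] \<and> snd ` set w \<subseteq> carrier G}"

text \<open>The value at the empty word is irrelevant.\<close>

fun word_product :: "'a::ring list \<Rightarrow> 'a" where
  "word_product [] = 0"
| "word_product [x] = x"
| "word_product (x # y # xs) = x * word_product (y # xs)"

definition multilinear_gpolys :: "'g monoid \<Rightarrow> nat \<Rightarrow> ('g, 'f::field) gpoly set" where
  "multilinear_gpolys G n = module.span gpoly_scale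
     {Poly_Mapping.single (map (\<lambda>i. (\<sigma> i, g i)) [1..<Suc n]) 1 | \<sigma> g.
        \<sigma> permutes {1..n} \<and> g \<in> {1..n} \<rightarrow> carrier G}"

definition substitute :: "('f::field \<Rightarrow> 'a::ring \<Rightarrow> 'a) \<Rightarrow> ('g \<Rightarrow> 'a \<Rightarrow> 'a) \<Rightarrow>
    (nat \<Rightarrow> 'a) \<Rightarrow> ('g, 'f) gpoly \<Rightarrow> 'a" where
  "substitute scale \<psi> a f = (\<Sum>w\<in>Poly_Mapping.keys f.
     scale (Poly_Mapping.lookup f w) (word_product (map (\<lambda>(j, g). \<psi> g (a j)) w)))"

definition Id_G :: "('f::field \<Rightarrow> 'a::ring \<Rightarrow> 'a) \<Rightarrow> 'g monoid \<Rightarrow> ('g \<Rightarrow> 'a \<Rightarrow> 'a) \<Rightarrow>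
    ('g, 'f) gpoly set" where
  "Id_G scale G \<psi> = {f \<in> free_algebra G. \<forall>a. substitute scale \<psi> a f = 0}"

definition codim_G :: "('f::field \<Rightarrow> 'a::ring \<Rightarrow> 'a) \<Rightarrow> 'g monoid \<Rightarrow> ('g \<Rightarrow> 'a \<Rightarrow> 'a) \<Rightarrow>
    nat \<Rightarrow> nat" where
  "codim_G scale G \<psi> n = quotient_dim gpoly_scale
     (multilinear_gpolys G n) (multilinear_gpolys G n \<inter> Id_G scale G \<psi>)"

definition PIexp_G :: "('f::field \<Rightarrow> 'a::ring \<Rightarrow> 'a) \<Rightarrow> 'g monoid \<Rightarrow> ('g \<Rightarrow> 'a \<Rightarrow> 'a) \<Rightarrow> real" where
  "PIexp_G scale G \<psi> = lim (\<lambda>n. root n (real (codim_G scale G \<psi> n)))"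

definition codim :: "('f::field \<Rightarrow> 'a::ring \<Rightarrow> 'a) \<Rightarrow> nat \<Rightarrow> nat" where
  "codim scale = codim_G scale (singleton_group ()) (\<lambda>_. id)"

definition PIexp :: "('f::field \<Rightarrow> 'a::ring \<Rightarrow> 'a) \<Rightarrow> real" where
  "PIexp scale = lim (\<lambda>n. root n (real (codim scale n)))"

end

theory Submission
  imports
    Defs
    "HOL-Combinatorics.Multiset_Permutations"
    "HOL-Analysis.Convex"
begin

text \<open>
  The proof determines the common value of the two limits. By structure theory \<open>A\<close> is the sum of a
  nilpotent ideal \<open>J\<close> and of pairwise annihilating full matrix algebras, its blocks, of dimensions
  \<open>(card V)\<^sup>2\<close> (\<open>exists_split\<close>). A set of blocks is admissible if some nonzero product of
  elements of \<open>A\<close> has a factor from each of them, and \<open>d\<close> is the largest dimension of an admissible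
  sum of blocks. Then \<open>c\<^sub>n\<^sup>G(A)\<close> lies between \<open>d\<^sup>n\<close> divided by a polynomial in \<open>n\<close> and \<open>d\<^sup>n\<close>
  multiplied by a polynomial in \<open>n\<close>, for every action which maps \<open>J\<close> into itself and each block
  into its sum with \<open>J\<close>. Both the given action and the trivial action of the trivial group have this
  property, so both limits exist and equal \<open>d\<close> (\<open>codim_root_LIMSEQ\<close>).

  The action of \<open>G\<close> has the property because an automorphism or anti-automorphism preserves \<open>J\<close> and
  permutes the ideals generated by \<open>J\<close> and one block, which are the minimal ones
  above \<open>J\<close>. The elements of \<open>G\<close> with a prescribed effect on one such ideal form a closed set, and
  \<open>G\<close> is connected (\<open>connected_group_fixes_blocks\<close>).

  Upper bound (\<open>codim_upper_bound\<close>). A multilinear \<open>G\<close>-polynomial is determined modulo identities by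
  its values on tuples of matrix units and of elements spanning \<open>J\<close>. If a monomial does not vanish
  on a tuple, then, on expansion into block and \<open>J\<close>-components, some nonzero term has a bounded
  number of factors from \<open>J\<close>, and its other factors come from an admissible set of blocks. So
  all but boundedly many entries of the tuple lie in this set of blocks, which leaves
  polynomially many times \<open>d\<^sup>n\<close> tuples.

  Lower bound (\<open>codim_lower_bound\<close>). Fix a nonzero product with factors from all blocks of an optimal
  admissible set, cut at these factors, and insert monomials there which are evaluated
  at matrix units. Reading a matrix unit \<open>E p q\<close> as an edge from \<open>p\<close> to \<open>q\<close>, the value is
  the fixed product or zero according to whether each inserted monomial runs through a closed trail
  at a base vertex. So the codimension is at least the rank of an incidence
  matrix between orderings of the variables and labellings of the variables by edges. The inequality
  \<open>(tr M)\<^sup>2 \<le> rk M \<cdot> tr M\<^sup>2\<close> for its Gram matrix \<open>M\<close> (\<open>Gram_trace_le\<close>) reduces the bound to counting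
  pairs of labellings which are closed trails for two orderings. An Eulerian trail is
  determined by the order in which it leaves each vertex, and this gives the required bound on
  the count (\<open>sum_common_trails_le\<close>).
\<close>

section \<open>A lower bound for the rank of a matrix of natural numbers\<close>

lemma orthonormal_system_spanning:
  fixes b :: "'s \<Rightarrow> 'u \<Rightarrow> real"
  assumes "finite B" "finite U"
  shows "\<exists>Q. finite Q \<and> card Q \<le> card B \<and>
     (\<forall>q\<in>Q. \<forall>q'\<in>Q. (\<Sum>u\<in>U. q u * q' u) = (if q = q' then 1 else 0)) \<and>
     (\<forall>i\<in>B. \<exists>c. \<forall>u\<in>U. b i u = (\<Sum>q\<in>Q. c q * q u))"
  using assms(1)
proof (induction B rule: finite_induct)
  case empty
  show ?case by (rule exI[of _ "{}"]) simp
next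
  case (insert i B)
  then obtain Q where Q: "finite Q" "card Q \<le> card B"
    and orth: "\<And>q q'. q \<in> Q \<Longrightarrow> q' \<in> Q \<Longrightarrow> (\<Sum>u\<in>U. q u * q' u) = (if q = q' then 1 else 0)"
    and spn: "\<And>j. j \<in> B \<Longrightarrow> \<exists>c. \<forall>u\<in>U. b j u = (\<Sum>q\<in>Q. c q * q u)"
    by blast
  define c where "c q = (\<Sum>u\<in>U. b i u * q u)" for q
  define r where "r u = b i u - (\<Sum>q\<in>Q. c q * q u)" for u
  have r_orth: "(\<Sum>u\<in>U. r u * q u) = 0" if q: "q \<in> Q" for q
  proof -
    have "(\<Sum>u\<in>U. (\<Sum>q'\<in>Q. c q' * q' u) * q u) = (\<Sum>q'\<in>Q. c q' * (\<Sum>u\<in>U. q' u * q u))"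
      by (simp add: sum_distrib_left sum_distrib_right mult.assoc) (rule sum.swap)
    also have "\<dots> = (\<Sum>q'\<in>Q. if q' = q then c q else 0)"
      using q by (intro sum.cong) (auto simp: orth)
    also have "\<dots> = c q" using q Q(1) by simp
    finally show ?thesis
      by (simp add: r_def c_def left_diff_distrib sum_subtractf)
  qed
  have b_i: "b i u = r u + (\<Sum>q\<in>Q. c q * q u)" for u by (simp add: r_def)
  show ?case
  proof (cases "(\<Sum>u\<in>U. r u * r u) = 0")
    case True
    then have "\<forall>u\<in>U. r u = 0"
      using assms(2) by (subst (asm) sum_nonneg_eq_0_iff) auto
    then have "\<exists>c. \<forall>u\<in>U. b i u = (\<Sum>q\<in>Q. c q * q u)" using b_i by auto
    then show ?thesis
      using Q orth spn insert.hyps by (intro exI[of _ Q]) auto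
  next
    case False
    define N where "N = sqrt (\<Sum>u\<in>U. r u * r u)"
    have "(\<Sum>u\<in>U. r u * r u) > 0"
      using False by (smt (verit, best) sum_nonneg zero_le_square)
    then have N: "N > 0" "N * N = (\<Sum>u\<in>U. r u * r u)"
      unfolding N_def by auto
    define q0 where "q0 u = r u / N" for u
    have q0_orth: "(\<Sum>u\<in>U. q0 u * q u) = 0" "(\<Sum>u\<in>U. q u * q0 u) = 0" if "q \<in> Q" for q
      using r_orth[OF that] by (simp_all add: q0_def mult.commute flip: sum_divide_distrib)
    have "(\<Sum>u\<in>U. q0 u * q0 u) = (\<Sum>u\<in>U. r u * r u) / (N * N)"
      by (simp add: q0_def sum_divide_distrib)
    also have "\<dots> = 1" using False unfolding N(2) by (rule divide_self)
    finally have q0_norm: "(\<Sum>u\<in>U. q0 u * q0 u) = 1" .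
    have "q0 \<notin> Q" using q0_orth(1)[of q0] q0_norm by auto
    have "\<exists>c. \<forall>u\<in>U. b j u = (\<Sum>q\<in>insert q0 Q. c q * q u)" if j: "j \<in> insert i B" for j
    proof (cases "j = i")
      case True
      have "b j u = (\<Sum>q\<in>insert q0 Q. (c(q0 := N)) q * q u)" for u
      proof -
        have "(\<Sum>q\<in>Q. (c(q0 := N)) q * q u) = (\<Sum>q\<in>Q. c q * q u)"
          using \<open>q0 \<notin> Q\<close> by (intro sum.cong) auto
        then show ?thesis
          using True N Q(1) \<open>q0 \<notin> Q\<close> b_i by (simp add: q0_def)
      qed
      then show ?thesis by blast
    next
      case False
      then obtain c' where c': "\<forall>u\<in>U. b j u = (\<Sum>q\<in>Q. c' q * q u)" using spn j by blast
      have "(\<Sum>q\<in>Q. (c'(q0 := 0)) q * q u) = (\<Sum>q\<in>Q. c' q * q u)" for u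
        using \<open>q0 \<notin> Q\<close> by (intro sum.cong) auto
      then have "\<forall>u\<in>U. b j u = (\<Sum>q\<in>insert q0 Q. (c'(q0 := 0)) q * q u)"
        using c' Q(1) \<open>q0 \<notin> Q\<close> by simp
      then show ?thesis by blast
    qed
    then show ?thesis
      using Q \<open>q0 \<notin> Q\<close> orth q0_orth q0_norm insert.hyps
      by (intro exI[of _ "insert q0 Q"]) auto
  qed
qed

text \<open>The trace of a positive semidefinite matrix \<open>G\<close> of rank \<open>r\<close> satisfies
  \<open>(tr G)\<^sup>2 \<le> r \<cdot> tr (G\<^sup>2)\<close>; here \<open>G\<close> is the Gram matrix of the \<open>v s\<close>. The trace and the square trace
  do not change on passing to the matrix \<open>M\<close> of the same form in an orthonormal basis of the span,
  where only \<open>r\<close> diagonal entries are left and the Cauchy-Schwarz inequality applies.\<close>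

lemma Gram_trace_le:
  fixes v :: "'s \<Rightarrow> 'u \<Rightarrow> real"
  assumes "finite B" "finite U"
    and span: "\<And>s. s \<in> S \<Longrightarrow> \<exists>c. \<forall>u\<in>U. v s u = (\<Sum>i\<in>B. c i * v i u)"
  shows "(\<Sum>s\<in>S. \<Sum>u\<in>U. (v s u)\<^sup>2)\<^sup>2 \<le> card B * (\<Sum>s\<in>S. \<Sum>t\<in>S. (\<Sum>u\<in>U. v s u * v t u)\<^sup>2)"
proof -
  obtain Q where Q: "finite Q" "card Q \<le> card B"
    and orth: "\<And>q q'. q \<in> Q \<Longrightarrow> q' \<in> Q \<Longrightarrow> (\<Sum>u\<in>U. q u * q' u) = (if q = q' then 1 else 0)"
    and spn: "\<And>i. i \<in> B \<Longrightarrow> \<exists>c. \<forall>u\<in>U. v i u = (\<Sum>q\<in>Q. c q * q u)"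
    using orthonormal_system_spanning[OF assms(1,2), of v] by blast
  have "\<exists>c. \<forall>u\<in>U. v s u = (\<Sum>q\<in>Q. c q * q u)" if s: "s \<in> S" for s
  proof -
    obtain c where c: "\<forall>u\<in>U. v s u = (\<Sum>i\<in>B. c i * v i u)" using span[OF s] by blast
    obtain d where d: "\<And>i. i \<in> B \<Longrightarrow> \<forall>u\<in>U. v i u = (\<Sum>q\<in>Q. d i q * q u)"
      using spn by metis
    have "v s u = (\<Sum>q\<in>Q. (\<Sum>i\<in>B. c i * d i q) * q u)" if "u \<in> U" for u
    proof -
      have "v s u = (\<Sum>i\<in>B. c i * (\<Sum>q\<in>Q. d i q * q u))" using c d that by simp
      also have "\<dots> = (\<Sum>q\<in>Q. (\<Sum>i\<in>B. c i * d i q) * q u)"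
        by (simp add: sum_distrib_left sum_distrib_right mult.assoc) (rule sum.swap)
      finally show ?thesis .
    qed
    then show ?thesis by (intro exI[of _ "\<lambda>q. \<Sum>i\<in>B. c i * d i q"]) blast
  qed
  then obtain c where c: "\<And>s u. s \<in> S \<Longrightarrow> u \<in> U \<Longrightarrow> v s u = (\<Sum>q\<in>Q. c s q * q u)"
    by metis
  have inner: "(\<Sum>u\<in>U. v s u * v t u) = (\<Sum>q\<in>Q. c s q * c t q)" if st: "s \<in> S" "t \<in> S" for s t
  proof -
    have "(\<Sum>u\<in>U. v s u * v t u) = (\<Sum>u\<in>U. \<Sum>q\<in>Q. \<Sum>q'\<in>Q. c s q * c t q' * (q u * q' u))"
      by (intro sum.cong refl) (simp add: c st sum_product algebra_simps)
    also have "\<dots> = (\<Sum>q\<in>Q. \<Sum>q'\<in>Q. \<Sum>u\<in>U. c s q * c t q' * (q u * q' u))"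
      by (subst sum.swap) (intro sum.cong refl sum.swap)
    also have "\<dots> = (\<Sum>q\<in>Q. \<Sum>q'\<in>Q. c s q * c t q' * (\<Sum>u\<in>U. q u * q' u))"
      by (simp add: sum_distrib_left)
    also have "\<dots> = (\<Sum>q\<in>Q. \<Sum>q'\<in>Q. if q = q' then c s q * c t q' else 0)"
      by (intro sum.cong refl) (simp add: orth)
    also have "\<dots> = (\<Sum>q\<in>Q. c s q * c t q)" using Q(1) by simp
    finally show ?thesis .
  qed
  define M where "M q q' = (\<Sum>s\<in>S. c s q * c s q')" for q q'
  have "(\<Sum>s\<in>S. \<Sum>u\<in>U. (v s u)\<^sup>2) = (\<Sum>s\<in>S. \<Sum>q\<in>Q. c s q * c s q)"
    by (intro sum.cong refl) (simp add: power2_eq_square inner)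
  also have "\<dots> = (\<Sum>q\<in>Q. M q q)" unfolding M_def by (rule sum.swap)
  finally have trace: "(\<Sum>s\<in>S. \<Sum>u\<in>U. (v s u)\<^sup>2) = (\<Sum>q\<in>Q. M q q)" .
  have "(\<Sum>q\<in>Q. M q q)\<^sup>2 = (\<Sum>q\<in>Q. 1 * M q q)\<^sup>2" by simp
  also have "\<dots> \<le> (\<Sum>q\<in>Q. 1\<^sup>2) * (\<Sum>q\<in>Q. (M q q)\<^sup>2)" by (rule Cauchy_Schwarz_ineq_sum)
  also have "\<dots> = card Q * (\<Sum>q\<in>Q. (M q q)\<^sup>2)" by simp
  also have "\<dots> \<le> card B * (\<Sum>q\<in>Q. \<Sum>q'\<in>Q. (M q q')\<^sup>2)"
    using Q by (intro mult_mono sum_mono member_le_sum) (auto intro: sum_nonneg)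
  also have "(\<Sum>q\<in>Q. \<Sum>q'\<in>Q. (M q q')\<^sup>2) = (\<Sum>q\<in>Q. \<Sum>q'\<in>Q. \<Sum>s\<in>S. \<Sum>t\<in>S. (c s q * c t q) * (c s q' * c t q'))"
    unfolding M_def power2_eq_square sum_product by (simp add: algebra_simps)
  also have "\<dots> = (\<Sum>q\<in>Q. \<Sum>s\<in>S. \<Sum>t\<in>S. \<Sum>q'\<in>Q. (c s q * c t q) * (c s q' * c t q'))"
    by (intro sum.cong refl, subst sum.swap, intro sum.cong refl sum.swap)
  also have "\<dots> = (\<Sum>s\<in>S. \<Sum>t\<in>S. \<Sum>q\<in>Q. \<Sum>q'\<in>Q. (c s q * c t q) * (c s q' * c t q'))"
    by (subst sum.swap) (intro sum.cong refl sum.swap)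
  also have "\<dots> = (\<Sum>s\<in>S. \<Sum>t\<in>S. (\<Sum>u\<in>U. v s u * v t u)\<^sup>2)"
    by (intro sum.cong refl) (simp add: inner power2_eq_square sum_product)
  finally show ?thesis unfolding trace .
qed

text \<open>An additive map is linear over the integers. Applied to the coefficients of a linear relation
  between integral vectors over \<open>'f\<close>, it yields a relation over the reals, and normalisation
  at \<open>1\<close> keeps the latter nontrivial.\<close>

lemma additive_to_real_exists:
  "\<exists>\<phi> :: 'f::field_char_0 \<Rightarrow> real. (\<forall>x y. \<phi> (x + y) = \<phi> x + \<phi> y) \<and> \<phi> 1 = 1"
proof -
  interpret vector_space_pair "\<lambda>q (x :: 'f). of_rat q * x" "\<lambda>q (x :: real). of_rat q * x"
    by unfold_locales (simp_all add: algebra_simps of_rat_add of_rat_mult)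
  have "\<not> vs1.dependent {1 :: 'f}"
    by (simp add: vs1.dependent_single)
  then obtain g where g: "Vector_Spaces.linear (\<lambda>q (x :: 'f). of_rat q * x) (\<lambda>q (x :: real). of_rat q * x) g"
      "g 1 = 1"
    using linear_independent_extend[of "{1}" "\<lambda>_. 1"] by auto
  interpret g: Vector_Spaces.linear "\<lambda>q (x :: 'f). of_rat q * x" "\<lambda>q (x :: real). of_rat q * x" g
    by fact
  show ?thesis using g(2) g.add by blast
qed

definition independent_rows :: "'s set \<Rightarrow> 'u set \<Rightarrow> ('s \<Rightarrow> 'u \<Rightarrow> 'f::field) \<Rightarrow> bool" where
  "independent_rows R U v \<longleftrightarrow>
     (\<forall>\<alpha>. (\<forall>u\<in>U. (\<Sum>s\<in>R. \<alpha> s * v s u) = 0) \<longrightarrow> (\<forall>s\<in>R. \<alpha> s = 0))"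

lemma independent_rowsD:
  "independent_rows R U v \<Longrightarrow> (\<And>u. u \<in> U \<Longrightarrow> (\<Sum>s\<in>R. \<alpha> s * v s u) = 0) \<Longrightarrow> s \<in> R \<Longrightarrow> \<alpha> s = 0"
  unfolding independent_rows_def by blast

text \<open>A maximal system of rows which are independent over \<open>'f\<close> spans all rows over the reals as
  well, so the trace inequality bounds its size from below.\<close>

lemma exists_independent_rows:
  fixes w :: "'s \<Rightarrow> 'u \<Rightarrow> nat"
  assumes "finite S" "finite U"
  shows "\<exists>R \<subseteq> S. independent_rows R U (\<lambda>s u. of_nat (w s u) :: 'f::field_char_0) \<and>
    (\<Sum>s\<in>S. \<Sum>u\<in>U. (w s u)\<^sup>2)\<^sup>2 \<le> card R * (\<Sum>s\<in>S. \<Sum>t\<in>S. (\<Sum>u\<in>U. w s u * w t u)\<^sup>2)"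
proof -
  let ?v = "\<lambda>s u. of_nat (w s u) :: 'f"
  define I where "I = {R. R \<subseteq> S \<and> independent_rows R U ?v}"
  have "finite I" using assms(1) unfolding I_def by simp
  moreover have "{} \<in> I" by (simp add: I_def independent_rows_def)
  ultimately obtain R where R: "R \<in> I" and max: "\<And>R'. R' \<in> I \<Longrightarrow> R \<subseteq> R' \<Longrightarrow> R' = R"
    using finite_has_maximal[of I] by (metis empty_iff)
  have RS: "R \<subseteq> S" "independent_rows R U ?v" using R by (auto simp: I_def)
  have finR: "finite R" using RS(1) assms(1) by (rule finite_subset)
  obtain \<phi> :: "'f \<Rightarrow> real" where \<phi>: "\<And>x y. \<phi> (x + y) = \<phi> x + \<phi> y" "\<phi> 1 = 1"
    using additive_to_real_exists by blast
  have \<phi>0: "\<phi> 0 = 0" using \<phi>(1)[of 0 0] by simp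
  have \<phi>sum: "\<phi> (\<Sum>i\<in>T. f i) = (\<Sum>i\<in>T. \<phi> (f i))" for f and T :: "'s set"
    by (induction T rule: infinite_finite_induct) (simp_all add: \<phi> \<phi>0)
  have \<phi>nat: "\<phi> (x * of_nat m) = \<phi> x * of_nat m" for x m
    by (induction m) (simp_all add: \<phi> \<phi>0 algebra_simps)
  have "\<exists>c. \<forall>u\<in>U. real (w s u) = (\<Sum>i\<in>R. c i * real (w i u))" if s: "s \<in> S" for s
  proof (cases "s \<in> R")
    case True
    have "real (w s u) = (\<Sum>i\<in>R. (if i = s then 1 else 0) * real (w i u))" for u
    proof -
      have "(\<Sum>i\<in>R. (if i = s then 1 else 0) * real (w i u)) = (\<Sum>i\<in>R. if i = s then real (w s u) else 0)"
        by (intro sum.cong) auto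
      then show ?thesis using True finR by simp
    qed
    then show ?thesis by (intro exI[of _ "\<lambda>i. if i = s then 1 else 0"]) blast
  next
    case False
    with max[of "insert s R"] have "insert s R \<notin> I" by auto
    then have "\<not> independent_rows (insert s R) U ?v" using s RS by (simp add: I_def)
    then obtain \<alpha> where \<alpha>: "\<And>u. u \<in> U \<Longrightarrow> (\<Sum>i\<in>insert s R. \<alpha> i * ?v i u) = 0"
        and nz: "\<exists>i\<in>insert s R. \<alpha> i \<noteq> 0"
      unfolding independent_rows_def by blast
    have "\<alpha> s \<noteq> 0"
    proof
      assume "\<alpha> s = 0"
      then have "(\<Sum>i\<in>R. \<alpha> i * ?v i u) = 0" if "u \<in> U" for u
        using \<alpha>[OF that] finR False by simp
      then have "\<forall>i\<in>R. \<alpha> i = 0" using independent_rowsD[OF RS(2)] by blast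
      with nz \<open>\<alpha> s = 0\<close> show False by auto
    qed
    have "real (w s u) = (\<Sum>i\<in>R. - \<phi> (\<alpha> i / \<alpha> s) * real (w i u))" if "u \<in> U" for u
    proof -
      have "(\<Sum>i\<in>insert s R. (\<alpha> i / \<alpha> s) * ?v i u) = (\<Sum>i\<in>insert s R. \<alpha> i * ?v i u) / \<alpha> s"
        by (simp add: sum_divide_distrib)
      then have "\<phi> (\<Sum>i\<in>insert s R. (\<alpha> i / \<alpha> s) * ?v i u) = 0"
        using \<alpha>[OF that] \<phi>0 by simp
      then have "(\<Sum>i\<in>insert s R. \<phi> (\<alpha> i / \<alpha> s) * real (w i u)) = 0"
        by (simp only: \<phi>sum \<phi>nat)
      then have "real (w s u) + (\<Sum>i\<in>R. \<phi> (\<alpha> i / \<alpha> s) * real (w i u)) = 0"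
        unfolding sum.insert[OF finR False] divide_self[OF \<open>\<alpha> s \<noteq> 0\<close>] \<phi>(2) mult_1 .
      then have "real (w s u) = - (\<Sum>i\<in>R. \<phi> (\<alpha> i / \<alpha> s) * real (w i u))" by linarith
      then show ?thesis unfolding mult_minus_left sum_negf .
    qed
    then show ?thesis by (intro exI[of _ "\<lambda>i. - \<phi> (\<alpha> i / \<alpha> s)"]) blast
  qed
  then have "(\<Sum>s\<in>S. \<Sum>u\<in>U. (real (w s u))\<^sup>2)\<^sup>2
      \<le> card R * (\<Sum>s\<in>S. \<Sum>t\<in>S. (\<Sum>u\<in>U. real (w s u) * real (w t u))\<^sup>2)"
    by (rule Gram_trace_le[OF finR assms(2)])
  then have "real ((\<Sum>s\<in>S. \<Sum>u\<in>U. (w s u)\<^sup>2)\<^sup>2)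
      \<le> real (card R * (\<Sum>s\<in>S. \<Sum>t\<in>S. (\<Sum>u\<in>U. w s u * w t u)\<^sup>2))"
    by simp
  then have "(\<Sum>s\<in>S. \<Sum>u\<in>U. (w s u)\<^sup>2)\<^sup>2
      \<le> card R * (\<Sum>s\<in>S. \<Sum>t\<in>S. (\<Sum>u\<in>U. w s u * w t u)\<^sup>2)"
    unfolding of_nat_le_iff .
  with RS show ?thesis by (intro exI[of _ R] conjI)
qed

section \<open>Closed trails and the rank of their incidence matrix\<close>

text \<open>A labelling sends each variable to an edge, i.e. a pair of its tail and its head; an ordering of
  the variables then spells out a list of edges.\<close>

fun trail :: "'v \<Rightarrow> 'v \<Rightarrow> ('v \<times> 'v) list \<Rightarrow> bool" where
  "trail p q [] \<longleftrightarrow> p = q"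
| "trail p q (e # es) \<longleftrightarrow> fst e = p \<and> trail (snd e) q es"

text \<open>The interior vertices of a trail along \<open>xs\<close> can be prescribed arbitrarily.\<close>

lemma card_trail_labellings_ge:
  assumes "distinct xs" "finite V" "p \<in> V" "q \<in> V" "xs = [] \<Longrightarrow> p = q"
  shows "card V ^ (length xs - 1) \<le> card {u \<in> set xs \<rightarrow>\<^sub>E V \<times> V. trail p q (map u xs)}"
  using assms(1,3,5)
proof (induction xs arbitrary: p)
  case Nil
  then show ?case by (simp add: PiE_empty_domain)
next
  case (Cons x xs)
  show ?case
  proof (cases "xs = []")
    case True
    have "{(\<lambda>y. undefined)(x := (p, q))} \<subseteq> {u \<in> set (x # xs) \<rightarrow>\<^sub>E V \<times> V. trail p q (map u (x # xs))}"
      using True Cons.prems assms(4) by (auto simp: PiE_iff extensional_def)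
    then have "card {(\<lambda>y. undefined)(x := (p, q))}
        \<le> card {u \<in> set (x # xs) \<rightarrow>\<^sub>E V \<times> V. trail p q (map u (x # xs))}"
      using assms(2) by (intro card_mono finite_subset[OF _ finite_PiE[of "set (x # xs)" "\<lambda>_. V \<times> V"]]) auto
    then show ?thesis using True by simp
  next
    case False
    let ?T = "\<lambda>c. {u \<in> set xs \<rightarrow>\<^sub>E V \<times> V. trail c q (map u xs)}"
    let ?f = "\<lambda>(c, u). u(x := (p, c))"
    have x: "x \<notin> set xs" using Cons.prems by simp
    have fin: "finite (?T c)" for c
      using assms(2) by (intro finite_subset[OF _ finite_PiE[of "set xs" "\<lambda>_. V \<times> V"]]) auto
    have "card V ^ (length (x # xs) - 1) = (\<Sum>c\<in>V. card V ^ (length xs - 1))"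
      using False by (cases xs) simp_all
    also have "\<dots> \<le> (\<Sum>c\<in>V. card (?T c))"
      using Cons False by (intro sum_mono) auto
    also have "\<dots> = card (Sigma V ?T)" using assms(2) fin by simp
    also have "\<dots> \<le> card {u \<in> set (x # xs) \<rightarrow>\<^sub>E V \<times> V. trail p q (map u (x # xs))}"
    proof (rule card_inj_on_le[of ?f])
      show "inj_on ?f (Sigma V ?T)"
      proof (rule inj_onI, clarify)
        fix c u c' u'
        assume u: "u \<in> set xs \<rightarrow>\<^sub>E V \<times> V" "u' \<in> set xs \<rightarrow>\<^sub>E V \<times> V"
          and eq: "u(x := (p, c)) = u'(x := (p, c'))"
        have "u y = u' y" for y
          using fun_cong[OF eq, of y] u x by (cases "y = x") (auto simp: PiE_iff extensional_def)
        moreover have "c = c'" using fun_cong[OF eq, of x] by simp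
        ultimately show "c = c' \<and> u = u'" by blast
      qed
      show "?f ` Sigma V ?T \<subseteq> {u \<in> set (x # xs) \<rightarrow>\<^sub>E V \<times> V. trail p q (map u (x # xs))}"
      proof clarify
        fix c u assume c: "c \<in> V" and u: "u \<in> set xs \<rightarrow>\<^sub>E V \<times> V" "trail c q (map u xs)"
        have "map (u(x := (p, c))) xs = map u xs" using x by (intro map_cong) auto
        then have "trail p q (map (u(x := (p, c))) (x # xs))"
          using u(2) by (simp del: map_eq_conv)
        moreover have "u(x := (p, c)) \<in> set (x # xs) \<rightarrow>\<^sub>E V \<times> V"
          using u(1) c Cons.prems by (auto simp: PiE_iff extensional_def)
        ultimately show "u(x := (p, c)) \<in> set (x # xs) \<rightarrow>\<^sub>E V \<times> V \<and>
            trail p q (map (u(x := (p, c))) (x # xs))" by blast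
      qed
      show "finite {u \<in> set (x # xs) \<rightarrow>\<^sub>E V \<times> V. trail p q (map u (x # xs))}"
        using assms(2) by (intro finite_subset[OF _ finite_PiE[of "set (x # xs)" "\<lambda>_. V \<times> V"]]) auto
    qed
    finally show ?thesis .
  qed
qed

lemma trail_determined_by_tails:
  assumes "trail p q (map u xs)" "trail p' q (map u' xs)"
    and "\<And>x. x \<in> set xs \<Longrightarrow> fst (u x) = fst (u' x)" and "x \<in> set xs"
  shows "u x = u' x"
  using assms
proof (induction xs arbitrary: p p')
  case (Cons y ys)
  have "snd (u y) = snd (u' y)"
    using Cons.prems(1-3) by (cases ys) auto
  then show ?case using Cons by (auto simp: prod_eq_iff)
qed simp

text \<open>Reading the exit lists off a directed graph is how a trail is traversed: at each vertex take
  the next unused edge from the exit list of that vertex. Here two trails are traversed at once.\<close>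

lemma trail_determined_by_exit_lists:
  assumes "trail p q (map u ys)" "trail p' q' (map u' ys)"
    and "trail p q (map u zs)" "trail p' q' (map u' zs)"
    and "\<And>c. filter (\<lambda>x. (fst (u x), fst (u' x)) = c) ys = filter (\<lambda>x. (fst (u x), fst (u' x)) = c) zs"
  shows "ys = zs"
  using assms
proof (induction ys arbitrary: zs p p')
  case Nil
  show ?case
  proof (cases zs)
    case (Cons z zs')
    then show ?thesis using Nil(5)[of "(fst (u z), fst (u' z))"] by simp
  qed simp
next
  case (Cons y ys)
  let ?t = "\<lambda>x. (fst (u x), fst (u' x))"
  have ty: "?t y = (p, p')" using Cons.prems by simp
  obtain z zs' where zs: "zs = z # zs'"
    using Cons.prems(5)[of "?t y"] by (cases zs) auto
  have tz: "?t z = (p, p')" using Cons.prems zs by simp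
  have "y = z" using Cons.prems(5)[of "(p, p')"] ty tz zs by simp
  moreover have "ys = zs'"
  proof (rule Cons.IH)
    show "filter (\<lambda>x. ?t x = c) ys = filter (\<lambda>x. ?t x = c) zs'" for c
      using Cons.prems(5)[of c] zs \<open>y = z\<close> by (cases "?t z = c") simp_all
  qed (use Cons.prems zs \<open>y = z\<close> in auto)
  ultimately show ?case using zs by simp
qed

text \<open>A pair of labellings along both of which \<open>xs\<close> is a closed trail labels the variables by edges of
  a graph on \<open>V \<times> V\<close>. The number of rearrangements \<open>ys\<close> which are closed trails for the same labels is
  at most the product of the factorials of the out-degrees, as \<open>ys\<close> is determined by its exit lists.
  The pair itself is determined by the tails of the edges. So the sum is at most the sum of
  multinomial coefficients times these products, i.e. \<open>n!\<close> for each sequence of out-degrees. The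
  injection in the proof packages this: concatenated exit lists form a permutation of \<open>X\<close>,
  and the out-degrees tell where to cut it.\<close>

lemma sum_common_trails_le:
  fixes V :: "'v set" and X :: "'x set"
  assumes "finite X" "finite V" "xs \<in> permutations_of_set X"
  defines "U \<equiv> X \<rightarrow>\<^sub>E V \<times> V"
  shows "(\<Sum>ys\<in>permutations_of_set X. (card {u \<in> U. trail b b (map u xs) \<and> trail b b (map u ys)})\<^sup>2)
      \<le> fact (card X) * (card X + 1) ^ ((card V)\<^sup>2)"
proof -
  let ?T = "\<lambda>ys. {u \<in> U. trail b b (map u xs) \<and> trail b b (map u ys)}"
  let ?P = "permutations_of_set X"
  have finU: "finite U" unfolding U_def using assms by (intro finite_PiE) auto
  obtain vs where vs: "set vs = V \<times> V" "distinct vs"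
    using finite_distinct_list[of "V \<times> V"] assms(2) by auto
  have len_vs: "length vs = (card V)\<^sup>2"
    using distinct_card[OF vs(2)] vs(1) by (simp add: card_cartesian_product power2_eq_square)
  define t where "t u u' x = (fst (u x), fst (u' x))" for u u' :: "'x \<Rightarrow> 'v \<times> 'v" and x
  define ex where "ex = (\<lambda>(ys, u, u'). map (\<lambda>c. filter (\<lambda>x. t u u' x = c) ys) vs)"
  define f where "f z = (map length (ex z), concat (ex z))" for z
  let ?D = "Sigma ?P (\<lambda>ys. ?T ys \<times> ?T ys)"
  let ?M = "{ms. set ms \<subseteq> {..card X} \<and> length ms = (card V)\<^sup>2}"
  have t_in: "t u u' x \<in> V \<times> V" if "u \<in> U" "u' \<in> U" "x \<in> X" for u u' x
    using that unfolding U_def t_def by (auto simp: PiE_iff mem_Times_iff)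
  have "inj_on f ?D"
  proof (rule inj_onI)
    fix d1 d2 assume d: "d1 \<in> ?D" "d2 \<in> ?D" "f d1 = f d2"
    obtain ys u u' zs v v' where d12: "d1 = (ys, u, u')" "d2 = (zs, v, v')"
      by (metis prod_cases3)
    have ys: "ys \<in> ?P" "u \<in> U" "u' \<in> U" and zs: "zs \<in> ?P" "v \<in> U" "v' \<in> U"
      and tr: "trail b b (map u xs)" "trail b b (map u ys)" "trail b b (map u' xs)" "trail b b (map u' ys)"
        "trail b b (map v xs)" "trail b b (map v zs)" "trail b b (map v' xs)" "trail b b (map v' zs)"
      and eq: "f (ys, u, u') = f (zs, v, v')"
      using d unfolding d12 by auto
    let ?a = "ex (ys, u, u')" and ?b = "ex (zs, v, v')"
    have len: "map length ?a = map length ?b" and con: "concat ?a = concat ?b"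
      using eq by (simp_all add: f_def)
    have l1: "length ?a = length ?b" by (simp add: ex_def)
    have "\<forall>(x, y)\<in>set (zip ?a ?b). length x = length y"
    proof clarify
      fix x y assume "(x, y) \<in> set (zip ?a ?b)"
      then obtain i where "i < length ?a" "i < length ?b" "x = ?a ! i" "y = ?b ! i"
        by (auto simp: in_set_zip)
      then show "length x = length y" using len by (metis nth_map)
    qed
    then have "?a = ?b" using concat_injective[OF con l1] by blast
    then have ex_V: "filter (\<lambda>x. t u u' x = c) ys = filter (\<lambda>x. t v v' x = c) zs" if "c \<in> V \<times> V" for c
      using that vs(1) by (auto simp: ex_def)
    have sets: "set ys = X" "set zs = X" "set xs = X"
      using ys(1) zs(1) assms(3) by (auto dest: permutations_of_setD)
    have t_eq: "t u u' x = t v v' x" if x: "x \<in> X" for x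
    proof -
      have "x \<in> set (filter (\<lambda>y. t u u' y = t u u' x) ys)" using x sets by simp
      also have "filter (\<lambda>y. t u u' y = t u u' x) ys = filter (\<lambda>y. t v v' y = t u u' x) zs"
        using ex_V t_in[OF ys(2,3) x] .
      finally show ?thesis by simp
    qed
    have "u x = v x" "u' x = v' x" if "x \<in> X" for x
      using trail_determined_by_tails[OF tr(1,5)] trail_determined_by_tails[OF tr(3,7)]
        t_eq sets that by (auto simp: t_def)
    then have uv: "u = v" "u' = v'"
      using ys zs unfolding U_def by (auto intro!: ext simp: PiE_iff extensional_def) metis+
    have "filter (\<lambda>x. t u u' x = c) ys = filter (\<lambda>x. t u u' x = c) zs" for c
    proof (cases "c \<in> V \<times> V")
      case True then show ?thesis using ex_V uv by blast
    next
      case False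
      then have "\<forall>x\<in>X. t u u' x \<noteq> c" using t_in ys by blast
      then show ?thesis using sets by (metis (mono_tags, lifting) filter_False)
    qed
    then have "ys = zs"
      using trail_determined_by_exit_lists[OF tr(2,4)] tr(6,8) uv unfolding t_def by blast
    with uv show "d1 = d2" unfolding d12 by blast
  qed
  moreover have "f ` ?D \<subseteq> ?M \<times> ?P"
  proof (rule image_subsetI)
    fix d1 assume "d1 \<in> ?D"
    then obtain ys u u' where d1: "d1 = (ys, u, u')" and ys: "ys \<in> ?P" "u \<in> U" "u' \<in> U"
      by blast
    obtain ms zs where fz: "f (ys, u, u') = (ms, zs)" by (rule prod.exhaust)
    have d: "distinct ys" "set ys = X" using ys(1) by (auto dest: permutations_of_setD)
    have "length ys = card X" using d distinct_card by fastforce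
    then have "length (filter P ys) \<le> card X" for P
      using length_filter_le[of P ys] by simp
    then have ms: "ms \<in> ?M" using fz len_vs by (auto simp: f_def ex_def)
    have zs_eq: "zs = concat (map (\<lambda>c. filter (\<lambda>x. t u u' x = c) ys) vs)"
      using fz by (simp add: f_def ex_def)
    have "distinct zs"
      unfolding zs_eq using vs(2) d(1)
      by (induction vs) auto
    moreover have "set zs = X"
      unfolding zs_eq using t_in[OF ys(2,3)] d(2) vs(1) by auto
    ultimately have "zs \<in> ?P" by blast
    with ms show "f d1 \<in> ?M \<times> ?P" unfolding d1 fz by blast
  qed
  moreover have "finite (?M \<times> ?P)"
    using assms(1) by (intro finite_cartesian_product finite_lists_length_eq) auto
  ultimately have "card ?D \<le> card (?M \<times> ?P)" by (rule card_inj_on_le)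
  also have "\<dots> = (card X + 1) ^ ((card V)\<^sup>2) * fact (card X)"
    using assms(1) by (simp add: card_cartesian_product card_lists_length_eq)
  finally have "card ?D \<le> (card X + 1) ^ ((card V)\<^sup>2) * fact (card X)" .
  moreover have "card ?D = (\<Sum>ys\<in>?P. (card (?T ys))\<^sup>2)"
    using finU assms(1) by (subst card_SigmaI) (auto simp: card_cartesian_product power2_eq_square)
  ultimately show ?thesis by (simp add: mult.commute)
qed

text \<open>The rank is at least the quotient of the squared trace of the Gram matrix by its square trace.
  With \<open>n\<close> variables and \<open>k\<close> vertices, the trace is at least
  \<open>n! k\<^sup>n\<^sup>-\<^sup>1\<close>, and the square trace is at most \<open>(n!)\<^sup>2 (n + 1)\<^sup>s\<close> with \<open>s = k\<^sup>2\<close>, so that the quotient is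
  \<open>k\<^sup>2\<^sup>n\<close> up to a polynomial factor.\<close>

lemma exists_independent_closed_trails:
  fixes V :: "'v set" and X :: "'x set"
  assumes "finite X" "finite V" "b \<in> V"
  shows "\<exists>R \<subseteq> permutations_of_set X.
    independent_rows R (X \<rightarrow>\<^sub>E V \<times> V) (\<lambda>xs u. if trail b b (map u xs) then 1 else 0 :: 'f::field_char_0) \<and>
    ((card V)\<^sup>2) ^ card X \<le> card R * ((card V)\<^sup>2 * (card X + 1) ^ ((card V)\<^sup>2))"
proof -
  let ?P = "permutations_of_set X" and ?U = "X \<rightarrow>\<^sub>E V \<times> V"
  let ?n = "card X" and ?k = "card V"
  let ?w = "\<lambda>xs u. if trail b b (map u xs) then 1 else 0 :: nat"
  (* For empty X the truncated exponent gives the right value 1: the empty list is a closed trail. *)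
  let ?N = "?k ^ (?n - 1)" and ?B = "(?n + 1) ^ (?k\<^sup>2)"
  have finU: "finite ?U" using assms by (intro finite_PiE) auto
  have "finite ?P" using assms(1) by simp
  from exists_independent_rows[OF this finU, of ?w]
  obtain R where R: "R \<subseteq> ?P" "independent_rows R ?U (\<lambda>s u. of_nat (?w s u) :: 'f)"
    and rank: "(\<Sum>xs\<in>?P. \<Sum>u\<in>?U. (?w xs u)\<^sup>2)\<^sup>2
      \<le> card R * (\<Sum>xs\<in>?P. \<Sum>ys\<in>?P. (\<Sum>u\<in>?U. ?w xs u * ?w ys u)\<^sup>2)"
    by blast
  have "?N \<le> (\<Sum>u\<in>?U. (?w xs u)\<^sup>2)" if "xs \<in> ?P" for xs
  proof -
    have xs: "set xs = X" "distinct xs"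
      using that by (auto dest: permutations_of_setD)
    then have "length xs = ?n" using distinct_card by fastforce
    have "?N \<le> card {u \<in> ?U. trail b b (map u xs)}"
      using card_trail_labellings_ge[OF xs(2) assms(2,3,3)] xs \<open>length xs = ?n\<close> by simp
    also have "\<dots> = (\<Sum>u\<in>?U. (?w xs u)\<^sup>2)"
      using finU by (simp add: if_distrib[of "\<lambda>x. x\<^sup>2"] sum.If_cases Int_def cong: if_cong)
    finally show ?thesis .
  qed
  then have "(\<Sum>xs\<in>?P. ?N) \<le> (\<Sum>xs\<in>?P. \<Sum>u\<in>?U. (?w xs u)\<^sup>2)" by (rule sum_mono)
  then have "(fact ?n * ?N)\<^sup>2 \<le> (\<Sum>xs\<in>?P. \<Sum>u\<in>?U. (?w xs u)\<^sup>2)\<^sup>2"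
    using assms(1) by (intro power_mono) simp_all
  also note rank
  also have "(\<Sum>xs\<in>?P. \<Sum>ys\<in>?P. (\<Sum>u\<in>?U. ?w xs u * ?w ys u)\<^sup>2) \<le> (\<Sum>xs\<in>?P. fact ?n * ?B)"
  proof (rule sum_mono)
    fix xs assume xs: "xs \<in> ?P"
    have "(\<Sum>u\<in>?U. ?w xs u * ?w ys u) = card {u \<in> ?U. trail b b (map u xs) \<and> trail b b (map u ys)}" for ys
    proof -
      have "(\<Sum>u\<in>?U. ?w xs u * ?w ys u) = (\<Sum>u\<in>?U. if trail b b (map u xs) \<and> trail b b (map u ys) then 1 else 0)"
        by (intro sum.cong) auto
      then show ?thesis using finU by (simp add: sum.If_cases Int_def)
    qed
    then show "(\<Sum>ys\<in>?P. (\<Sum>u\<in>?U. ?w xs u * ?w ys u)\<^sup>2) \<le> fact ?n * ?B"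
      using sum_common_trails_le[OF assms(1,2) xs, of b] by simp
  qed
  also have "(\<Sum>xs\<in>?P. fact ?n * ?B) = (fact ?n)\<^sup>2 * ?B"
    using assms(1) by (simp add: power2_eq_square)
  finally have "(fact ?n)\<^sup>2 * ?N\<^sup>2 \<le> (fact ?n)\<^sup>2 * (card R * ?B)"
    by (simp add: power_mult_distrib algebra_simps)
  then have N: "?N\<^sup>2 \<le> card R * ?B" by simp
  have "?k > 0" using assms by (auto simp: card_gt_0_iff)
  have "(?k\<^sup>2) ^ ?n \<le> (?k\<^sup>2) ^ (?n - 1 + 1)"
    using \<open>?k > 0\<close> by (intro power_increasing) auto
  also have "\<dots> = ?k\<^sup>2 * ?N\<^sup>2" by (simp add: power_mult[symmetric] mult.commute)
  also have "\<dots> \<le> ?k\<^sup>2 * (card R * ?B)" using N by simp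
  finally have "(?k\<^sup>2) ^ ?n \<le> card R * (?k\<^sup>2 * ?B)" by (simp add: algebra_simps)
  moreover have w_eq: "(\<lambda>s u. of_nat (?w s u) :: 'f) = (\<lambda>s u. if trail b b (map u s) then 1 else 0)"
    by (intro ext) simp
  have "independent_rows R ?U (\<lambda>xs u. if trail b b (map u xs) then 1 else 0 :: 'f)"
    using R(2) unfolding w_eq .
  ultimately show ?thesis using R(1) by (intro exI[of _ R] conjI)
qed

text \<open>A system of colours: for each colour a finite set of vertices and a base vertex in it.\<close>

definition colour_system :: "('v set \<times> 'v) list \<Rightarrow> bool" where
  "colour_system cs \<longleftrightarrow> (\<forall>(V, b)\<in>set cs. finite V \<and> b \<in> V) \<and>
     sorted_wrt (\<lambda>(V, _) (V', _). V \<inter> V' = {}) cs"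

definition coloured_edges :: "('v set \<times> 'v) list \<Rightarrow> ('v \<times> 'v) set" where
  "coloured_edges cs = (\<Union>(V, b)\<in>set cs. V \<times> V)"

definition closed_trails :: "('v set \<times> 'v) list \<Rightarrow> ('x \<Rightarrow> 'v \<times> 'v) \<Rightarrow> 'x list list \<Rightarrow> bool" where
  "closed_trails cs u ws \<longleftrightarrow> list_all2 (\<lambda>(V, b) w. trail b b (map u w)) cs ws"

text \<open>As no edge leaves a colour, a trail which starts in a colour uses edges of that colour only.\<close>

lemma trail_stays_in_colour:
  assumes "trail p q (map u w)" "p \<in> V"
    and "\<And>x. x \<in> set w \<Longrightarrow> u x \<in> E" and "\<And>e. e \<in> E \<Longrightarrow> fst e \<in> V \<Longrightarrow> snd e \<in> V"
    and "x \<in> set w"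
  shows "fst (u x) \<in> V \<and> snd (u x) \<in> V"
  using assms(1-3,5)
proof (induction w arbitrary: p)
  case (Cons y w)
  have "fst (u y) \<in> V" "snd (u y) \<in> V" using Cons.prems assms(4)[of "u y"] by auto
  then show ?case using Cons.IH[of "snd (u y)"] Cons.prems by auto
qed simp

lemma disjoint_coloured_edges:
  assumes "colour_system ((V, b) # cs)" "e \<in> coloured_edges cs"
  shows "fst e \<notin> V" "snd e \<notin> V"
proof -
  obtain V' b' where V': "(V', b') \<in> set cs" "fst e \<in> V'" "snd e \<in> V'"
    using assms(2) by (auto simp: coloured_edges_def)
  then have "V \<inter> V' = {}" using assms(1) by (auto simp: colour_system_def)
  with V' show "fst e \<notin> V" "snd e \<notin> V" by blast+
qed

lemma closed_trails_avoid_other_colour: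
  assumes "colour_system ((V, b) # cs)" "closed_trails cs u ws"
    and u: "\<And>x. x \<in> set (concat ws) \<Longrightarrow> u x \<in> coloured_edges ((V, b) # cs)"
    and x: "x \<in> set (concat ws)"
  shows "fst (u x) \<notin> V"
proof -
  obtain w where w: "w \<in> set ws" "x \<in> set w" using x by auto
  have l2: "list_all2 (\<lambda>(V, b) w. trail b b (map u w)) cs ws"
    using assms(2) by (simp add: closed_trails_def)
  obtain i where i: "i < length ws" "ws ! i = w"
    using w(1) by (auto simp: in_set_conv_nth)
  have "i < length cs" using i(1) list_all2_lengthD[OF l2] by simp
  obtain V' b' where Vb: "cs ! i = (V', b')" by (rule prod.exhaust)
  have tr: "trail b' b' (map u w)"
    using list_all2_nthD2[OF l2 i(1)] i(2) Vb by simp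
  have in_cs: "(V', b') \<in> set cs" using nth_mem[OF \<open>i < length cs\<close>] Vb by simp
  have "b' \<in> V'" and disj: "V \<inter> V' = {}"
    using assms(1) in_cs by (auto simp: colour_system_def)
  have "fst (u x) \<in> - V \<and> snd (u x) \<in> - V"
  proof (rule trail_stays_in_colour[OF tr])
    show "b' \<in> - V" using \<open>b' \<in> V'\<close> disj by blast
    show "u y \<in> coloured_edges ((V, b) # cs)" if "y \<in> set w" for y
      using that w(1) u by auto
    show "snd e \<in> - V" if "e \<in> coloured_edges ((V, b) # cs)" "fst e \<in> - V" for e
      using that disjoint_coloured_edges[OF assms(1), of e] by (auto simp: coloured_edges_def)
  qed (use w in simp)
  then show ?thesis by simp
qed

text \<open>Rows are families of words, one for each colour, which use each variable exactly once.
  For a fixed partition of the variables among the colours the incidence matrix is a tensor product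
  of matrices for the single colours, and the rows of different partitions have disjoint supports. So,
  when a colour is split off, the number of rows is a sum over the sets \<open>Y\<close> of its variables, and
  the binomial theorem adds the squares of the numbers of vertices.\<close>

lemma exists_independent_coloured_trails:
  fixes X :: "'x set" and cs :: "('v set \<times> 'v) list"
  assumes "finite X" "colour_system cs"
  shows "\<exists>R. finite R \<and>
    (\<forall>ws\<in>R. length ws = length cs \<and> distinct (concat ws) \<and> set (concat ws) = X) \<and>
    independent_rows R (X \<rightarrow>\<^sub>E coloured_edges cs)
      (\<lambda>ws u. if closed_trails cs u ws then 1 else 0 :: 'f::field_char_0) \<and>
    (\<Sum>(V, b)\<leftarrow>cs. (card V)\<^sup>2) ^ card X
      \<le> card R * (\<Prod>(V, b)\<leftarrow>cs. (card V)\<^sup>2 * (card X + 1) ^ ((card V)\<^sup>2))"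
  using assms
proof (induction cs arbitrary: X)
  case Nil
  (* Without colours there is one row if there are no variables, and none otherwise. *)
  let ?R = "if X = {} then {[]} else {} :: 'x list list set"
  have "independent_rows ?R (X \<rightarrow>\<^sub>E coloured_edges [])
      (\<lambda>ws u. if closed_trails [] u ws then 1 else 0 :: 'f)"
    by (auto simp: independent_rows_def closed_trails_def)
  moreover have "0 ^ card X \<le> card ?R"
    using Nil.prems by (cases "X = {}") (auto simp: zero_power card_gt_0_iff)
  ultimately show ?case by (intro exI[of _ ?R] conjI) simp_all
next
  case (Cons c cs)
  obtain V b where c: "c = (V, b)" by (rule prod.exhaust)
  note cols = Cons.prems(2)[unfolded c]
  have V: "finite V" "b \<in> V" and cols': "colour_system cs"
    using cols by (auto simp: colour_system_def)
  let ?v1 = "\<lambda>w u. if trail b b (map u w) then 1 else 0 :: 'f"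
  let ?v2 = "\<lambda>ws u. if closed_trails cs u ws then 1 else 0 :: 'f"
  let ?v = "\<lambda>ws u. if closed_trails (c # cs) u ws then 1 else 0 :: 'f"
  define a where "a = (card V)\<^sup>2"
  define d where "d = (\<Sum>(V, b)\<leftarrow>cs. (card V)\<^sup>2)"
  define pa where "pa n = a * (n + 1) ^ a" for n :: nat
  define pd where "pd n = (\<Prod>(V, b)\<leftarrow>cs. (card V)\<^sup>2 * (n + 1) ^ ((card V)\<^sup>2))" for n :: nat
  have "\<exists>R \<subseteq> permutations_of_set Y. independent_rows R (Y \<rightarrow>\<^sub>E V \<times> V) ?v1 \<and> a ^ card Y \<le> card R * pa (card Y)"
    if "Y \<subseteq> X" for Y
    using exists_independent_closed_trails[OF finite_subset[OF that Cons.prems(1)] V]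
    unfolding a_def pa_def .
  then obtain R1 where R1: "\<And>Y. Y \<subseteq> X \<Longrightarrow> R1 Y \<subseteq> permutations_of_set Y"
      "\<And>Y. Y \<subseteq> X \<Longrightarrow> independent_rows (R1 Y) (Y \<rightarrow>\<^sub>E V \<times> V) ?v1"
      "\<And>Y. Y \<subseteq> X \<Longrightarrow> a ^ card Y \<le> card (R1 Y) * pa (card Y)"
    by metis
  have "\<exists>R. finite R \<and> (\<forall>ws\<in>R. length ws = length cs \<and> distinct (concat ws) \<and> set (concat ws) = X - Y) \<and>
      independent_rows R ((X - Y) \<rightarrow>\<^sub>E coloured_edges cs) ?v2 \<and> d ^ card (X - Y) \<le> card R * pd (card (X - Y))" for Y
    using Cons.IH[OF finite_Diff[OF Cons.prems(1)] cols'] unfolding d_def pd_def .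
  then obtain R2 where R2: "\<And>Y. finite (R2 Y)"
      "\<And>Y ws. ws \<in> R2 Y \<Longrightarrow> length ws = length cs \<and> distinct (concat ws) \<and> set (concat ws) = X - Y"
      "\<And>Y. independent_rows (R2 Y) ((X - Y) \<rightarrow>\<^sub>E coloured_edges cs) ?v2"
      "\<And>Y. d ^ card (X - Y) \<le> card (R2 Y) * pd (card (X - Y))"
    by metis
  have R1_set: "set w = Y" "distinct w" if "w \<in> R1 Y" "Y \<subseteq> X" for w Y
    using R1(1)[OF that(2)] that(1) by (auto dest: permutations_of_setD)
  have finR1: "finite (R1 Y)" if "Y \<subseteq> X" for Y
    using R1(1)[OF that] finite_subset[OF that Cons.prems(1)]
    by (metis finite_permutations_of_set finite_subset)
  define S where "S = Sigma (Pow X) (\<lambda>Y. R1 Y \<times> R2 Y)"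
  define f where "f = (\<lambda>(Y :: 'x set, w :: 'x list, ws). w # ws)"
  have finS: "finite S"
    unfolding S_def using Cons.prems(1) finR1 R2(1) by auto
  have inj: "inj_on f S"
    unfolding S_def f_def by (rule inj_onI) (auto dest: R1_set)
  let ?R = "f ` S"
  have "\<forall>ws\<in>?R. length ws = length (c # cs) \<and> distinct (concat ws) \<and> set (concat ws) = X"
  proof
    fix ws' assume "ws' \<in> ?R"
    then obtain Y w ws where "Y \<subseteq> X" "w \<in> R1 Y" "ws \<in> R2 Y" "ws' = w # ws"
      by (auto simp: S_def f_def)
    then show "length ws' = length (c # cs) \<and> distinct (concat ws') \<and> set (concat ws') = X"
      using R1_set[of w Y] R2(2)[of ws Y] by auto
  qed
  moreover have "finite ?R" using finS by simp
  moreover have "independent_rows ?R (X \<rightarrow>\<^sub>E coloured_edges (c # cs)) ?v"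
    unfolding independent_rows_def
  proof (intro allI impI ballI)
    fix \<alpha> ws0
    assume zero: "\<forall>u\<in>X \<rightarrow>\<^sub>E coloured_edges (c # cs). (\<Sum>ws\<in>?R. \<alpha> ws * ?v ws u) = 0"
      and "ws0 \<in> ?R"
    then obtain Y w0 ws1 where Y: "Y \<subseteq> X" and ws0: "w0 \<in> R1 Y" "ws1 \<in> R2 Y" "ws0 = w0 # ws1"
      by (auto simp: S_def f_def)
    have prod_zero: "(\<Sum>w\<in>R1 Y. (\<Sum>ws\<in>R2 Y. \<alpha> (w # ws) * ?v2 ws u2) * ?v1 w u1) = 0"
      if u1: "u1 \<in> Y \<rightarrow>\<^sub>E V \<times> V" and u2: "u2 \<in> (X - Y) \<rightarrow>\<^sub>E coloured_edges cs" for u1 u2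
    proof -
      define u where "u x = (if x \<in> Y then u1 x else u2 x)" for x
      have u_Y: "u x \<in> V \<times> V" if "x \<in> Y" for x
        using that u1 by (auto simp: u_def)
      have u_nY: "u x \<in> coloured_edges cs" if "x \<in> X - Y" for x
        using that u2 by (auto simp: u_def)
      have u_in: "u x \<in> coloured_edges ((V, b) # cs)" if "x \<in> X" for x
        using that u_Y[of x] u_nY[of x] by (cases "x \<in> Y") (auto simp: coloured_edges_def)
      have "u \<in> X \<rightarrow>\<^sub>E coloured_edges (c # cs)"
        using u_in u1 u2 Y c by (auto simp: PiE_iff extensional_def u_def)
      with zero have "(\<Sum>ws\<in>?R. \<alpha> ws * ?v ws u) = 0" by blast
      also have "(\<Sum>ws\<in>?R. \<alpha> ws * ?v ws u) = (\<Sum>z\<in>S. \<alpha> (f z) * ?v (f z) u)"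
        by (simp add: sum.reindex[OF inj])
      also have "\<dots> = (\<Sum>z\<in>{Y} \<times> (R1 Y \<times> R2 Y). \<alpha> (f z) * ?v (f z) u)"
      proof (rule sum.mono_neutral_right[OF finS])
        show "{Y} \<times> (R1 Y \<times> R2 Y) \<subseteq> S" using Y by (auto simp: S_def)
        show "\<forall>z\<in>S - {Y} \<times> (R1 Y \<times> R2 Y). \<alpha> (f z) * ?v (f z) u = 0"
        proof
          fix z assume z: "z \<in> S - {Y} \<times> (R1 Y \<times> R2 Y)"
          then obtain Y' w ws where zz: "z = (Y', w, ws)" "Y' \<subseteq> X" "w \<in> R1 Y'" "ws \<in> R2 Y'" "Y' \<noteq> Y"
            by (auto simp: S_def)
          have "\<not> closed_trails (c # cs) u (w # ws)"
          proof
            assume "closed_trails (c # cs) u (w # ws)"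
            then have tr: "trail b b (map u w)" "closed_trails cs u ws"
              by (simp_all add: closed_trails_def c)
            have sw: "set w = Y'" and sws: "set (concat ws) = X - Y'"
              using R1_set zz R2(2) by blast+
            have "x \<in> Y" if x: "x \<in> Y'" for x
            proof (rule ccontr)
              assume "x \<notin> Y"
              then have "u x \<in> coloured_edges cs" using x zz(2) u_nY by blast
              moreover have "fst (u x) \<in> V \<and> snd (u x) \<in> V"
              proof (rule trail_stays_in_colour[OF tr(1) V(2)])
                show "u y \<in> coloured_edges ((V, b) # cs)" if "y \<in> set w" for y
                  using that sw zz(2) u_in by blast
                show "snd e \<in> V" if "e \<in> coloured_edges ((V, b) # cs)" "fst e \<in> V" for e
                  using that disjoint_coloured_edges(1)[OF cols, of e]
                  by (auto simp: coloured_edges_def)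
              qed (use x sw in simp)
              ultimately show False using disjoint_coloured_edges(1)[OF cols] by blast
            qed
            moreover have "x \<in> Y'" if x: "x \<in> Y" for x
            proof (rule ccontr)
              assume "x \<notin> Y'"
              then have "x \<in> set (concat ws)" using x Y sws by blast
              then have "fst (u x) \<notin> V"
                using closed_trails_avoid_other_colour[OF cols tr(2)] u_in sws by blast
              then show False using u_Y[OF x] by auto
            qed
            ultimately show False using zz(5) by blast
          qed
          then show "\<alpha> (f z) * ?v (f z) u = 0" by (simp add: zz(1) f_def)
        qed
      qed
      also have "\<dots> = (\<Sum>w\<in>R1 Y. \<Sum>ws\<in>R2 Y. \<alpha> (w # ws) * ?v (w # ws) u)"
        by (simp add: sum.cartesian_product' f_def)
      also have "\<dots> = (\<Sum>w\<in>R1 Y. (\<Sum>ws\<in>R2 Y. \<alpha> (w # ws) * ?v2 ws u2) * ?v1 w u1)"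
        unfolding sum_distrib_right
      proof (intro sum.cong refl)
        fix w ws assume w: "w \<in> R1 Y" "ws \<in> R2 Y"
        have "map u w = map u1 w" using R1_set[OF w(1) Y] by (auto simp: u_def)
        moreover have m: "map u v = map u2 v" if "v \<in> set ws" for v
          using R2(2)[OF w(2)] that by (auto simp: u_def)
        have "(case d of (V, b) \<Rightarrow> \<lambda>w. trail b b (map u w)) v = (case d of (V, b) \<Rightarrow> \<lambda>w. trail b b (map u2 w)) v"
          if "v \<in> set ws" for d :: "'v set \<times> 'v" and v
          by (cases d) (simp only: m[OF that] prod.case)
        then have "closed_trails cs u ws = closed_trails cs u2 ws"
          unfolding closed_trails_def by (intro list.rel_cong refl)
        ultimately show "\<alpha> (w # ws) * ?v (w # ws) u = \<alpha> (w # ws) * ?v2 ws u2 * ?v1 w u1"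
          by (simp add: closed_trails_def c del: map_eq_conv)
      qed
      finally show ?thesis .
    qed
    have "(\<Sum>ws\<in>R2 Y. \<alpha> (w0 # ws) * ?v2 ws u2) = 0" if "u2 \<in> (X - Y) \<rightarrow>\<^sub>E coloured_edges cs" for u2
      using independent_rowsD[OF R1(2)[OF Y] prod_zero[OF _ that] ws0(1)] .
    then have "\<alpha> (w0 # ws1) = 0"
      using independent_rowsD[OF R2(3), of Y "\<lambda>ws. \<alpha> (w0 # ws)" ws1] ws0(2) by blast
    then show "\<alpha> ws0 = 0" using ws0(3) by simp
  qed
  moreover have "(\<Sum>(V, b)\<leftarrow>c # cs. (card V)\<^sup>2) ^ card X
      \<le> card ?R * (\<Prod>(V, b)\<leftarrow>c # cs. (card V)\<^sup>2 * (card X + 1) ^ ((card V)\<^sup>2))"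
  proof -
    have pd_mono: "pd m \<le> pd n" if "m \<le> n" for m n
      unfolding pd_def using that by (induction cs) (auto intro!: mult_le_mono power_mono)
    have pa_mono: "pa m \<le> pa n" if "m \<le> n" for m n
      unfolding pa_def using that by (intro mult_le_mono power_mono) auto
    have "(a + d) ^ card X = (\<Prod>x\<in>X. a + d)" by simp
    also have "\<dots> = (\<Sum>Y\<in>Pow X. a ^ card Y * d ^ card (X - Y))"
      using prod_add[OF Cons.prems(1), of "\<lambda>_. a" "\<lambda>_. d"] by simp
    also have "\<dots> \<le> (\<Sum>Y\<in>Pow X. (card (R1 Y) * card (R2 Y)) * (pa (card X) * pd (card X)))"
    proof (rule sum_mono)
      fix Y assume "Y \<in> Pow X"
      then have "a ^ card Y * d ^ card (X - Y) \<le> (card (R1 Y) * pa (card X)) * (card (R2 Y) * pd (card X))"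
        using R1(3)[of Y] R2(4)[of Y] pa_mono[OF card_mono[OF Cons.prems(1), of Y]]
          pd_mono[OF card_mono[OF Cons.prems(1), of "X - Y"]]
        by (intro mult_le_mono) (auto intro: order_trans mult_le_mono2)
      then show "a ^ card Y * d ^ card (X - Y) \<le> (card (R1 Y) * card (R2 Y)) * (pa (card X) * pd (card X))"
        by (simp only: mult_ac)
    qed
    also have "\<dots> = card S * (pa (card X) * pd (card X))"
      unfolding S_def using Cons.prems(1) finR1 R2(1)
      by (subst card_SigmaI) (auto simp: card_cartesian_product sum_distrib_right)
    also have "card S = card ?R" by (rule card_image[OF inj, symmetric])
    finally show ?thesis by (simp add: c a_def d_def pa_def pd_def)
  qed
  ultimately show ?case by blast
qed

section \<open>Idempotents in finite dimensional algebras\<close>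

locale fd_algebra = assoc_algebra scale + finite_dimensional_vector_space scale Basis
  for scale :: "'f::field \<Rightarrow> 'a::ring \<Rightarrow> 'a" and Basis
begin

lemma scale_mult_left_eq: "scale c x * y = scale c (x * y)"
  by (simp add: scale_mult_left)

lemma scale_mult_right_eq: "x * scale c y = scale c (x * y)"
  by (simp add: scale_mult_right)

lemmas scale_mult_eq = scale_mult_left_eq scale_mult_right_eq

lemma subspaceI_closed:
  assumes "0 \<in> S" "\<And>x y. x \<in> S \<Longrightarrow> y \<in> S \<Longrightarrow> x + y \<in> S" "\<And>c x. x \<in> S \<Longrightarrow> scale c x \<in> S"
  shows "subspace S"
  using assms unfolding subspace_def by blast

lemma sequence_meets_span: "\<exists>j. f j \<in> span (f ` {..<j})" for f :: "nat \<Rightarrow> 'a"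
proof (rule ccontr)
  assume neg: "\<nexists>j. f j \<in> span (f ` {..<j})"
  have "independent (f ` {..<j}) \<and> card (f ` {..<j}) = j" for j
  proof (induction j)
    case 0
    show ?case by (simp add: independent_empty)
  next
    case (Suc j)
    have notin: "f j \<notin> span (f ` {..<j})" using neg by blast
    then have "f j \<notin> f ` {..<j}" by (rule contrapos_nn) (rule span_base)
    then have "card (insert (f j) (f ` {..<j})) = Suc j"
      using Suc by (subst card_insert_disjoint) auto
    moreover have "independent (insert (f j) (f ` {..<j}))"
      using notin Suc by (intro independent_insertI) auto
    ultimately show ?case unfolding lessThan_Suc image_insert by blast
  qed
  from this[of "Suc (dim UNIV)"] have "Suc (dim UNIV) \<le> dim UNIV"
    using independent_card_le_dim[of "f ` {..<Suc (dim UNIV)}" UNIV] by simp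
  then show False by simp
qed

text \<open>As the algebra need not have a unit, \<open>pw y n\<close> denotes the power of \<open>y\<close> with exponent \<open>n + 1\<close>.\<close>

definition pw :: "'a \<Rightarrow> nat \<Rightarrow> 'a" where
  "pw y n = ((*) y ^^ n) y"

lemma pw_0 [simp]: "pw y 0 = y" and pw_Suc: "pw y (Suc n) = y * pw y n"
  by (simp_all add: pw_def)

lemma pw_mult: "pw y m * pw y n = pw y (Suc (m + n))"
  by (induction m) (simp_all add: pw_Suc mult.assoc)

lemma commute_span_pw:
  assumes "x * y = y * x" "h \<in> span (range (pw y))"
  shows "x * h = h * x"
proof -
  have pw: "x * pw y n = pw y n * x" for n
    by (induction n) (use assms(1) in \<open>auto simp: pw_Suc mult.assoc[symmetric]\<close>, metis mult.assoc)
  have "subspace {h. x * h = h * x}"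
    by (rule subspaceI_closed) (auto simp: algebra_simps scale_mult_eq)
  then have "span (range (pw y)) \<subseteq> {h. x * h = h * x}"
    using pw by (intro span_minimal) auto
  then show ?thesis using assms(2) by blast
qed

lemma pw_mult_span_pw:
  assumes "h \<in> span (range (pw y))"
  shows "pw y m * h \<in> span (range (pw y))"
proof -
  have "subspace {h. pw y m * h \<in> span (range (pw y))}"
    by (rule subspaceI_closed) (auto simp: distrib_left scale_mult_eq intro: span_add span_scale span_zero)
  then have "span (range (pw y)) \<subseteq> {h. pw y m * h \<in> span (range (pw y))}"
    by (intro span_minimal) (auto simp: pw_mult intro: span_base)
  then show ?thesis using assms by blast
qed

text \<open>The descending chain of the spans of high powers of \<open>y\<close> stops, so some power \<open>y\<^sup>k\<close> is of the
  form \<open>y\<^sup>2\<^sup>k h\<close>; then \<open>y\<^sup>k h\<close> is idempotent.\<close>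

lemma exists_idempotent_multiple:
  shows "\<exists>w\<in>span (range (pw y)). y * w = w * y \<and> (y * w) * (y * w) = y * w \<and> (y * w = 0 \<longrightarrow> (\<exists>n. pw y n = 0))"
proof -
  define S where "S j = span (pw y ` {j..})" for j
  have S_mono: "S j \<subseteq> S i" if "i \<le> j" for i j
    unfolding S_def using that by (intro span_mono) auto
  obtain m where m: "\<And>j. dim (S m) \<le> dim (S j)"
    using ex_has_least_nat[of "\<lambda>_. True" undefined "\<lambda>j. dim (S j)"] by blast
  define P where "P = pw y (Suc m)"
  (* P is the power of y with exponent m + 2, so the powers spanning S k are the products of P P
     with the positive powers of y. *)
  define k where "k = 2 * m + 4"
  have "S k = S m"
    using m[of k] S_mono[of m k] unfolding S_def k_def
    by (intro subspace_dim_equal subspace_span) auto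
  moreover have "P \<in> S m" unfolding S_def P_def by (intro span_base) auto
  ultimately have "P \<in> S k" by simp
  moreover have "S k \<subseteq> {x. \<exists>h\<in>span (range (pw y)). x = P * P * h}"
    unfolding S_def
  proof (rule span_minimal)
    show "pw y ` {k..} \<subseteq> {x. \<exists>h\<in>span (range (pw y)). x = P * P * h}"
    proof (rule image_subsetI)
      fix i assume "i \<in> {k..}"
      then have "i = Suc (Suc (Suc m + Suc m) + (i - k))" by (simp add: k_def)
      then have "pw y i = P * P * pw y (i - k)"
        unfolding P_def pw_mult by simp
      moreover have "pw y (i - k) \<in> span (range (pw y))" by (rule span_base) simp
      ultimately show "pw y i \<in> {x. \<exists>h\<in>span (range (pw y)). x = P * P * h}" by blast
    qed
    show "subspace {x. \<exists>h\<in>span (range (pw y)). x = P * P * h}"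
    proof (rule subspaceI_closed)
      show "0 \<in> {x. \<exists>h\<in>span (range (pw y)). x = P * P * h}"
        using span_zero by (auto intro: bexI[of _ 0])
      show "a + b \<in> {x. \<exists>h\<in>span (range (pw y)). x = P * P * h}"
        if "a \<in> {x. \<exists>h\<in>span (range (pw y)). x = P * P * h}" "b \<in> {x. \<exists>h\<in>span (range (pw y)). x = P * P * h}" for a b
        using that by (auto simp: distrib_left[symmetric] intro: span_add)
      show "scale c a \<in> {x. \<exists>h\<in>span (range (pw y)). x = P * P * h}"
        if "a \<in> {x. \<exists>h\<in>span (range (pw y)). x = P * P * h}" for c a
        using that by (auto simp: scale_mult_right_eq[symmetric] intro: span_scale)
    qed
  qed
  ultimately obtain h where h: "h \<in> span (range (pw y))" "P = P * P * h" by blast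
  let ?w = "pw y m * h"
  have w: "?w \<in> span (range (pw y))" using h(1) by (rule pw_mult_span_pw)
  have yw: "y * ?w = P * h" by (simp add: P_def pw_Suc mult.assoc)
  have "h * y = y * h" using commute_span_pw[OF refl h(1)] by simp
  then have hP: "h * P = P * h"
    unfolding P_def by (rule commute_span_pw) (auto intro: span_base)
  have "(y * ?w) * (y * ?w) = P * (h * P) * h" unfolding yw by (simp add: mult.assoc)
  also have "\<dots> = (P * P * h) * h" unfolding hP by (simp add: mult.assoc)
  also have "\<dots> = y * ?w" unfolding h(2)[symmetric] yw ..
  finally have idem: "(y * ?w) * (y * ?w) = y * ?w" .
  have "y * ?w = 0 \<longrightarrow> pw y (Suc m) = 0"
    using h(2) unfolding yw P_def[symmetric] by (metis mult.assoc mult_zero_right)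
  then show ?thesis
    using w idem commute_span_pw[OF refl w] by blast
qed

definition corner :: "'a \<Rightarrow> 'a set" where
  "corner p = {x. p * x = x \<and> x * p = x}"

lemma cornerD: "x \<in> corner p \<Longrightarrow> p * x = x" "x \<in> corner p \<Longrightarrow> x * p = x"
  by (simp_all add: corner_def)

lemma subspace_corner: "subspace (corner p)"
  by (rule subspaceI_closed) (auto simp: corner_def algebra_simps scale_mult_eq)

lemma corner_mult: "x \<in> corner p \<Longrightarrow> y \<in> corner p \<Longrightarrow> x * y \<in> corner p"
  by (simp add: corner_def) (metis mult.assoc)

lemma corner_pw: "x \<in> corner p \<Longrightarrow> pw x n \<in> corner p"
  by (induction n) (auto simp: pw_Suc intro: corner_mult)

lemma corner_sandwich: "p * p = p \<Longrightarrow> p * x * p \<in> corner p"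
  by (simp add: corner_def mult.assoc) (metis mult.assoc)

definition primitive :: "'a \<Rightarrow> bool" where
  "primitive p \<longleftrightarrow> p \<noteq> 0 \<and> p * p = p \<and> (\<forall>q\<in>corner p. q * q = q \<longrightarrow> q = 0 \<or> q = p)"

definition corner_unit :: "'a \<Rightarrow> 'a \<Rightarrow> bool" where
  "corner_unit p z \<longleftrightarrow> (\<exists>w\<in>corner p. z * w = p \<and> w * z = p)"

lemma primitive_self: "primitive p \<Longrightarrow> p \<in> corner p"
  by (simp add: primitive_def corner_def)

text \<open>The dichotomy of Fitting: the only idempotents in the corner of a primitive idempotent are
  trivial.\<close>

lemma corner_unit_or_nilpotent:
  assumes "primitive p" "z \<in> corner p"
  shows "corner_unit p z \<or> (\<exists>n. pw z n = 0)"
proof -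
  obtain w where w: "w \<in> span (range (pw z))" "z * w = w * z" "(z * w) * (z * w) = z * w"
      "z * w = 0 \<longrightarrow> (\<exists>n. pw z n = 0)"
    using exists_idempotent_multiple[of z] by blast
  have "span (range (pw z)) \<subseteq> corner p"
    using assms(2) by (intro span_minimal subspace_corner) (auto intro: corner_pw)
  then have "w \<in> corner p" using w(1) by blast
  moreover from this have "z * w \<in> corner p" using assms(2) by (intro corner_mult)
  then have "z * w = 0 \<or> z * w = p" using assms(1) w(3) unfolding primitive_def by blast
  ultimately show ?thesis using w(2,4) unfolding corner_unit_def by metis
qed

lemma right_invertible_not_nilpotent:
  assumes "p \<noteq> 0" "z \<in> corner p" "z * w = p"
  shows "pw z n \<noteq> 0"
proof (induction n)
  case 0
  then show ?case using assms by auto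
next
  case (Suc n)
  have "pw z (Suc n) = pw z n * z" using pw_mult[of z n 0] by simp
  then have "pw z (Suc n) * w = pw z n * p" using assms(3) by (simp add: mult.assoc)
  also have "\<dots> = pw z n" using corner_pw[OF assms(2)] by (rule cornerD(2))
  finally show ?case using Suc by auto
qed

lemma corner_unit_of_right_inverse:
  assumes "primitive p" "z \<in> corner p" "z * w = p"
  shows "corner_unit p z"
  using corner_unit_or_nilpotent[OF assms(1,2)] right_invertible_not_nilpotent[OF _ assms(2,3)] assms(1)
  unfolding primitive_def by blast

text \<open>If \<open>z\<close> is nilpotent, then the geometric series inverts \<open>p - z\<close>.\<close>

lemma corner_local:
  assumes "primitive p" "z \<in> corner p"
  shows "corner_unit p z \<or> corner_unit p (p - z)"
proof -
  have "corner_unit p (p - z)" if n: "pw z n = 0" for n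
  proof -
    define s where "s = (\<Sum>i\<le>n. pw z i)"
    have s: "s \<in> corner p"
      unfolding s_def using assms(2) by (intro subspace_sum subspace_corner corner_pw)
    have "s + pw z (Suc n) = z + (\<Sum>i\<le>n. pw z (Suc i))"
      unfolding s_def by (metis sum.atMost_Suc sum.atMost_Suc_shift pw_0)
    moreover have "pw z (Suc n) = 0" using n by (simp add: pw_Suc)
    moreover have "(\<Sum>i\<le>n. pw z (Suc i)) = z * s" by (simp add: s_def sum_distrib_left pw_Suc)
    moreover have "(\<Sum>i\<le>n. pw z (Suc i)) = s * z"
      using pw_mult[of z _ 0] by (simp add: s_def sum_distrib_right)
    ultimately have "s = z + z * s" "s * z = z * s" by simp_all
    then have zs: "z * s = s - z" "s * z = s - z" by (metis add_diff_cancel_left')+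
    have "p \<in> corner p" using assms(1) by (rule primitive_self)
    then have ps: "p + s \<in> corner p" using s subspace_corner by (rule subspace_add[rotated])
    have "(p - z) * (p + s) = p" "(p + s) * (p - z) = p"
      using zs cornerD[OF s] cornerD[OF assms(2)] cornerD[OF \<open>p \<in> corner p\<close>]
      by (simp_all add: algebra_simps)
    with ps show ?thesis unfolding corner_unit_def by blast
  qed
  then show ?thesis using corner_unit_or_nilpotent[OF assms] by blast
qed

lemma corner_unit_add:
  assumes "primitive p" "x \<in> corner p" "y \<in> corner p" "corner_unit p (x + y)"
  shows "corner_unit p x \<or> corner_unit p y"
proof -
  obtain w where w: "w \<in> corner p" "(x + y) * w = p" using assms(4) unfolding corner_unit_def by blast
  have xw: "x * w \<in> corner p" and "p - x * w = y * w"
    using assms(2) w by (auto intro: corner_mult simp: algebra_simps)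
  then consider w' where "x * w * w' = p" | w' where "y * w * w' = p"
    using corner_local[OF assms(1) xw] unfolding corner_unit_def by auto
  then show ?thesis
    by cases (use corner_unit_of_right_inverse[OF assms(1)] assms(2,3) in \<open>auto simp: mult.assoc\<close>)
qed

lemma corner_unit_sum:
  assumes "primitive p" "finite T" "\<And>t. t \<in> T \<Longrightarrow> z t \<in> corner p" "corner_unit p (\<Sum>t\<in>T. z t)"
  shows "\<exists>t\<in>T. corner_unit p (z t)"
  using assms(2-4)
proof (induction T rule: finite_induct)
  case empty
  then show ?case using assms(1) by (auto simp: corner_unit_def primitive_def)
next
  case (insert t T)
  have "(\<Sum>t\<in>T. z t) \<in> corner p"
    using insert.prems(1) by (intro subspace_sum subspace_corner) auto
  then show ?case
    using corner_unit_add[OF assms(1), of "z t" "\<Sum>t\<in>T. z t"] insert by auto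
qed

end

text \<open>An element of a corner satisfies a polynomial of minimal degree; over an algebraically closed
  field this polynomial has a linear factor \<open>X - c\<close>, and by minimality \<open>z - c p\<close> is a zero
  divisor.\<close>

lemma (in fd_algebra) corner_eigenvalue:
  fixes z :: 'a
  assumes closed: "\<And>q :: 'f poly. degree q > 0 \<Longrightarrow> \<exists>x. poly q x = 0"
    and "primitive p" "z \<in> corner p"
  shows "\<exists>c. \<not> corner_unit p (z - scale c p)"
proof -
  have p: "p \<noteq> 0" "p \<in> corner p"
    using assms(2) primitive_self by (auto simp: primitive_def)
  define zp where "zp i = ((*) z ^^ i) p" for i
  have zp_0: "zp 0 = p" and zp_Suc: "zp (Suc i) = z * zp i" for i by (simp_all add: zp_def)
  have zp_corner: "zp i \<in> corner p" for i
    by (induction i) (auto simp: zp_0 zp_Suc p intro: corner_mult assms(3))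
  define ev where "ev q = (\<Sum>i\<le>degree q. scale (coeff q i) (zp i))" for q
  have ev_0: "ev 0 = 0" by (simp add: ev_def)
  have ev_pCons: "ev (pCons a q) = scale a p + z * ev q" for a q
  proof (cases "q = 0")
    case False
    then show ?thesis
      by (simp add: ev_def sum.atMost_Suc_shift zp_0 zp_Suc sum_distrib_left scale_mult_eq del: sum.atMost_Suc)
  qed (simp add: ev_def zp_0)
  have ev_add: "ev (q + r) = ev q + ev r" for q r
  proof (induction q arbitrary: r)
    case (pCons a q)
    obtain b r' where "r = pCons b r'" by (rule pCons_cases)
    then show ?case by (simp add: ev_pCons pCons.IH scale_left_distrib distrib_left)
  qed (simp add: ev_0)
  have ev_diff: "ev (q - r) = ev q - ev r" for q r
    using ev_add[of "q - r" r] by (simp add: algebra_simps)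
  have ev_smult: "ev (smult c q) = scale c (ev q)" for c q
    by (induction q) (simp_all add: ev_0 ev_pCons scale_right_distrib scale_mult_eq)
  have ev_monom: "ev (monom 1 i) = zp i" for i
    by (induction i) (simp_all add: monom_0 monom_Suc ev_pCons ev_0 zp_0 zp_Suc)
  have ev_corner: "ev q \<in> corner p" for q
    unfolding ev_def by (intro subspace_sum subspace_scale subspace_corner zp_corner)
  obtain j where j: "zp j \<in> span (zp ` {..<j})" using sequence_meets_span by blast
  let ?T = "{ev q | q. \<forall>i\<ge>j. coeff q i = 0}"
  have "span (zp ` {..<j}) \<subseteq> ?T"
  proof (rule span_minimal)
    show "zp ` {..<j} \<subseteq> ?T"
      by (auto simp: ev_monom[symmetric] intro!: exI[of _ "monom 1 _"])
    show "subspace ?T"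
    proof (rule subspaceI_closed)
      show "0 \<in> ?T" using ev_0 by (auto intro!: exI[of _ 0])
      show "x + y \<in> ?T" if xy: "x \<in> ?T" "y \<in> ?T" for x y
      proof -
        obtain q r where "x = ev q" "y = ev r" "\<forall>i\<ge>j. coeff q i = 0" "\<forall>i\<ge>j. coeff r i = 0"
          using xy by blast
        then have "x + y = ev (q + r) \<and> (\<forall>i\<ge>j. coeff (q + r) i = 0)" by (simp add: ev_add)
        then show ?thesis by blast
      qed
      show "scale c x \<in> ?T" if x: "x \<in> ?T" for c x
      proof -
        obtain q where "x = ev q" "\<forall>i\<ge>j. coeff q i = 0" using x by blast
        then have "scale c x = ev (smult c q) \<and> (\<forall>i\<ge>j. coeff (smult c q) i = 0)" by (simp add: ev_smult)
        then show ?thesis by blast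
      qed
    qed
  qed
  then obtain q0 where q0: "zp j = ev q0" "\<forall>i\<ge>j. coeff q0 i = 0" using j by blast
  have "coeff (monom 1 j + smult (-1) q0) j = 1" using q0(2) by simp
  then have "monom 1 j + smult (-1) q0 \<noteq> 0" by (metis coeff_0 zero_neq_one)
  moreover have "ev (monom 1 j + smult (-1) q0) = 0"
    by (simp only: ev_add ev_smult ev_monom q0(1)) simp
  ultimately have "\<exists>q. q \<noteq> 0 \<and> ev q = 0" by blast
  then obtain q where q: "q \<noteq> 0" "ev q = 0"
    and min: "\<And>r. r \<noteq> 0 \<Longrightarrow> ev r = 0 \<Longrightarrow> degree q \<le> degree r"
    using ex_has_least_nat[of "\<lambda>q. q \<noteq> 0 \<and> ev q = 0" _ degree] by metis
  have "degree q > 0"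
  proof (rule ccontr)
    assume "\<not> degree q > 0"
    then obtain a where "q = [:a:]" by (metis degree_eq_zeroE gr0I)
    then show False using q p(1) by (simp add: ev_pCons ev_0)
  qed
  then obtain c where "poly q c = 0" using closed by blast
  then obtain r where r: "q = [:- c, 1:] * r" by (metis poly_eq_0_iff_dvd dvdE)
  have r0: "r \<noteq> 0" using q(1) r by auto
  then have "degree q = Suc (degree r)" unfolding r by (subst degree_mult_eq) auto
  then have ev_r: "ev r \<noteq> 0" using min[OF r0] by auto
  have "ev q = (z - scale c p) * ev r"
    unfolding r using cornerD[OF ev_corner[of r]]
    by (simp add: ev_diff ev_smult ev_pCons left_diff_distrib scale_mult_eq)
  then have zero: "(z - scale c p) * ev r = 0" using q(2) by simp
  have "\<not> corner_unit p (z - scale c p)"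
  proof
    assume "corner_unit p (z - scale c p)"
    then obtain w where "w * (z - scale c p) = p" unfolding corner_unit_def by blast
    then have "ev r = w * ((z - scale c p) * ev r)"
      using cornerD[OF ev_corner[of r]] by (simp add: mult.assoc[symmetric])
    then show False using zero ev_r by simp
  qed
  then show ?thesis by blast
qed


context fd_algebra
begin

section \<open>Nil ideals\<close>

definition two_sided_ideal :: "'a set \<Rightarrow> bool" where
  "two_sided_ideal I \<longleftrightarrow> subspace I \<and> (\<forall>x\<in>I. \<forall>a. a * x \<in> I \<and> x * a \<in> I)"

text \<open>If \<open>V\<close> were nonzero, take a maximal proper submodule \<open>W\<close> of \<open>V\<close> and \<open>v\<close> with \<open>J v\<close> not contained in
  \<open>W\<close>. By maximality \<open>v = j v\<close> modulo \<open>W\<close> for some \<open>j\<close> in \<open>J\<close>, and iteration gives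
  \<open>v = j\<^sup>n v = 0\<close> modulo \<open>W\<close>.\<close>

lemma nil_ideal_module_eq_0:
  assumes J: "two_sided_ideal J" "\<And>j. j \<in> J \<Longrightarrow> \<exists>n. pw j n = 0"
    and V: "subspace V" "\<And>j v. j \<in> J \<Longrightarrow> v \<in> V \<Longrightarrow> j * v \<in> V"
    and full: "V \<subseteq> span {j * v |j v. j \<in> J \<and> v \<in> V}"
  shows "V = {0}"
proof (rule ccontr)
  assume "V \<noteq> {0}"
  have subJ: "subspace J" using J(1) unfolding two_sided_ideal_def by blast
  define Ws where "Ws = {W. subspace W \<and> W \<subseteq> V \<and> W \<noteq> V \<and> (\<forall>j\<in>J. \<forall>w\<in>W. j * w \<in> W)}"
  have "{0} \<in> Ws"
    using \<open>V \<noteq> {0}\<close> subspace_0[OF V(1)] by (auto simp: Ws_def subspace_single_0)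
  then have "\<exists>W. W \<in> Ws \<and> (\<forall>W'. W' \<in> Ws \<longrightarrow> dim W' \<le> dim W)"
    by (rule ex_has_greatest_nat[where b = "Suc (dim UNIV)"])
      (intro allI impI le_imp_less_Suc dim_subset subset_UNIV)
  then obtain W where W: "W \<in> Ws" and max: "\<And>W'. W' \<in> Ws \<Longrightarrow> dim W' \<le> dim W" by blast
  have W1: "subspace W" "W \<subseteq> V" "W \<noteq> V" "\<And>j w. j \<in> J \<Longrightarrow> w \<in> W \<Longrightarrow> j * w \<in> W"
    using W by (auto simp: Ws_def)
  have "\<not> {j * v |j v. j \<in> J \<and> v \<in> V} \<subseteq> W"
  proof
    assume "{j * v |j v. j \<in> J \<and> v \<in> V} \<subseteq> W"
    then have "span {j * v |j v. j \<in> J \<and> v \<in> V} \<subseteq> W" using W1(1) by (rule span_minimal)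
    then show False using full W1(2,3) by simp
  qed
  then obtain j0 v where jv: "j0 \<in> J" "v \<in> V" "j0 * v \<notin> W" by blast
  then have v: "v \<notin> W" using W1(4) by blast
  (* The submodule generated by J v and W. *)
  define T where "T = {j * v + w |j w. j \<in> J \<and> w \<in> W}"
  have T: "subspace T"
  proof (rule subspaceI_closed)
    have "0 = 0 * v + 0" by simp
    then show "0 \<in> T" unfolding T_def using subspace_0[OF subJ] subspace_0[OF W1(1)] by blast
    show "x + y \<in> T" if "x \<in> T" "y \<in> T" for x y
    proof -
      obtain j w j' w' where "x = j * v + w" "y = j' * v + w'" "j \<in> J" "j' \<in> J" "w \<in> W" "w' \<in> W"
        using \<open>x \<in> T\<close> \<open>y \<in> T\<close> unfolding T_def by blast
      moreover from this have "x + y = (j + j') * v + (w + w')" by (simp add: algebra_simps)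
      ultimately show ?thesis
        unfolding T_def using subspace_add[OF subJ] subspace_add[OF W1(1)] by blast
    qed
    show "scale c x \<in> T" if x: "x \<in> T" for c x
    proof -
      obtain j w where "x = j * v + w" "j \<in> J" "w \<in> W" using x unfolding T_def by blast
      moreover from this have "scale c x = scale c j * v + scale c w"
        by (simp add: scale_right_distrib scale_mult_eq)
      ultimately show ?thesis
        unfolding T_def using subspace_scale[OF subJ] subspace_scale[OF W1(1)] by blast
    qed
  qed
  have TV: "T \<subseteq> V"
  proof
    fix x assume "x \<in> T"
    then obtain j w where "x = j * v + w" "j \<in> J" "w \<in> W" unfolding T_def by blast
    then show "x \<in> V" using V(2)[of j v] jv(2) W1(2) subspace_add[OF V(1)] by blast
  qed
  have WT: "W \<subseteq> T"
  proof
    fix w assume "w \<in> W"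
    moreover have "w = 0 * v + w" by simp
    ultimately show "w \<in> T" unfolding T_def using subspace_0[OF subJ] by blast
  qed
  have "j0 * v = j0 * v + 0" by simp
  then have "j0 * v \<in> T" unfolding T_def using jv(1) subspace_0[OF W1(1)] by blast
  then have "W \<subset> T" using WT jv(3) by blast
  then have "span W \<subset> span T" using T W1(1) by (simp add: span_eq_iff[THEN iffD2])
  then have "dim W < dim T" by (rule dim_psubset)
  then have "T \<notin> Ws" using max by (meson not_le)
  moreover have "j * x \<in> T" if j: "j \<in> J" and xT: "x \<in> T" for j x
  proof -
    obtain j' w where x: "x = j' * v + w" "j' \<in> J" "w \<in> W" using xT unfolding T_def by blast
    have "j * x = (j * j') * v + j * w" by (simp add: x(1) distrib_left mult.assoc)
    moreover have "j * j' \<in> J" using J(1) x(2) unfolding two_sided_ideal_def by blast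
    ultimately show ?thesis unfolding T_def using W1(4)[OF j x(3)] by blast
  qed
  ultimately have "T = V" using T TV unfolding Ws_def by blast
  then have "v \<in> T" using jv(2) by simp
  then obtain j w where j: "v = j * v + w" "j \<in> J" "w \<in> W" unfolding T_def by blast
  have diff: "v - pw j n * v \<in> W" for n
  proof (induction n)
    case 0
    have "v - j * v = w" using j(1) by (metis add_diff_cancel_left')
    then show ?case using j(3) by simp
  next
    case (Suc n)
    have "v - pw j (Suc n) * v = (v - j * v) + j * (v - pw j n * v)"
      by (simp add: pw_Suc algebra_simps)
    moreover have "v - j * v = w" using j(1) by (metis add_diff_cancel_left')
    ultimately show ?case using W1(4)[OF j(2) Suc] j(3) subspace_add[OF W1(1)] by simp
  qed
  obtain n where "pw j n = 0" using J(2)[OF j(2)] by blast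
  then show False using diff[of n] v by simp
qed

text \<open>By the previous lemma the spans of \<open>J A\<close>, \<open>J J A\<close>, and so on decrease strictly until they vanish.\<close>

lemma nil_ideal_nilpotent:
  assumes J: "two_sided_ideal J" "\<And>j. j \<in> J \<Longrightarrow> \<exists>n. pw j n = 0"
  shows "\<exists>m. \<forall>xs. m \<le> length xs \<longrightarrow> set xs \<subseteq> J \<longrightarrow> word_product xs = 0"
proof -
  define V where "V = rec_nat UNIV (\<lambda>_ W. span {j * v |j v. j \<in> J \<and> v \<in> W})"
  have V_Suc: "V (Suc i) = span {j * v |j v. j \<in> J \<and> v \<in> V i}" for i
    by (simp add: V_def)
  have sub: "subspace (V i)" for i by (cases i) (simp_all add: V_def)
  have JV: "j * v \<in> V (Suc i)" if "j \<in> J" "v \<in> V i" for j v i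
    unfolding V_Suc using that by (intro span_base) blast
  have anti: "V (Suc i) \<subseteq> V i" for i
  proof (induction i)
    case (Suc i)
    have "{j * v |j v. j \<in> J \<and> v \<in> V (Suc i)} \<subseteq> {j * v |j v. j \<in> J \<and> v \<in> V i}"
      using Suc by blast
    from span_mono[OF this] show ?case by (simp only: V_Suc[symmetric])
  qed (simp add: V_def)
  have "dim (V i) \<le> dim (UNIV :: 'a set) - i" for i
  proof (induction i)
    case (Suc i)
    show ?case
    proof (cases "V i = {0}")
      case True
      then have "dim (V (Suc i)) = 0" using anti[of i] dim_eq_0[of "V (Suc i)"] by simp
      then show ?thesis by (simp del: dim_eq_0)
    next
      case False
      then have "\<not> V i \<subseteq> V (Suc i)"
        using nil_ideal_module_eq_0[OF J sub[of i]] JV anti unfolding V_Suc by blast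
      then have "V (Suc i) \<subset> V i" using anti by blast
      then have "span (V (Suc i)) \<subset> span (V i)" using sub by (simp add: span_eq_iff[THEN iffD2])
      then have "dim (V (Suc i)) < dim (V i)" by (rule dim_psubset)
      then show ?thesis using Suc by simp
    qed
  qed (simp add: V_def)
  then have "dim (V (dim (UNIV :: 'a set) + i)) = 0" for i
    by (metis diff_add_inverse diff_is_0_eq' le_add1 le_zero_eq)
  then have zero: "V (dim (UNIV :: 'a set) + i) \<subseteq> {0}" for i
    using dim_eq_0 by blast
  have word: "word_product (x # xs) \<in> V (length xs)" if "set (x # xs) \<subseteq> J" for x xs
    using that
  proof (induction xs arbitrary: x)
    case (Cons y ys)
    then show ?case using JV[of x "word_product (y # ys)"] by simp
  qed (simp add: V_def)
  have "word_product xs = 0" if len: "dim (UNIV :: 'a set) + 1 \<le> length xs" and sub: "set xs \<subseteq> J" for xs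
  proof -
    obtain y ys where xs: "xs = y # ys" using len by (cases xs) auto
    have "length ys = dim (UNIV :: 'a set) + (length ys - dim (UNIV :: 'a set))" using len xs by simp
    then show ?thesis using word[of y ys] zero sub xs by (metis singletonD subsetD)
  qed
  then show ?thesis by blast
qed

section \<open>Maximal systems of orthogonal idempotents\<close>

definition orthogonal_idempotents :: "'a set \<Rightarrow> bool" where
  "orthogonal_idempotents P \<longleftrightarrow> (\<forall>p\<in>P. p \<noteq> 0 \<and> p * p = p) \<and> (\<forall>p\<in>P. \<forall>q\<in>P. p \<noteq> q \<longrightarrow> p * q = 0)"

lemma orthogonal_idempotentsD:
  assumes "orthogonal_idempotents P" "p \<in> P"
  shows "p \<noteq> 0" "p * p = p" "q \<in> P \<Longrightarrow> p \<noteq> q \<Longrightarrow> p * q = 0"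
  using assms unfolding orthogonal_idempotents_def by simp_all

lemma orthogonal_idempotents_independent:
  assumes "orthogonal_idempotents P"
  shows "independent P"
  unfolding dependent_explicit
proof clarify
  fix T u p assume T: "finite T" "T \<subseteq> P" "(\<Sum>v\<in>T. scale (u v) v) = 0" and p: "p \<in> T" "u p \<noteq> 0"
  have "0 = p * (\<Sum>v\<in>T. scale (u v) v)" using T(3) by simp
  also have "\<dots> = (\<Sum>v\<in>T. if v = p then scale (u p) p else 0)"
    unfolding sum_distrib_left
  proof (intro sum.cong refl)
    fix v assume "v \<in> T"
    then have "p \<in> P" "v \<in> P" using T(2) p(1) by blast+
    then show "p * scale (u v) v = (if v = p then scale (u p) p else 0)"
      using orthogonal_idempotentsD[OF assms, of p] by (auto simp: scale_mult_eq)
  qed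
  also have "\<dots> = scale (u p) p" using T(1) p(1) by simp
  finally show False
    using p T(2) orthogonal_idempotentsD(1)[OF assms] by (metis scale_eq_0_iff subsetD)
qed

definition max_orthogonal_idempotents :: "'a set \<Rightarrow> bool" where
  "max_orthogonal_idempotents P \<longleftrightarrow> orthogonal_idempotents P \<and>
     (\<forall>Q. orthogonal_idempotents Q \<longrightarrow> card Q \<le> card P)"

lemma exists_max_orthogonal_idempotents: "\<exists>P. max_orthogonal_idempotents P"
proof -
  have "orthogonal_idempotents {}" by (simp add: orthogonal_idempotents_def)
  moreover have "\<forall>Q. orthogonal_idempotents Q \<longrightarrow> card Q < Suc (dim (UNIV :: 'a set))"
    using orthogonal_idempotents_independent independent_card_le_dim[OF subset_UNIV]
    by (blast intro: le_imp_less_Suc)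
  ultimately have "\<exists>P. orthogonal_idempotents P \<and> (\<forall>Q. orthogonal_idempotents Q \<longrightarrow> card Q \<le> card P)"
    by (rule ex_has_greatest_nat)
  then show ?thesis unfolding max_orthogonal_idempotents_def .
qed

end

locale max_idempotents = fd_algebra scale Basis
  for scale :: "'f::field \<Rightarrow> 'a::ring \<Rightarrow> 'a" and Basis +
  fixes P :: "'a set"
  assumes max: "max_orthogonal_idempotents P"
begin

lemma orth: "orthogonal_idempotents P"
  using max unfolding max_orthogonal_idempotents_def by blast

lemmas P_nonzero = orthogonal_idempotentsD(1)[OF orth]
  and P_idem = orthogonal_idempotentsD(2)[OF orth]
  and P_orth = orthogonal_idempotentsD(3)[OF orth]

lemma finite_P: "finite P"
  using orthogonal_idempotents_independent[OF orth] by (rule finiteI_independent)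

text \<open>By maximality a member cannot be split into two orthogonal idempotents.\<close>

lemma P_primitive:
  assumes p: "p \<in> P"
  shows "primitive p"
  unfolding primitive_def
proof (intro conjI ballI impI)
  show "p \<noteq> 0" "p * p = p" using p by (auto simp: P_nonzero P_idem)
  fix q assume q: "q \<in> corner p" "q * q = q"
  show "q = 0 \<or> q = p"
  proof (rule ccontr)
    assume neg: "\<not> (q = 0 \<or> q = p)"
    let ?Q = "insert q (insert (p - q) (P - {p}))"
    have pq: "p * q = q" "q * p = q" using q(1) by (simp_all add: cornerD)
    have r: "r * q = 0" "q * r = 0" "r * p = 0" "p * r = 0" if "r \<in> P - {p}" for r
    proof -
      show rp: "r * p = 0" "p * r = 0" using that p P_orth by auto
      show "r * q = 0" using rp pq by (metis mult.assoc mult_zero_left)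
      show "q * r = 0" using rp pq by (metis mult.assoc mult_zero_right)
    qed
    have qp: "q * (p - q) = 0" "(p - q) * q = 0" "(p - q) * (p - q) = p - q"
      using pq q(2) P_idem[OF p] by (simp_all add: algebra_simps)
    have "orthogonal_idempotents ?Q"
      using r qp q(2) neg P_nonzero P_idem P_orth
      by (auto simp: orthogonal_idempotents_def left_diff_distrib right_diff_distrib)
    then have "card ?Q \<le> card P" using max unfolding max_orthogonal_idempotents_def by blast
    moreover have "q \<noteq> p - q" using qp(1) q(2) neg by auto
    moreover have "q \<notin> P - {p}" using r[of q] q(2) neg by auto
    moreover have "p - q \<notin> P - {p}"
    proof
      assume a: "p - q \<in> P - {p}"
      have "(p - q) * (p - q) = (p - q) * p - (p - q) * q" by (rule right_diff_distrib)
      then have "p - q = 0" using qp(3) r[OF a] by simp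
      then show False using neg by simp
    qed
    moreover have "card (P - {p}) = card P - 1" "card P > 0"
      using p finite_P by (auto simp: card_gt_0_iff)
    ultimately show False using finite_P by simp
  qed
qed

text \<open>By maximality no idempotent can be added.\<close>

lemma no_orthogonal_idempotent:
  assumes "f * f = f" "\<And>p. p \<in> P \<Longrightarrow> p * f = 0" "\<And>p. p \<in> P \<Longrightarrow> f * p = 0"
  shows "f = 0"
proof (rule ccontr)
  assume "f \<noteq> 0"
  then have "orthogonal_idempotents (insert f P)"
    using assms P_nonzero P_idem P_orth by (auto simp: orthogonal_idempotents_def)
  then have "card (insert f P) \<le> card P" using max unfolding max_orthogonal_idempotents_def by blast
  moreover have "f \<notin> P" using assms \<open>f \<noteq> 0\<close> by auto
  ultimately show False using finite_P by simp
qed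

definition unit_sum :: 'a where
  "unit_sum = (\<Sum>p\<in>P. p)"

lemma P_unit_sum:
  assumes "p \<in> P"
  shows "p * unit_sum = p" "unit_sum * p = p"
proof -
  have "p * unit_sum = (\<Sum>q\<in>P. if q = p then p else 0)"
    unfolding unit_sum_def sum_distrib_left using assms P_idem P_orth by (intro sum.cong) auto
  then show "p * unit_sum = p" using assms finite_P by simp
  have "unit_sum * p = (\<Sum>q\<in>P. if q = p then p else 0)"
    unfolding unit_sum_def sum_distrib_right using assms P_idem P_orth by (intro sum.cong) auto
  then show "unit_sum * p = p" using assms finite_P by simp
qed

lemma unit_sum_idem: "unit_sum * unit_sum = unit_sum"
proof -
  have "unit_sum * unit_sum = (\<Sum>p\<in>P. p * unit_sum)"
    unfolding sum_distrib_right[symmetric] unit_sum_def[symmetric] ..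
  also have "\<dots> = unit_sum"
    unfolding unit_sum_def[of] using P_unit_sum(1) by (intro sum.cong) (auto simp: unit_sum_def)
  finally show ?thesis .
qed

section \<open>The radical\<close>

text \<open>\<open>a\<close> lies in the radical if no member of \<open>P\<close> lies in the ideal generated by \<open>a\<close>; membership
  is witnessed by a single product because the corners \<open>p A p\<close> are local.\<close>

definition radical :: "'a set" where
  "radical = {a. \<forall>p\<in>P. \<forall>x y. p * x * a * y * p \<noteq> p}"

lemma not_in_radical: "a \<notin> radical \<Longrightarrow> \<exists>p\<in>P. \<exists>x y. p * x * a * y * p = p"
  by (auto simp: radical_def)

lemma radical_ideal: "two_sided_ideal radical"
  unfolding two_sided_ideal_def
proof (intro conjI ballI allI)
  show "subspace radical"
  proof (rule subspaceI_closed)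
    show "0 \<in> radical" using P_nonzero by (auto simp: radical_def)
    show "scale c a \<in> radical" if "a \<in> radical" for c a
    proof (rule ccontr)
      assume "scale c a \<notin> radical"
      then obtain p x y where "p \<in> P" "p * x * scale c a * y * p = p" using not_in_radical by blast
      then have "p * x * a * scale c y * p = p" by (simp add: scale_mult_eq)
      then show False using that \<open>p \<in> P\<close> unfolding radical_def by blast
    qed
    show "a + b \<in> radical" if "a \<in> radical" "b \<in> radical" for a b
    proof (rule ccontr)
      assume "a + b \<notin> radical"
      then obtain p x y where p: "p \<in> P" "p * x * (a + b) * y * p = p" using not_in_radical by blast
      have no_unit: "\<not> corner_unit p (p * x * c * y * p)" if "c \<in> radical" for c
      proof
        assume "corner_unit p (p * x * c * y * p)"
        then obtain w where "w \<in> corner p" "p * x * c * y * p * w = p" unfolding corner_unit_def by blast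
        then have "p * x * c * (y * p * w) * p = p"
          using P_idem[OF p(1)] by (simp add: mult.assoc cornerD)
        then show False using that p(1) unfolding radical_def by blast
      qed
      have "p * x * a * y * p \<in> corner p" "p * x * b * y * p \<in> corner p"
        using corner_sandwich[OF P_idem[OF p(1)], of "x * a * y"]
          corner_sandwich[OF P_idem[OF p(1)], of "x * b * y"] by (simp_all add: mult.assoc)
      moreover have "corner_unit p (p * x * a * y * p + p * x * b * y * p)"
        using p primitive_self[OF P_primitive[OF p(1)]] P_idem
        by (auto simp: corner_unit_def distrib_left distrib_right)
      ultimately show False
        using corner_unit_add[OF P_primitive[OF p(1)]] no_unit that by blast
    qed
  qed
  show "b * a \<in> radical" "a * b \<in> radical" if "a \<in> radical" for a b
  proof -
    have "p * (x * b) * a * y * p \<noteq> p" "p * x * a * (b * y) * p \<noteq> p" if "p \<in> P" for p x y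
      using \<open>a \<in> radical\<close> that unfolding radical_def by blast+
    then show "b * a \<in> radical" "a * b \<in> radical" unfolding radical_def by (simp_all add: mult.assoc)
  qed
qed

text \<open>If \<open>p x a y p = p\<close>, then \<open>t = a y p x\<close> is an idempotent with \<open>e t = 0\<close>, where \<open>e\<close> is the sum of
  \<open>P\<close>. Then \<open>t - t e\<close> is an idempotent orthogonal to \<open>P\<close>, hence zero, which forces \<open>t = 0\<close>.\<close>

lemma left_annihilated_in_radical:
  assumes "unit_sum * a = 0"
  shows "a \<in> radical"
proof (rule ccontr)
  assume "a \<notin> radical"
  then obtain p x y where p: "p \<in> P" "p * x * a * y * p = p" using not_in_radical by blast
  define t where "t = a * y * p * x"
  have tt: "t * t = t"
  proof -
    have "t * t = a * y * (p * x * a * y * p) * x" by (simp add: t_def mult.assoc)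
    then show ?thesis unfolding p(2) by (simp add: t_def mult.assoc)
  qed
  have et: "unit_sum * t = 0" using assms by (simp add: t_def mult.assoc[symmetric])
  have "t - t * unit_sum = 0"
  proof (rule no_orthogonal_idempotent)
    have "unit_sum * (t * b) = 0" for b using et by (simp add: mult.assoc[symmetric])
    then show "(t - t * unit_sum) * (t - t * unit_sum) = t - t * unit_sum"
      using tt et by (simp add: left_diff_distrib right_diff_distrib mult.assoc) (metis mult.assoc)
    fix q assume q: "q \<in> P"
    have "q * t = q * (unit_sum * t)" using P_unit_sum[OF q] by (simp add: mult.assoc[symmetric])
    then show "q * (t - t * unit_sum) = 0" using et by (simp add: right_diff_distrib mult.assoc[symmetric])
    show "(t - t * unit_sum) * q = 0"
      using P_unit_sum[OF q] by (simp add: left_diff_distrib mult.assoc)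
  qed
  then have "t = t * unit_sum" by simp
  then have "t * t = t * (unit_sum * t)" by (metis mult.assoc)
  then have "t = 0" using tt et by simp
  have "p = (p * x * a * y * p) * (p * x * a * y * p)" using p P_idem by simp
  also have "\<dots> = p * x * (a * y * (p * p) * x) * a * y * p" by (simp add: mult.assoc)
  also have "\<dots> = 0" using \<open>t = 0\<close> P_idem[OF p(1)] by (simp add: t_def)
  finally show False using P_nonzero p(1) by blast
qed

lemma right_annihilated_in_radical:
  assumes "a * unit_sum = 0"
  shows "a \<in> radical"
proof (rule ccontr)
  assume "a \<notin> radical"
  then obtain p x y where p: "p \<in> P" "p * x * a * y * p = p" using not_in_radical by blast
  define t where "t = y * p * x * a"
  have tt: "t * t = t"
  proof -
    have "t * t = y * (p * x * a * y * p) * x * a" by (simp add: t_def mult.assoc)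
    then show ?thesis unfolding p(2) by (simp add: t_def mult.assoc)
  qed
  have et: "t * unit_sum = 0" using assms by (simp add: t_def mult.assoc)
  have "t - unit_sum * t = 0"
  proof (rule no_orthogonal_idempotent)
    have "t * (unit_sum * b) = 0" for b using et by (simp add: mult.assoc[symmetric])
    then show "(t - unit_sum * t) * (t - unit_sum * t) = t - unit_sum * t"
      using tt et by (simp add: left_diff_distrib right_diff_distrib mult.assoc)
    fix q assume q: "q \<in> P"
    have "t * q = t * unit_sum * q" using P_unit_sum[OF q] by (simp add: mult.assoc)
    then show "(t - unit_sum * t) * q = 0" using et by (simp add: left_diff_distrib mult.assoc)
    show "q * (t - unit_sum * t) = 0"
      using P_unit_sum[OF q] by (simp add: right_diff_distrib mult.assoc[symmetric])
  qed
  then have "t = unit_sum * t" by simp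
  then have "t * t = t * unit_sum * t" by (metis mult.assoc)
  then have "t = 0" using tt et by simp
  have "p = (p * x * a * y * p) * (p * x * a * y * p)" using p P_idem by simp
  also have "\<dots> = p * x * a * (y * (p * p) * x * a) * y * p" by (simp add: mult.assoc)
  also have "\<dots> = 0" using \<open>t = 0\<close> P_idem[OF p(1)] by (simp add: t_def)
  finally show False using P_nonzero p(1) by blast
qed

text \<open>If \<open>r x z y r = r\<close>, then \<open>z y r x p\<close> is a nonzero idempotent in the corner of \<open>p\<close>, hence equal to
  \<open>p\<close>; so \<open>z\<close> has a right inverse in the corner.\<close>

lemma corner_nonunit_in_radical:
  assumes p: "p \<in> P" and z: "z \<in> corner p" "\<not> corner_unit p z"
  shows "z \<in> radical"
proof (rule ccontr)
  assume "z \<notin> radical"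
  then obtain r x y where r: "r \<in> P" "r * x * z * y * r = r" using not_in_radical by blast
  define g where "g = z * y * r * x * p"
  have pz: "p * z = z" "z * p = z" using z(1) by (simp_all add: cornerD)
  have "g \<in> corner p"
    using pz P_idem[OF p] unfolding corner_def g_def by (simp add: mult.assoc[symmetric]) (simp add: mult.assoc)
  moreover have "g * g = g"
  proof -
    have "g * g = z * y * (r * x * (p * z) * y * r) * x * p" by (simp add: g_def mult.assoc)
    also have "\<dots> = z * y * r * x * p" unfolding pz r(2) ..
    finally show ?thesis by (simp add: g_def)
  qed
  ultimately have "g = 0 \<or> g = p" using P_primitive[OF p] unfolding primitive_def by blast
  moreover have "g \<noteq> 0"
  proof
    assume "g = 0"
    have "r = (r * x * z * y * r) * (r * x * z * y * r)" using r P_idem by simp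
    also have "\<dots> = r * x * (z * y * (r * r) * x * (p * z)) * y * r" unfolding pz by (simp add: mult.assoc)
    also have "\<dots> = r * x * (g * z) * y * r" using P_idem[OF r(1)] by (simp add: g_def mult.assoc)
    finally show False using \<open>g = 0\<close> P_nonzero[OF r(1)] by simp
  qed
  ultimately have "z * (y * r * x * p) = p" by (simp add: g_def mult.assoc)
  then show False using corner_unit_of_right_inverse[OF P_primitive[OF p] z(1)] z(2) by blast
qed

text \<open>A nonzero idempotent of the radical could be taken primitive. Then its corner is local, and
  one of the summands \<open>g p g\<close> with \<open>p\<close> in \<open>P\<close>, or the remaining summand of \<open>g\<close>, is invertible there;
  the former puts \<open>p\<close> into the ideal generated by \<open>g\<close>, the latter
  contradicts the maximality of \<open>P\<close>.\<close>

lemma primitive_not_in_radical: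
  assumes g: "primitive g"
  shows "g \<notin> radical"
proof
  assume rad: "g \<in> radical"
  have gg: "g * g = g" "g \<noteq> 0" using g by (auto simp: primitive_def)
  let ?z = "g * unit_sum * g"
  have z: "?z \<in> corner g" by (rule corner_sandwich[OF gg(1)])
  show False
  proof (cases "corner_unit g ?z")
    case True
    have "?z = (\<Sum>p\<in>P. g * p * g)"
      by (simp add: unit_sum_def sum_distrib_left sum_distrib_right)
    then obtain p where p: "p \<in> P" "corner_unit g (g * p * g)"
      using corner_unit_sum[OF g finite_P, of "\<lambda>p. g * p * g"] True corner_sandwich[OF gg(1)] by auto
    then obtain w where w: "w \<in> corner g" "g * p * g * w = g" unfolding corner_unit_def by blast
    define h where "h = p * g * w * g * p"
    have wg: "w * g = w" using w(1) by (rule cornerD)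
    have "h \<in> corner p"
      using corner_sandwich[OF P_idem[OF p(1)], of "g * w * g"] by (simp add: h_def mult.assoc)
    moreover have "h * h = h"
    proof -
      have "h * h = p * g * w * (g * (p * p) * g * w) * g * p" by (simp add: h_def mult.assoc)
      also have "\<dots> = p * g * w * g * g * p" unfolding P_idem[OF p(1)] w(2) ..
      finally show ?thesis using gg by (simp add: h_def mult.assoc)
    qed
    moreover have "h \<noteq> 0"
    proof
      assume "h = 0"
      have "g * h * g = (g * p * g * w) * (g * p * g)" by (simp add: h_def mult.assoc)
      also have "\<dots> = g * p * g" unfolding w(2) using gg(1) by (simp add: mult.assoc[symmetric])
      finally have "g * p * g = 0" using \<open>h = 0\<close> by simp
      then show False using w(2) gg(2) by simp
    qed
    ultimately have "h = p" using P_primitive[OF p(1)] unfolding primitive_def by blast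
    then have "p * p * g * (w * g) * p = p" using P_idem[OF p(1)] by (simp add: h_def mult.assoc)
    then show False using rad p(1) unfolding radical_def by blast
  next
    case False
    define u where "u = g - ?z"
    have "corner_unit g u" using corner_local[OF g z] False unfolding u_def by blast
    then obtain w where w: "w \<in> corner g" "w * u = g" "u * w = g" unfolding corner_unit_def by blast
    have wg: "w * g = w" "g * w = w" using w(1) by (simp_all add: cornerD)
    have "u \<in> corner g"
      unfolding u_def using z primitive_self[OF g] by (intro subspace_diff subspace_corner)
    then have ug: "g * u = u" "u * g = u" by (simp_all add: cornerD)
    (* If e is the sum of P and f = 1 - e formally, then l = f g, r = g f and u = g f g. The idempotent
       l w r = f g w g f is orthogonal to P. *)
    define l where "l = g - unit_sum * g"
    define r where "r = g - g * unit_sum"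
    have eeb: "unit_sum * (unit_sum * b) = unit_sum * b" for b
      using unit_sum_idem by (simp add: mult.assoc[symmetric])
    have ggb: "g * (g * b) = g * b" for b using gg by (simp add: mult.assoc[symmetric])
    have rl: "r * l = u"
      using gg by (simp add: r_def l_def u_def algebra_simps eeb ggb)
    have gl: "g * l = u" and rg: "r * g = u"
      using gg by (simp_all add: r_def l_def u_def algebra_simps)
    have "l * w * r = 0"
    proof (rule no_orthogonal_idempotent)
      have "(l * w * r) * (l * w * r) = l * (w * (r * l)) * w * r" by (simp add: mult.assoc)
      also have "\<dots> = l * (g * w) * r" unfolding rl w(2) by (simp add: mult.assoc)
      finally show "(l * w * r) * (l * w * r) = l * w * r" unfolding wg .
      fix p assume p: "p \<in> P"
      have "p * l = p * g - p * unit_sum * g" by (simp add: l_def right_diff_distrib mult.assoc)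
      then have "p * l = 0" using P_unit_sum[OF p] by simp
      then show "p * (l * w * r) = 0" by (simp add: mult.assoc[symmetric])
      have "r * p = g * p - g * (unit_sum * p)" by (simp add: r_def left_diff_distrib mult.assoc)
      then have "r * p = 0" using P_unit_sum[OF p] by simp
      then show "l * w * r * p = 0" by (simp add: mult.assoc)
    qed
    moreover have "g * (l * w * r) * g = (g * l) * w * (r * g)" by (simp add: mult.assoc)
    ultimately have "u * w * u = 0" unfolding gl rg by simp
    then have "u = 0" using w(3) ug by simp
    then show False using w(3) gg(2) by simp
  qed
qed

text \<open>An element which is not nilpotent has an idempotent multiple; among the nonzero idempotents of the
  radical one with the smallest corner is primitive.\<close>

lemma radical_nil:
  assumes "a \<in> radical"
  shows "\<exists>n. pw a n = 0"
proof (rule ccontr)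
  assume neg: "\<nexists>n. pw a n = 0"
  obtain w where w: "(a * w) * (a * w) = a * w" "a * w \<noteq> 0"
    using exists_idempotent_multiple[of a] neg by blast
  define I where "I = {g. g \<in> radical \<and> g * g = g \<and> g \<noteq> 0}"
  have "a * w \<in> I"
    using w assms radical_ideal unfolding I_def two_sided_ideal_def by blast
  then obtain g where g: "g \<in> I" and min: "\<And>h. h \<in> I \<Longrightarrow> dim (corner g) \<le> dim (corner h)"
    using ex_has_least_nat[of "\<lambda>g. g \<in> I" "a * w" "\<lambda>g. dim (corner g)"] by blast
  have gg: "g * g = g" "g \<noteq> 0" "g \<in> radical" using g by (auto simp: I_def)
  have "primitive g"
    unfolding primitive_def
  proof (intro conjI ballI impI)
    fix q assume q: "q \<in> corner g" "q * q = q"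
    show "q = 0 \<or> q = g"
    proof (rule ccontr)
      assume neg: "\<not> (q = 0 \<or> q = g)"
      have qg: "g * q = q" "q * g = q" using q(1) by (simp_all add: cornerD)
      have "q \<in> radical" using gg(3) qg(1) radical_ideal unfolding two_sided_ideal_def by metis
      then have "q \<in> I" using q(2) neg by (simp add: I_def)
      have "corner q \<subseteq> corner g"
      proof
        fix x assume "x \<in> corner q"
        then have "q * x = x" "x * q = x" by (simp_all add: cornerD)
        then have "g * x = x" "x * g = x" using qg by (metis mult.assoc)+
        then show "x \<in> corner g" by (simp add: corner_def)
      qed
      moreover have "g \<in> corner g" "g \<notin> corner q" using gg qg neg by (auto simp: corner_def)
      ultimately have "corner q \<subset> corner g" by blast
      then have "span (corner q) \<subset> span (corner g)"
        using subspace_corner by (simp add: span_eq_iff[THEN iffD2])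
      then have "dim (corner q) < dim (corner g)" by (rule dim_psubset)
      then show False using min[OF \<open>q \<in> I\<close>] by simp
    qed
  qed (use gg in auto)
  then show False using primitive_not_in_radical gg(3) by blast
qed

section \<open>Matrix units\<close>

definition linked :: "'a \<Rightarrow> 'a \<Rightarrow> bool" where
  "linked p r \<longleftrightarrow> (\<exists>x y. p * x * r * y * p = p)"

text \<open>The product \<open>r y p x r\<close> is a nonzero idempotent in the corner of the primitive idempotent \<open>r\<close>. So \<open>p\<close> and \<open>r\<close>
  generate the same ideal, and being linked is symmetric.\<close>

lemma linked_flip:
  assumes "p \<in> P" "r \<in> P" "p * x * r * y * p = p"
  shows "r * y * p * x * r = r"
proof -
  let ?q = "r * y * p * x * r"
  have "?q \<in> corner r"
    using corner_sandwich[OF P_idem[OF assms(2)], of "y * p * x"] by (simp add: mult.assoc)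
  moreover have "?q * ?q = ?q"
  proof -
    have "?q * ?q = r * y * (p * x * (r * r) * y * p) * x * r" by (simp add: mult.assoc)
    also have "\<dots> = ?q" unfolding P_idem[OF assms(2)] assms(3) ..
    finally show ?thesis .
  qed
  moreover have "?q \<noteq> 0"
  proof
    assume "?q = 0"
    have "p = (p * x * r * y * p) * (p * x * r * y * p)" using assms P_idem by simp
    also have "\<dots> = p * x * (r * y * (p * p) * x * r) * y * p" by (simp add: mult.assoc)
    also have "\<dots> = 0" unfolding P_idem[OF assms(1)] \<open>?q = 0\<close> by simp
    finally show False using P_nonzero assms(1) by blast
  qed
  ultimately show ?thesis using P_primitive[OF assms(2)] unfolding primitive_def by blast
qed

lemma linked_refl: "p \<in> P \<Longrightarrow> linked p p"
  unfolding linked_def using P_idem by (metis mult.assoc)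

lemma linked_sym: "p \<in> P \<Longrightarrow> r \<in> P \<Longrightarrow> linked p r \<Longrightarrow> linked r p"
  unfolding linked_def using linked_flip by blast

lemma linked_trans:
  assumes "linked p r" "linked r t"
  shows "linked p t"
proof -
  obtain x y x' y' where "p * x * r * y * p = p" "r * x' * t * y' * r = r"
    using assms unfolding linked_def by blast
  then have "p * x * (r * x' * t * y' * r) * y * p = p" by simp
  then have "p * (x * r * x') * t * (y' * r * y) * p = p" by (simp add: mult.assoc)
  then show ?thesis unfolding linked_def by blast
qed

lemma unlinked_in_radical:
  assumes "p \<in> P" "r \<in> P" "\<not> linked p r"
  shows "p * a * r \<in> radical"
proof (rule ccontr)
  assume "p * a * r \<notin> radical"
  then obtain t x y where t: "t \<in> P" "t * x * (p * a * r) * y * t = t" using not_in_radical by blast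
  have "t * x * p * (a * r * y) * t = t" "t * (x * p * a) * r * y * t = t"
    using t(2) by (simp_all add: mult.assoc)
  then have "linked t p" "linked t r" unfolding linked_def by blast+
  then have "linked p r" using linked_sym[OF t(1) assms(1)] linked_trans by blast
  then show False using assms(3) by blast
qed

definition link_class :: "'a \<Rightarrow> 'a set" where
  "link_class p = {r \<in> P. linked p r}"

lemma link_class_eq: "p \<in> P \<Longrightarrow> r \<in> P \<Longrightarrow> linked p r \<Longrightarrow> link_class p = link_class r"
  unfolding link_class_def using linked_sym linked_trans by blast

text \<open>Every linked pair is joined through the chosen representative \<open>s\<close> of its class: with
  \<open>X p Y p = s\<close> and \<open>Y p X p = p\<close> the products \<open>Y p X q\<close> are matrix units.\<close>

lemma exists_matrix_units:
  "\<exists>E. (\<forall>p\<in>P. E p p = p) \<and> (\<forall>p\<in>P. \<forall>q\<in>P. p * E p q = E p q \<and> E p q * q = E p q) \<and>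
     (\<forall>p q r t. p \<in> P \<longrightarrow> q \<in> P \<longrightarrow> r \<in> P \<longrightarrow> t \<in> P \<longrightarrow> linked p q \<longrightarrow> linked r t \<longrightarrow>
       E p q * E r t = (if q = r then E p t else 0))"
proof -
  define s where "s p = (SOME s. s \<in> link_class p)" for p
  have s: "s p \<in> P" "linked p (s p)" if "p \<in> P" for p
  proof -
    have "p \<in> link_class p" using that linked_refl by (simp add: link_class_def)
    then have "s p \<in> link_class p" unfolding s_def by (rule someI)
    then show "s p \<in> P" "linked p (s p)" by (simp_all add: link_class_def)
  qed
  have s_eq: "s p = s q" if "p \<in> P" "q \<in> P" "linked p q" for p q
    using link_class_eq[OF that] by (simp add: s_def)
  have "\<forall>p\<in>P. \<exists>x y. s p * x * p * y * s p = s p"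
  proof
    fix p assume p: "p \<in> P"
    show "\<exists>x y. s p * x * p * y * s p = s p"
      using linked_sym[OF p s(1)[OF p] s(2)[OF p]] unfolding linked_def .
  qed
  then obtain x where "\<forall>p\<in>P. \<exists>y. s p * x p * p * y * s p = s p"
    by (rule bchoice[THEN exE])
  then obtain y where "\<forall>p\<in>P. s p * x p * p * y p * s p = s p"
    by (rule bchoice[THEN exE])
  then have xy: "s p * x p * p * y p * s p = s p" if "p \<in> P" for p using that by blast
  have yx: "p * y p * s p * x p * p = p" if "p \<in> P" for p
    using linked_flip[OF s(1)[OF that] that xy[OF that]] .
  define X where "X p = s p * x p * p" for p
  define Y where "Y p = p * y p * s p" for p
  have XY: "X p * p = X p" "p * Y p = Y p" "s p * X p = X p" "Y p * s p = Y p"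
      "X p * Y p = s p" "Y p * X p = p" if p: "p \<in> P" for p
  proof -
    have idem: "p * p = p" "s p * s p = s p" using p s(1) P_idem by blast+
    have idem': "p * (p * b) = p * b" "s p * (s p * b) = s p * b" for b
      using idem by (simp_all add: mult.assoc[symmetric])
    show "X p * p = X p" "p * Y p = Y p" "s p * X p = X p" "Y p * s p = Y p"
        "X p * Y p = s p" "Y p * X p = p"
      using xy[OF p] yx[OF p] by (simp_all add: X_def Y_def mult.assoc idem idem')
  qed
  have mult: "(Y p * X q) * (Y r * X t) = (if q = r then Y p * X t else 0)"
    if "p \<in> P" "q \<in> P" "r \<in> P" "t \<in> P" "linked p q" "linked r t" for p q r t
  proof (cases "q = r")
    case True
    have "(Y p * X q) * (Y r * X t) = Y p * (X q * Y q) * X t" using True by (simp add: mult.assoc)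
    also have "X q * Y q = s p" using XY(5)[OF that(2)] s_eq[OF that(1,2,5)] by simp
    also have "Y p * s p = Y p" using XY(4)[OF that(1)] .
    finally show ?thesis using True by simp
  next
    case False
    have "(Y p * X q) * (Y r * X t) = Y p * ((X q * q) * (r * Y r)) * X t"
      using XY(1,2) that by (simp add: mult.assoc)
    also have "(X q * q) * (r * Y r) = X q * (q * r) * Y r" by (simp add: mult.assoc)
    also have "q * r = 0" using P_orth that False by blast
    finally show ?thesis using False by simp
  qed
  have "p * (Y p * X q) = Y p * X q" "(Y p * X q) * q = Y p * X q" if "p \<in> P" "q \<in> P" for p q
    using XY(1)[OF that(2)] XY(2)[OF that(1)] by (simp_all add: mult.assoc) (simp add: mult.assoc[symmetric])
  with mult XY(6) show ?thesis
    by (intro exI[of _ "\<lambda>p q. Y p * X q"]) blast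
qed

end

text \<open>The family \<open>C\<close> consists of disjoint sets of labels; for each of them the \<open>E p q\<close> form a
  system of matrix units, and \<open>J\<close> is a nilpotent ideal which together with the matrix units spans
  the algebra. So the algebra is a direct sum of \<open>J\<close> and of full matrix algebras of sizes \<open>card V\<close>,
  \<open>V \<in> C\<close>, as in the theorems of Wedderburn and Malcev. A label is the
  diagonal matrix unit which it indexes.\<close>

locale split_algebra = fd_algebra scale Basis
  for scale :: "'f::field \<Rightarrow> 'a::ring \<Rightarrow> 'a" and Basis +
  fixes C :: "'a set set" and E :: "'a \<Rightarrow> 'a \<Rightarrow> 'a" and J :: "'a set" and m :: nat
  assumes finite_C: "finite C" and finite_class: "V \<in> C \<Longrightarrow> finite V"
    and class_nonempty: "V \<in> C \<Longrightarrow> V \<noteq> {}"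
    and disjoint_classes: "V \<in> C \<Longrightarrow> W \<in> C \<Longrightarrow> V \<noteq> W \<Longrightarrow> V \<inter> W = {}"
    and E_mult: "V \<in> C \<Longrightarrow> W \<in> C \<Longrightarrow> p \<in> V \<Longrightarrow> q \<in> V \<Longrightarrow> r \<in> W \<Longrightarrow> t \<in> W \<Longrightarrow>
      E p q * E r t = (if q = r then E p t else 0)"
    and E_diag: "V \<in> C \<Longrightarrow> p \<in> V \<Longrightarrow> E p p = p"
    and class_nonzero: "V \<in> C \<Longrightarrow> p \<in> V \<Longrightarrow> p \<noteq> 0"
    and J_ideal: "two_sided_ideal J"
    and J_nilpotent: "m \<le> length xs \<Longrightarrow> set xs \<subseteq> J \<Longrightarrow> word_product xs = 0"
    and not_in_J: "a \<notin> J \<Longrightarrow> \<exists>V\<in>C. \<exists>p\<in>V. \<exists>x y. p * x * a * y * p = p"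
    and spanning: "a \<in> span ((\<Union>V\<in>C. {E p q |p q. p \<in> V \<and> q \<in> V}) \<union> J)"

text \<open>The Peirce components \<open>p a q\<close> of \<open>a\<close> with \<open>p\<close>, \<open>q\<close> linked are multiples of matrix units modulo
  the radical, as an element of \<open>p A p\<close> differs from a multiple of \<open>p\<close> by a non-invertible one; all
  other components lie in the radical.\<close>

theorem (in fd_algebra) exists_split:
  assumes closed: "\<And>q :: 'f poly. degree q > 0 \<Longrightarrow> \<exists>x. poly q x = 0"
  shows "\<exists>C E J m. split_algebra scale Basis C E J m"
proof -
  obtain P where "max_orthogonal_idempotents P" using exists_max_orthogonal_idempotents by blast
  then interpret max_idempotents scale Basis P by unfold_locales
  obtain E where E_diag: "\<And>p. p \<in> P \<Longrightarrow> E p p = p"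
    and E_ends: "\<And>p q. p \<in> P \<Longrightarrow> q \<in> P \<Longrightarrow> p * E p q = E p q \<and> E p q * q = E p q"
    and E_mult: "\<And>p q r t. p \<in> P \<Longrightarrow> q \<in> P \<Longrightarrow> r \<in> P \<Longrightarrow> t \<in> P \<Longrightarrow> linked p q \<Longrightarrow> linked r t \<Longrightarrow>
       E p q * E r t = (if q = r then E p t else 0)"
    using exists_matrix_units by blast
  obtain m where m: "\<And>xs. m \<le> length xs \<Longrightarrow> set xs \<subseteq> radical \<Longrightarrow> word_product xs = 0"
    using nil_ideal_nilpotent[OF radical_ideal radical_nil] by blast
  define C where "C = link_class ` P"
  have in_class: "p \<in> P \<and> q \<in> P \<and> linked p q" if V: "V \<in> C" "p \<in> V" "q \<in> V" for V p q
  proof -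
    obtain r where r: "r \<in> P" "V = link_class r" using V(1) by (auto simp: C_def)
    then have pq: "p \<in> P" "q \<in> P" "linked r p" "linked r q" using V by (auto simp: link_class_def)
    then show ?thesis using linked_sym[OF r(1) pq(1,3)] linked_trans by blast
  qed
  let ?U = "(\<Union>V\<in>C. {E p q |p q. p \<in> V \<and> q \<in> V}) \<union> radical"
  have rad_span: "radical \<subseteq> span ?U" using span_superset by blast
  have Peirce: "p * a * q \<in> span ?U" if pq: "p \<in> P" "q \<in> P" for p q a
  proof (cases "linked p q")
    case False
    then show ?thesis using unlinked_in_radical[OF pq] rad_span by blast
  next
    case True
    then have qp: "linked q p" using linked_sym pq by blast
    (* Moved to the corner of p, the component p a q is a scalar modulo the radical. *)
    let ?z = "p * a * E q p"
    have z: "?z \<in> corner p"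
      using P_idem[OF pq(1)] E_ends[OF pq(2,1)] by (simp add: corner_def mult.assoc) (simp add: mult.assoc[symmetric])
    obtain c where c: "\<not> corner_unit p (?z - scale c p)"
      using corner_eigenvalue[OF closed P_primitive[OF pq(1)] z] by blast
    have "?z - scale c p \<in> corner p"
      using z primitive_self[OF P_primitive[OF pq(1)]]
      by (intro subspace_diff subspace_scale subspace_corner)
    then have "?z - scale c p \<in> radical" using corner_nonunit_in_radical[OF pq(1)] c by blast
    then have "(?z - scale c p) * E p q \<in> radical"
      using radical_ideal unfolding two_sided_ideal_def by blast
    moreover have "(?z - scale c p) * E p q = p * a * (E q p * E p q) - scale c (p * E p q)"
      by (simp add: left_diff_distrib mult.assoc scale_mult_eq)
    moreover have "E q p * E p q = q" using E_mult[OF pq(2,1,1,2) qp True] E_diag[OF pq(2)] by simp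
    ultimately have "p * a * q - scale c (E p q) \<in> span ?U"
      using E_ends[OF pq] rad_span by auto
    moreover have "E p q \<in> span ?U"
    proof (rule span_base)
      have "p \<in> link_class p" "q \<in> link_class p" "link_class p \<in> C"
        using pq True linked_refl by (auto simp: link_class_def C_def)
      then show "E p q \<in> ?U" by blast
    qed
    ultimately have "(p * a * q - scale c (E p q)) + scale c (E p q) \<in> span ?U"
      by (intro span_add span_scale)
    then show ?thesis by simp
  qed
  have "a \<in> span ?U" for a
  proof -
    let ?e = unit_sum
    note ee = unit_sum_idem
    have "?e * (a - ?e * a) = 0" using ee by (simp add: right_diff_distrib mult.assoc[symmetric])
    then have 1: "a - ?e * a \<in> span ?U" using left_annihilated_in_radical rad_span by blast
    have "(?e * a - ?e * a * ?e) * ?e = 0" using ee by (simp add: left_diff_distrib mult.assoc)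
    then have 2: "?e * a - ?e * a * ?e \<in> span ?U" using right_annihilated_in_radical rad_span by blast
    have "?e * a * ?e = (\<Sum>q\<in>P. \<Sum>p\<in>P. p * a * q)"
      by (simp add: unit_sum_def sum_distrib_left sum_distrib_right)
    then have 3: "?e * a * ?e \<in> span ?U" by (simp only:) (intro span_sum Peirce)
    have "a = ((a - ?e * a) + (?e * a - ?e * a * ?e)) + ?e * a * ?e" by simp
    then show ?thesis using span_add[OF span_add[OF 1 2] 3] by simp
  qed
  then have "split_algebra scale Basis C E radical m"
  proof unfold_locales
    show "finite C" unfolding C_def using finite_P by simp
    show "finite V" if "V \<in> C" for V
      using that finite_P by (auto simp: C_def link_class_def)
    show "V \<noteq> {}" if "V \<in> C" for V
      using that linked_refl by (auto simp: C_def link_class_def)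
    show "V \<inter> W = {}" if VW: "V \<in> C" "W \<in> C" "V \<noteq> W" for V W
    proof (rule ccontr)
      assume "V \<inter> W \<noteq> {}"
      then obtain r where r: "r \<in> V" "r \<in> W" by blast
      obtain p q where "p \<in> P" "q \<in> P" "V = link_class p" "W = link_class q"
        using VW by (auto simp: C_def)
      moreover from this r have "V = link_class r" "W = link_class r"
        using link_class_eq by (auto simp: link_class_def)
      ultimately show False using VW(3) by simp
    qed
    show "E p q * E r t = (if q = r then E p t else 0)"
      if "V \<in> C" "W \<in> C" "p \<in> V" "q \<in> V" "r \<in> W" "t \<in> W" for V W p q r t
      using in_class[OF that(1,3,4)] in_class[OF that(2,5,6)] E_mult by blast
    show "E p p = p" "p \<noteq> 0" if "V \<in> C" "p \<in> V" for V p
      using in_class[OF that that(2)] E_diag P_nonzero by blast+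
    show "two_sided_ideal radical" by (rule radical_ideal)
    show "word_product xs = 0" if "m \<le> length xs" "set xs \<subseteq> radical" for xs
      using m that by blast
    show "\<exists>V\<in>C. \<exists>p\<in>V. \<exists>x y. p * x * a * y * p = p" if a: "a \<notin> radical" for a
    proof -
      obtain p x y where p: "p \<in> P" "p * x * a * y * p = p" using not_in_radical[OF a] by blast
      have "p \<in> link_class p" "link_class p \<in> C" using p(1) linked_refl by (auto simp: link_class_def C_def)
      then show ?thesis using p(2) by blast
    qed
  qed blast
  then show ?thesis by blast
qed

section \<open>Dimensions of quotient spaces\<close>

lemma vector_space_mult: "vector_space ((*) :: 'f::field \<Rightarrow> 'f \<Rightarrow> 'f)"
  by unfold_locales (simp_all add: algebra_simps)

lemma homogeneous_system_nontrivial_solution: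
  fixes e :: "'t \<Rightarrow> 's \<Rightarrow> 'f::field"
  assumes "finite T" "finite S" "card T < card S"
  shows "\<exists>u. (\<exists>s\<in>S. u s \<noteq> 0) \<and> (\<forall>t\<in>T. (\<Sum>s\<in>S. u s * e t s) = 0)"
  using assms
proof (induction T arbitrary: S e rule: finite_induct)
  case empty
  then obtain s where "s \<in> S" by fastforce
  then show ?case by (intro exI[of _ "\<lambda>_. 1"]) auto
next
  case (insert t T)
  show ?case
  proof (cases "\<forall>s\<in>S. e t s = 0")
    case True
    obtain u where "\<exists>s\<in>S. u s \<noteq> 0" "\<forall>t\<in>T. (\<Sum>s\<in>S. u s * e t s) = 0"
      using insert.IH[of S e] insert.prems insert.hyps by auto
    then show ?thesis using True by (intro exI[of _ u]) auto
  next
    case False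
    then obtain s0 where s0: "s0 \<in> S" "e t s0 \<noteq> 0" by blast
    define S' where "S' = S - {s0}"
    (* Eliminate the unknown u s0 by means of the equation t. *)
    define e' where "e' t' s = e t' s - e t' s0 / e t s0 * e t s" for t' s
    have S': "finite S'" "s0 \<notin> S'" "S = insert s0 S'" using insert.prems s0 by (auto simp: S'_def)
    have "card T < card S'" using insert S' by simp
    then obtain u where u: "\<exists>s\<in>S'. u s \<noteq> 0" "\<forall>t\<in>T. (\<Sum>s\<in>S'. u s * e' t s) = 0"
      using insert.IH[of S' e'] S' by blast
    define c where "c = (\<Sum>s\<in>S'. u s * e t s) / e t s0"
    define v where "v = u(s0 := - c)"
    have v_sum: "(\<Sum>s\<in>S. v s * e t' s) = (\<Sum>s\<in>S'. u s * e t' s) - c * e t' s0" for t'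
    proof -
      have "(\<Sum>s\<in>S'. v s * e t' s) = (\<Sum>s\<in>S'. u s * e t' s)"
        using S'(2) by (intro sum.cong) (auto simp: v_def)
      then show ?thesis using S' by (simp add: v_def)
    qed
    have "(\<Sum>s\<in>S. v s * e t s) = 0" unfolding v_sum c_def using s0 by simp
    moreover have "(\<Sum>s\<in>S. v s * e t' s) = 0" if "t' \<in> T" for t'
    proof -
      have "(\<Sum>s\<in>S'. u s * e' t' s) = (\<Sum>s\<in>S'. u s * e t' s) - (\<Sum>s\<in>S'. u s * e t s) * (e t' s0 / e t s0)"
        unfolding sum_distrib_right sum_subtractf[symmetric]
        by (intro sum.cong refl) (simp add: e'_def right_diff_distrib)
      then show ?thesis using u(2) that unfolding v_sum c_def by simp
    qed
    moreover have "\<exists>s\<in>S. v s \<noteq> 0" using u(1) S' by (auto simp: v_def)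
    ultimately show ?thesis by (intro exI[of _ v]) auto
  qed
qed

definition independent_modulo :: "('f::field \<Rightarrow> 'v::ab_group_add \<Rightarrow> 'v) \<Rightarrow> 'v set \<Rightarrow> 'v set \<Rightarrow> bool" where
  "independent_modulo sc W B \<longleftrightarrow>
     (\<forall>S u. finite S \<and> S \<subseteq> B \<and> (\<Sum>v\<in>S. sc (u v) v) \<in> W \<longrightarrow> (\<forall>v\<in>S. u v = 0))"

lemma independent_moduloD:
  "independent_modulo sc W B \<Longrightarrow> finite S \<Longrightarrow> S \<subseteq> B \<Longrightarrow> (\<Sum>v\<in>S. sc (u v) v) \<in> W \<Longrightarrow> v \<in> S \<Longrightarrow> u v = 0"
  unfolding independent_modulo_def by blast

text \<open>The functionals \<open>e t\<close> detect membership in \<open>W\<close>, so that they embed \<open>V / W\<close> into a space of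
  dimension \<open>card T\<close>. In particular the quotient has a finite basis.\<close>

lemma quotient_dim_bounds:
  fixes scale :: "'f::field \<Rightarrow> 'v::ab_group_add \<Rightarrow> 'v" and e :: "'t \<Rightarrow> 'v \<Rightarrow> 'f"
  assumes "vector_space scale" and W: "module.subspace scale W" and V: "module.subspace scale V"
    and T: "finite T" and e: "\<And>t. t \<in> T \<Longrightarrow> Vector_Spaces.linear scale (*) (e t)"
    and detect: "\<And>v. v \<in> V \<Longrightarrow> (\<And>t. t \<in> T \<Longrightarrow> e t v = 0) \<Longrightarrow> v \<in> W"
  shows "quotient_dim scale V W \<le> card T"
    and "B \<subseteq> V \<Longrightarrow> independent_modulo scale W B \<Longrightarrow> card B \<le> quotient_dim scale V W"
proof -
  interpret vector_space scale by fact
  have bound: "finite B \<and> card B \<le> card T" if B: "B \<subseteq> V" "independent_modulo scale W B" for B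
  proof (rule ccontr)
    assume neg: "\<not> (finite B \<and> card B \<le> card T)"
    have "\<exists>S \<subseteq> B. finite S \<and> card T < card S"
    proof (cases "finite B")
      case False
      then obtain S where "S \<subseteq> B" "finite S" "card S = Suc (card T)"
        using infinite_arbitrarily_large by blast
      then show ?thesis by auto
    qed (use neg in auto)
    then obtain S where S: "S \<subseteq> B" "finite S" "card T < card S" by blast
    obtain u where u: "\<exists>s\<in>S. u s \<noteq> 0" "\<forall>t\<in>T. (\<Sum>s\<in>S. u s * e t s) = 0"
      using homogeneous_system_nontrivial_solution[OF T S(2,3)] by blast
    have "(\<Sum>s\<in>S. scale (u s) s) \<in> W"
    proof (rule detect)
      show "(\<Sum>s\<in>S. scale (u s) s) \<in> V"
        using S(1) B(1) by (intro subspace_sum[OF V] subspace_scale[OF V]) auto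
      fix t assume t: "t \<in> T"
      interpret et: Vector_Spaces.linear scale "(*)" "e t" using e[OF t] .
      show "e t (\<Sum>s\<in>S. scale (u s) s) = 0"
        using u(2) t by (simp add: et.sum et.scale)
    qed
    then show False using independent_moduloD[OF B(2) S(2,1), of u] u(1) by blast
  qed
  have extend: "\<exists>B. quotient_basis scale V W B \<and> B0 \<subseteq> B" if B0: "B0 \<subseteq> V" "independent_modulo scale W B0" for B0
  proof -
    let ?Q = "\<lambda>B. B \<subseteq> V \<and> independent_modulo scale W B \<and> B0 \<subseteq> B"
    have "?Q B0" using B0 by blast
    moreover have "\<forall>B. ?Q B \<longrightarrow> card B < Suc (card T)" using bound by (auto simp: less_Suc_eq_le)
    ultimately have "\<exists>B. ?Q B \<and> (\<forall>B'. ?Q B' \<longrightarrow> card B' \<le> card B)"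
      by (rule ex_has_greatest_nat)
    then obtain B where B: "?Q B" and max: "\<And>B'. ?Q B' \<Longrightarrow> card B' \<le> card B" by blast
    have finB: "finite B" using B bound by blast
    have "\<exists>b\<in>span B. v - b \<in> W" if v: "v \<in> V" for v
    proof (rule ccontr)
      assume neg: "\<not> (\<exists>b\<in>span B. v - b \<in> W)"
      have "v \<notin> B"
      proof
        assume "v \<in> B"
        then have "v \<in> span B" by (rule span_base)
        moreover have "v - v \<in> W" using subspace_0[OF W] by simp
        ultimately show False using neg by blast
      qed
      have "independent_modulo scale W (insert v B)"
        unfolding independent_modulo_def
      proof (intro allI impI)
        fix S u assume S: "finite S \<and> S \<subseteq> insert v B \<and> (\<Sum>s\<in>S. scale (u s) s) \<in> W"
        define S' where "S' = S - {v}"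
        have S': "finite S'" "S' \<subseteq> B" "v \<notin> S'" using S by (auto simp: S'_def)
        have zero: "u v = 0" if vS: "v \<in> S"
        proof (rule ccontr)
          assume uv: "u v \<noteq> 0"
          let ?b = "scale (- inverse (u v)) (\<Sum>s\<in>S'. scale (u s) s)"
          have "?b \<in> span B"
            using S'(2) by (intro span_scale span_sum span_base) auto
          moreover have "S = insert v S'" using vS by (auto simp: S'_def)
          then have "(\<Sum>s\<in>S. scale (u s) s) = scale (u v) v + (\<Sum>s\<in>S'. scale (u s) s)"
            using S' by simp
          then have "v - ?b = scale (inverse (u v)) (\<Sum>s\<in>S. scale (u s) s)"
            using uv by (simp add: scale_right_distrib)
          then have "v - ?b \<in> W" using S subspace_scale[OF W] by simp
          ultimately show False using neg by blast
        qed
        have "(\<Sum>s\<in>S'. scale (u s) s) = (\<Sum>s\<in>S. scale (u s) s)"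
          unfolding S'_def using S zero by (intro sum.mono_neutral_left) auto
        then have in_W: "(\<Sum>s\<in>S'. scale (u s) s) \<in> W" using S by simp
        have ind: "independent_modulo scale W B" using B by simp
        have "\<forall>s\<in>S'. u s = 0"
          by (rule ballI) (rule independent_moduloD[OF ind S'(1,2) in_W])
        then show "\<forall>s\<in>S. u s = 0" using zero by (auto simp: S'_def)
      qed
      then have "card (insert v B) \<le> card B" using B v by (intro max) blast
      then show False using \<open>v \<notin> B\<close> finB by simp
    qed
    then have "\<forall>v\<in>V. \<exists>b\<in>span B. v - b \<in> W" by (rule ballI)
    then have "quotient_basis scale V W B"
      using B unfolding quotient_basis_def independent_modulo_def[symmetric] by simp
    then show ?thesis using B by blast
  qed
  have qdim: "quotient_dim scale V W = card B \<and> finite B" if "quotient_basis scale V W B" for B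
  proof -
    have "finite B"
      using that bound unfolding quotient_basis_def independent_modulo_def[symmetric] by simp
    then show ?thesis using quotient_dim_eq_card[OF assms(1) W that] by blast
  qed
  have "independent_modulo scale W {}" by (simp add: independent_modulo_def)
  then obtain B where B: "quotient_basis scale V W B" using extend[of "{}"] by blast
  then have "B \<subseteq> V" "independent_modulo scale W B"
    unfolding quotient_basis_def independent_modulo_def[symmetric] by simp_all
  then show "quotient_dim scale V W \<le> card T" using bound qdim[OF B] by simp
  show "card B \<le> quotient_dim scale V W" if B': "B \<subseteq> V" "independent_modulo scale W B" for B
  proof -
    obtain B1 where B1: "quotient_basis scale V W B1" "B \<subseteq> B1" using extend[OF B'] by blast
    then show ?thesis using qdim[OF B1(1)] by (metis card_mono)
  qed
qed

section \<open>Multilinear \<open>G\<close>-polynomials\<close>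

definition multilinear_words :: "'g monoid \<Rightarrow> nat \<Rightarrow> (nat \<times> 'g) list set" where
  "multilinear_words G n =
     {w. distinct (map fst w) \<and> set (map fst w) = {1..n} \<and> snd ` set w \<subseteq> carrier G}"

text \<open>Monomials are handled as words below: the permutation is read off from the first components.\<close>

lemma multilinear_gpolys_eq:
  "multilinear_gpolys G n = module.span gpoly_scale ((\<lambda>w. Poly_Mapping.single w 1) ` multilinear_words G n)"
proof -
  have "{map (\<lambda>i. (\<sigma> i, g i)) [1..<Suc n] | \<sigma> g. \<sigma> permutes {1..n} \<and> g \<in> {1..n} \<rightarrow> carrier G}
      = multilinear_words G n" (is "?L = ?R")
  proof (intro equalityI subsetI)
    fix w assume "w \<in> ?L"
    then obtain \<sigma> g where w: "w = map (\<lambda>i. (\<sigma> i, g i)) [1..<Suc n]"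
      and \<sigma>: "\<sigma> permutes {1..n}" and g: "g \<in> {1..n} \<rightarrow> carrier G" by blast
    have fst_w: "map fst w = map \<sigma> [1..<Suc n]" by (simp add: w)
    have "inj_on \<sigma> {1..n}" using permutes_inj_on[OF \<sigma>] .
    then have "distinct (map fst w)"
      unfolding fst_w by (simp add: distinct_map atLeastLessThanSuc_atLeastAtMost del: upt_Suc)
    moreover have "set (map fst w) = {1..n}"
      unfolding fst_w using permutes_image[OF \<sigma>]
      by (simp add: atLeastLessThanSuc_atLeastAtMost del: upt_Suc)
    moreover have "snd ` set w \<subseteq> carrier G"
      using g by (auto simp: w simp del: upt_Suc)
    ultimately show "w \<in> ?R" by (simp add: multilinear_words_def)
  next
    fix w assume "w \<in> ?R"
    then have w: "distinct (map fst w)" "set (map fst w) = {1..n}" "snd ` set w \<subseteq> carrier G"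
      by (auto simp: multilinear_words_def)
    have len: "length w = n" using distinct_card[OF w(1)] w(2) by simp
    define \<sigma> where "\<sigma> i = (if i \<in> {1..n} then fst (w ! (i - 1)) else i)" for i
    define g where "g i = snd (w ! (i - 1))" for i
    have w_eq: "w = map (\<lambda>i. (\<sigma> i, g i)) [1..<Suc n]"
      using len by (intro nth_equalityI) (auto simp: \<sigma>_def g_def simp del: upt_Suc)
    have "\<sigma> ` {1..n} = {1..n}"
    proof -
      have "map fst w = map \<sigma> [1..<Suc n]" by (subst w_eq) simp
      then show ?thesis
        using w(2) by (metis set_map set_upt atLeastLessThanSuc_atLeastAtMost)
    qed
    then have "bij_betw \<sigma> {1..n} {1..n}"
      by (simp add: bij_betw_def eq_card_imp_inj_on)
    then have "\<sigma> permutes {1..n}"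
      by (rule bij_imp_permutes) (auto simp: \<sigma>_def)
    moreover have "g \<in> {1..n} \<rightarrow> carrier G"
      using len by (auto simp: g_def intro!: subsetD[OF w(3)] imageI nth_mem)
    ultimately show "w \<in> ?L" using w_eq by blast
  qed
  from this[symmetric] have "(\<lambda>w. Poly_Mapping.single w (1 :: 'b)) ` multilinear_words G n =
    {Poly_Mapping.single (map (\<lambda>i. (\<sigma> i, g i)) [1..<Suc n]) 1 | \<sigma> g.
        \<sigma> permutes {1..n} \<and> g \<in> {1..n} \<rightarrow> carrier G}"
    by (simp only:) blast
  then show ?thesis unfolding multilinear_gpolys_def by simp
qed

definition word_value :: "('g \<Rightarrow> 'a::ring \<Rightarrow> 'a) \<Rightarrow> (nat \<Rightarrow> 'a) \<Rightarrow> (nat \<times> 'g) list \<Rightarrow> 'a" where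
  "word_value \<psi> a w = word_product (map (\<lambda>(j, g). \<psi> g (a j)) w)"

lemma word_product_Cons: "xs \<noteq> [] \<Longrightarrow> word_product (x # xs) = x * word_product xs"
  by (cases xs) simp_all

interpretation gp: vector_space "gpoly_scale :: 'f::field \<Rightarrow> ('g, 'f) gpoly \<Rightarrow> _"
  by (rule vector_space_gpoly_scale)

lemma (in assoc_algebra) substitute_superset:
  assumes "finite K" "Poly_Mapping.keys f \<subseteq> K"
  shows "substitute scale \<psi> a f = (\<Sum>w\<in>K. scale (Poly_Mapping.lookup f w) (word_value \<psi> a w))"
  unfolding substitute_def word_value_def using assms
  by (intro sum.mono_neutral_left) (auto simp: in_keys_iff)

lemma (in assoc_algebra) substitute_linear:
  "Vector_Spaces.linear gpoly_scale scale (substitute scale \<psi> a)"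
proof -
  have "substitute scale \<psi> a (f + g) = substitute scale \<psi> a f + substitute scale \<psi> a g" for f g
  proof -
    let ?K = "Poly_Mapping.keys f \<union> Poly_Mapping.keys g"
    have "Poly_Mapping.keys (f + g) \<subseteq> ?K" by (rule Poly_Mapping.keys_add)
    then show ?thesis
      by (simp add: substitute_superset[of ?K] lookup_add scale_left_distrib sum.distrib)
  qed
  moreover have "substitute scale \<psi> a (gpoly_scale c f) = scale c (substitute scale \<psi> a f)" for c f
  proof -
    have "Poly_Mapping.keys (gpoly_scale c f) \<subseteq> Poly_Mapping.keys f" by (auto simp: in_keys_iff)
    then show ?thesis
      by (simp add: substitute_superset[of "Poly_Mapping.keys f"] scale_sum_right)
  qed
  ultimately show ?thesis
    by (simp add: Vector_Spaces.linear_iff vector_space_gpoly_scale vector_space_axioms)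
qed

lemma (in assoc_algebra) substitute_single:
  "substitute scale \<psi> a (Poly_Mapping.single w 1) = word_value \<psi> a w"
  by (simp add: substitute_superset[of "{w}"])

lemma multilinear_in_free_algebra:
  assumes "n \<ge> 1" "f \<in> multilinear_gpolys G n"
  shows "f \<in> free_algebra G"
proof -
  have "gp.subspace (free_algebra G)"
  proof (rule gp.subspaceI)
    show "0 \<in> free_algebra G" by (simp add: free_algebra_def)
    show "f + h \<in> free_algebra G" if "f \<in> free_algebra G" "h \<in> free_algebra G" for f h
      using that subsetD[OF Poly_Mapping.keys_add[of f h]] unfolding free_algebra_def by blast
    show "gpoly_scale c f \<in> free_algebra G" if "f \<in> free_algebra G" for c f
      using that by (simp add: free_algebra_def in_keys_iff)
  qed
  moreover have "(\<lambda>w. Poly_Mapping.single w 1) ` multilinear_words G n \<subseteq> free_algebra G"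
    using assms(1) by (fastforce simp: multilinear_words_def free_algebra_def split: if_splits)
  ultimately show ?thesis
    using assms(2) gp.span_minimal[of _ "free_algebra G"] unfolding multilinear_gpolys_eq by auto
qed

text \<open>Linearity of the action makes a multilinear \<open>G\<close>-polynomial a multilinear function of the
  elements substituted.\<close>

locale linear_action = fd_algebra scale Basis
  for scale :: "'f::field \<Rightarrow> 'a::ring \<Rightarrow> 'a" and Basis +
  fixes G :: "'g monoid" and \<psi> :: "'g \<Rightarrow> 'a \<Rightarrow> 'a"
  assumes action_linear: "g \<in> carrier G \<Longrightarrow> Vector_Spaces.linear scale scale (\<psi> g)"
begin

lemma subspace_vanishing: "gp.subspace {f. substitute scale \<psi> a f = 0}"
proof -
  interpret s: Vector_Spaces.linear gpoly_scale scale "substitute scale \<psi> a" by (rule substitute_linear)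
  show ?thesis by (rule gp.subspaceI) (simp_all add: s.zero s.add s.scale)
qed

lemma vanishing_on_multilinear:
  assumes "\<And>w. w \<in> multilinear_words G n \<Longrightarrow> word_value \<psi> a w = 0" "f \<in> multilinear_gpolys G n"
  shows "substitute scale \<psi> a f = 0"
proof -
  have "multilinear_gpolys G n \<subseteq> {f. substitute scale \<psi> a f = 0}"
    unfolding multilinear_gpolys_eq
    using assms(1) by (intro gp.span_minimal subspace_vanishing) (auto simp: substitute_single)
  then show ?thesis using assms(2) by blast
qed

lemma word_value_linear:
  assumes "distinct (map fst w)" "k \<in> set (map fst w)" "snd ` set w \<subseteq> carrier G"
  shows "Vector_Spaces.linear scale scale (\<lambda>x. word_value \<psi> (a(k := x)) w)"
  using assms
proof (induction w)
  case (Cons c w)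
  obtain j g where c: "c = (j, g)" by (rule prod.exhaust)
  have g: "Vector_Spaces.linear scale scale (\<psi> g)" using Cons.prems c by (auto intro: action_linear)
  interpret g: Vector_Spaces.linear scale scale "\<psi> g" by (rule g)
  have rest: "word_value \<psi> (a(k := x)) w = word_value \<psi> a w" if "k \<notin> set (map fst w)" for x
    unfolding word_value_def
    using that by (intro arg_cong[of _ _ word_product] map_cong) force+
  show ?case
  proof (cases "w = []")
    case True
    then have "j = k" using Cons.prems c by simp
    then have "(\<lambda>x. word_value \<psi> (a(k := x)) (c # w)) = \<psi> g"
      using True c by (simp add: word_value_def fun_eq_iff)
    then show ?thesis using g by (simp only:)
  next
    case False
    have step: "word_value \<psi> b (c # w) = \<psi> g (b j) * word_value \<psi> b w" for b
      using False c by (simp add: word_value_def word_product_Cons)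
    show ?thesis
    proof (cases "j = k")
      case True
      then have "k \<notin> set (map fst w)" using Cons.prems c by simp
      then have "word_value \<psi> (a(k := x)) (c # w) = \<psi> g x * word_value \<psi> a w" for x
        unfolding step using True rest by simp
      then have eq: "(\<lambda>x. word_value \<psi> (a(k := x)) (c # w)) = (\<lambda>x. \<psi> g x * word_value \<psi> a w)"
        by (rule ext)
      show ?thesis
        unfolding eq by (simp add: Vector_Spaces.linear_iff vector_space_axioms g.add g.scale distrib_right scale_mult_eq)
    next
      case False
      then have "k \<in> set (map fst w)" using Cons.prems c by auto
      then have "Vector_Spaces.linear scale scale (\<lambda>x. word_value \<psi> (a(k := x)) w)"
        using Cons.prems by (intro Cons.IH) auto
      then interpret r: Vector_Spaces.linear scale scale "\<lambda>x. word_value \<psi> (a(k := x)) w" .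
      have "word_value \<psi> (a(k := x)) (c # w) = \<psi> g (a j) * word_value \<psi> (a(k := x)) w" for x
        unfolding step using False by simp
      then have eq: "(\<lambda>x. word_value \<psi> (a(k := x)) (c # w)) = (\<lambda>x. \<psi> g (a j) * word_value \<psi> (a(k := x)) w)"
        by (rule ext)
      show ?thesis
        unfolding eq by (simp add: Vector_Spaces.linear_iff vector_space_axioms r.add r.scale distrib_left scale_mult_eq)
    qed
  qed
qed simp

text \<open>The arguments from the spanning set are replaced by arbitrary ones, one after the other.\<close>

lemma identity_if_vanishing_on_spanning_set:
  assumes D: "\<And>x. x \<in> span D" and f: "f \<in> multilinear_gpolys G n"
    and zero: "\<And>a. (\<And>k. k \<in> {1..n} \<Longrightarrow> a k \<in> D) \<Longrightarrow> substitute scale \<psi> a f = 0"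
  shows "substitute scale \<psi> a f = 0"
proof -
  have "substitute scale \<psi> a f = 0" if "\<And>k. k \<in> {Suc m..n} \<Longrightarrow> a k \<in> D" for m a
    using that
  proof (induction m arbitrary: a)
    case 0
    then show ?case by (intro zero) simp
  next
    case (Suc m)
    show ?case
    proof (cases "Suc m \<in> {1..n}")
      case False
      then show ?thesis using Suc by (intro Suc.IH) auto
    next
      case True
      have lin: "Vector_Spaces.linear scale scale (\<lambda>x. substitute scale \<psi> (a(Suc m := x)) f)"
      proof -
        have "gp.subspace {f. Vector_Spaces.linear scale scale (\<lambda>x. substitute scale \<psi> (a(Suc m := x)) f)}"
        proof (rule gp.subspaceI)
          interpret s: Vector_Spaces.linear gpoly_scale scale "substitute scale \<psi> b" for b by (rule substitute_linear)
          show "0 \<in> {f. Vector_Spaces.linear scale scale (\<lambda>x. substitute scale \<psi> (a(Suc m := x)) f)}"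
            by (simp add: Vector_Spaces.linear_iff vector_space_axioms s.zero)
          show "f + h \<in> {f. Vector_Spaces.linear scale scale (\<lambda>x. substitute scale \<psi> (a(Suc m := x)) f)}"
            if fh: "f \<in> {f. Vector_Spaces.linear scale scale (\<lambda>x. substitute scale \<psi> (a(Suc m := x)) f)}"
              "h \<in> {f. Vector_Spaces.linear scale scale (\<lambda>x. substitute scale \<psi> (a(Suc m := x)) f)}" for f h
          proof -
            interpret lf: Vector_Spaces.linear scale scale "\<lambda>x. substitute scale \<psi> (a(Suc m := x)) f" using fh by simp
            interpret lh: Vector_Spaces.linear scale scale "\<lambda>x. substitute scale \<psi> (a(Suc m := x)) h" using fh by simp
            show ?thesis
              by (simp add: Vector_Spaces.linear_iff vector_space_axioms s.add lf.add lh.add lf.scale lh.scale scale_right_distrib)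
          qed
          show "gpoly_scale c f \<in> {f. Vector_Spaces.linear scale scale (\<lambda>x. substitute scale \<psi> (a(Suc m := x)) f)}"
            if fc: "f \<in> {f. Vector_Spaces.linear scale scale (\<lambda>x. substitute scale \<psi> (a(Suc m := x)) f)}" for c f
          proof -
            interpret lf: Vector_Spaces.linear scale scale "\<lambda>x. substitute scale \<psi> (a(Suc m := x)) f" using fc by simp
            show ?thesis
              by (simp add: Vector_Spaces.linear_iff vector_space_axioms s.scale lf.add lf.scale scale_right_distrib mult.commute)
          qed
        qed
        moreover have "(\<lambda>w. Poly_Mapping.single w 1) ` multilinear_words G n
            \<subseteq> {f. Vector_Spaces.linear scale scale (\<lambda>x. substitute scale \<psi> (a(Suc m := x)) f)}"
          using True by (auto simp: substitute_single multilinear_words_def intro!: word_value_linear)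
        ultimately have "multilinear_gpolys G n
            \<subseteq> {f. Vector_Spaces.linear scale scale (\<lambda>x. substitute scale \<psi> (a(Suc m := x)) f)}"
          unfolding multilinear_gpolys_eq by (rule gp.span_minimal[rotated])
        then show ?thesis using f by auto
      qed
      interpret l: Vector_Spaces.linear scale scale "\<lambda>x. substitute scale \<psi> (a(Suc m := x)) f" by (rule lin)
      have "subspace {x. substitute scale \<psi> (a(Suc m := x)) f = 0}"
        by (rule subspaceI_closed) (simp_all add: l.zero l.add l.scale)
      moreover have "D \<subseteq> {x. substitute scale \<psi> (a(Suc m := x)) f = 0}"
        using Suc.prems by (auto intro!: Suc.IH)
      ultimately have "span D \<subseteq> {x. substitute scale \<psi> (a(Suc m := x)) f = 0}"
        by (intro span_minimal)
      then have "substitute scale \<psi> (a(Suc m := a (Suc m))) f = 0" using D by blast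
      then show ?thesis by simp
    qed
  qed
  from this[of n a] show ?thesis by simp
qed

lemma subspace_identities: "gp.subspace (multilinear_gpolys G n \<inter> Id_G scale G \<psi>)"
  if "n \<ge> 1"
proof -
  have "multilinear_gpolys G n \<inter> Id_G scale G \<psi> = multilinear_gpolys G n \<inter> (\<Inter>a. {f. substitute scale \<psi> a f = 0})"
    using multilinear_in_free_algebra[OF that] by (auto simp: Id_G_def)
  moreover have "gp.subspace (multilinear_gpolys G n)"
    unfolding multilinear_gpolys_eq by (rule gp.subspace_span)
  moreover have "gp.subspace (\<Inter>a. {f. substitute scale \<psi> a f = 0})"
    using subspace_vanishing by (intro gp.subspace_Inter) auto
  ultimately show ?thesis by (simp only:) (rule gp.subspace_inter)
qed

text \<open>Codimensions through evaluation: a multilinear polynomial is determined modulo identities by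
  the coordinates of its values on tuples from a spanning set, and only those tuples count on
  which not all monomials vanish.\<close>

lemma codim_bounds:
  assumes n: "n \<ge> 1" and D: "finite D" "\<And>x. x \<in> span D"
    and A: "A \<subseteq> {1..n} \<rightarrow>\<^sub>E D"
    and vanish: "\<And>a w. a \<in> ({1..n} \<rightarrow>\<^sub>E D) - A \<Longrightarrow> w \<in> multilinear_words G n \<Longrightarrow> word_value \<psi> a w = 0"
  shows "codim_G scale G \<psi> n \<le> card A * card Basis"
    and "Z \<subseteq> multilinear_gpolys G n \<Longrightarrow>
      independent_modulo gpoly_scale (multilinear_gpolys G n \<inter> Id_G scale G \<psi>) Z \<Longrightarrow> card Z \<le> codim_G scale G \<psi> n"
proof -
  let ?V = "multilinear_gpolys G n :: ('g, 'f) gpoly set" and ?W = "multilinear_gpolys G n \<inter> Id_G scale G \<psi>"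
  define e where "e = (\<lambda>(a, b) f. representation Basis (substitute scale \<psi> a f) b)"
  have span_B: "x \<in> span Basis" for x using span_Basis by blast
  have fin: "finite (A \<times> Basis)"
    using finite_subset[OF A] D(1) finite_Basis by (auto intro: finite_PiE)
  have lin: "Vector_Spaces.linear gpoly_scale (*) (e t)" for t
  proof -
    obtain a b where t: "t = (a, b)" by (rule prod.exhaust)
    interpret s: Vector_Spaces.linear gpoly_scale scale "substitute scale \<psi> a" by (rule substitute_linear)
    show ?thesis
      unfolding t e_def prod.case
      unfolding Vector_Spaces.linear_iff
      by (simp add: vector_space_gpoly_scale vector_space_mult s.add s.scale representation_add[OF independent_Basis span_B span_B]
          representation_scale[OF independent_Basis span_B] algebra_simps)
  qed
  have detect: "f \<in> ?W" if f: "f \<in> ?V" and zero: "\<And>t. t \<in> A \<times> Basis \<Longrightarrow> e t f = 0" for f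
  proof -
    have "substitute scale \<psi> a f = 0" for a
    proof (rule identity_if_vanishing_on_spanning_set[OF D(2) f])
      fix a :: "nat \<Rightarrow> 'a" assume aD: "\<And>k. k \<in> {1..n} \<Longrightarrow> a k \<in> D"
      define a' where "a' = restrict a {1..n}"
      have a'D: "a' \<in> {1..n} \<rightarrow>\<^sub>E D" using aD by (auto simp: a'_def)
      have zero': "substitute scale \<psi> a' f = 0"
      proof (cases "a' \<in> A")
        case True
        have "representation Basis (substitute scale \<psi> a' f) b = 0" for b
        proof (cases "b \<in> Basis")
          case b: True
          then show ?thesis using zero[of "(a', b)"] True by (simp add: e_def)
        next
          case False
          then show ?thesis using representation_ne_zero[of Basis "substitute scale \<psi> a' f" b] by argo
        qed
        then show ?thesis
          using sum_nonzero_representation_eq[OF independent_Basis span_B, of "substitute scale \<psi> a' f"] by simp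
      next
        case False
        then show ?thesis using vanish a'D by (intro vanishing_on_multilinear[OF _ f]) auto
      qed
      have same: "word_value \<psi> a w = word_value \<psi> a' w" if w: "w \<in> multilinear_words G n" for w
      proof -
        have "a j = a' j" if "(j, g) \<in> set w" for j g
        proof -
          have "fst (j, g) \<in> set (map fst w)" unfolding set_map using that by (rule imageI)
          also have "set (map fst w) = {1..n}" using w by (simp add: multilinear_words_def)
          finally show ?thesis by (simp add: a'_def)
        qed
        then show ?thesis
          unfolding word_value_def by (intro arg_cong[of _ _ word_product] map_cong) auto
      qed
      interpret s: Vector_Spaces.linear gpoly_scale scale "substitute scale \<psi> b" for b by (rule substitute_linear)
      have "gp.subspace {f. substitute scale \<psi> a f = substitute scale \<psi> a' f}"
        by (rule gp.subspaceI) (simp_all add: s.zero s.add s.scale)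
      then have "?V \<subseteq> {f. substitute scale \<psi> a f = substitute scale \<psi> a' f}"
        unfolding multilinear_gpolys_eq
        by (intro gp.span_minimal) (auto simp: substitute_single same)
      then show "substitute scale \<psi> a f = 0" using f zero' by auto
    qed
    then show ?thesis using f multilinear_in_free_algebra[OF n f] by (simp add: Id_G_def)
  qed
  have subV: "gp.subspace ?V" unfolding multilinear_gpolys_eq by (rule gp.subspace_span)
  note subW = subspace_identities[OF n]
  show "codim_G scale G \<psi> n \<le> card A * card Basis"
    unfolding codim_G_def card_cartesian_product[symmetric]
    by (rule quotient_dim_bounds(1)[where e = e, OF vector_space_gpoly_scale subW subV fin lin detect])
  show "card Z \<le> codim_G scale G \<psi> n"
    if "Z \<subseteq> ?V" "independent_modulo gpoly_scale ?W Z"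
    unfolding codim_G_def
    by (rule quotient_dim_bounds(2)[where e = e, OF vector_space_gpoly_scale subW subV fin lin detect that])
qed

end

section \<open>The exponent of a split algebra\<close>

context split_algebra
begin

definition units :: "'a set \<Rightarrow> 'a set" where
  "units V = {E p q |p q. p \<in> V \<and> q \<in> V}"

text \<open>The blocks of an admissible set may occur in any order in the nonzero product, and several
  times.\<close>

definition admissible :: "'a set set \<Rightarrow> bool" where
  "admissible I \<longleftrightarrow> I \<subseteq> C \<and>
     (I \<noteq> {} \<longrightarrow> (\<exists>zs. word_product zs \<noteq> 0 \<and> (\<forall>V\<in>I. \<exists>z\<in>set zs. z \<in> units V)))"

definition weight :: "'a set set \<Rightarrow> nat" where
  "weight I = (\<Sum>V\<in>I. (card V)\<^sup>2)"

definition exponent :: nat where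
  "exponent = Max (weight ` {I. admissible I})"

lemma finite_admissible: "finite {I. admissible I}"
  by (rule finite_subset[of _ "Pow C"]) (auto simp: admissible_def finite_C)

lemma admissible_empty: "admissible {}"
  by (simp add: admissible_def)

lemma weight_le_exponent: "admissible I \<Longrightarrow> weight I \<le> exponent"
  unfolding exponent_def using finite_admissible by (intro Max_ge) auto

lemma exponent_attained: "\<exists>I. admissible I \<and> weight I = exponent"
proof -
  have "exponent \<in> weight ` {I. admissible I}"
    unfolding exponent_def using finite_admissible admissible_empty by (intro Max_in) auto
  then show ?thesis by auto
qed

lemma units_image: "units V = (\<lambda>(p, q). E p q) ` (V \<times> V)"
  by (auto simp: units_def)

lemma finite_units: "V \<in> C \<Longrightarrow> finite (units V)"
  unfolding units_image using finite_class by simp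

lemma card_units_le: "V \<in> C \<Longrightarrow> card (units V) \<le> (card V)\<^sup>2"
  unfolding units_image using finite_class card_image_le[of "V \<times> V"]
  by (simp add: card_cartesian_product power2_eq_square)

lemma E_nonzero:
  assumes "V \<in> C" "p \<in> V" "q \<in> V"
  shows "E p q \<noteq> 0"
  using E_mult[OF assms(1,1) assms(2,3,3,2)] E_diag[OF assms(1,2)] class_nonzero[OF assms(1,2)]
  by auto

lemma units_disjoint:
  assumes "V \<in> C" "W \<in> C" "z \<in> units V" "z \<in> units W"
  shows "V = W"
proof (rule ccontr)
  assume "V \<noteq> W"
  obtain p q where "z = E p q" "p \<in> V" "q \<in> V" using assms(3) by (auto simp: units_def)
  moreover obtain r t where "z = E r t" "r \<in> W" "t \<in> W" using assms(4) by (auto simp: units_def)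
  ultimately have z: "z = E p q" "p \<in> V" "q \<in> V" "z = E r t" "r \<in> W" "t \<in> W" by simp_all
  have "p \<noteq> r" using disjoint_classes[OF assms(1,2) \<open>V \<noteq> W\<close>] z by blast
  then have "E p p * E r t = 0" using E_mult[OF assms(1,2) z(2,2,5,6)] by (simp only: if_False)
  moreover have "E p p * E p q = E p q" using E_mult[OF assms(1,1) z(2,2,2,3)] by simp
  ultimately show False using E_nonzero[OF assms(1) z(2,3)] z(1,4) by simp
qed

lemma J_mult: "x \<in> J \<Longrightarrow> a * x \<in> J" "x \<in> J \<Longrightarrow> x * a \<in> J"
  using J_ideal unfolding two_sided_ideal_def by blast+

lemma subspace_J: "subspace J"
  using J_ideal unfolding two_sided_ideal_def by blast

section \<open>The upper bound for the codimensions\<close>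

text \<open>Absorbing the other factors, a product is a product of as many elements of \<open>J\<close> as it has
  factors from \<open>J\<close>; so this number is bounded if the product does not vanish.\<close>

lemma word_product_collapse:
  assumes "\<exists>z\<in>set zs. z \<in> J"
  shows "\<exists>xs. set xs \<subseteq> J \<and> length xs = length (filter (\<lambda>z. z \<in> J) zs) \<and> word_product zs = word_product xs"
  using assms
proof (induction zs)
  case (Cons z zs)
  show ?case
  proof (cases "\<exists>z\<in>set zs. z \<in> J")
    case True
    then obtain xs where xs: "set xs \<subseteq> J" "length xs = length (filter (\<lambda>z. z \<in> J) zs)"
        "word_product zs = word_product xs"
      using Cons.IH by blast
    have "zs \<noteq> []" using True by auto
    have "xs \<noteq> []" using True xs(2) by (auto simp: filter_empty_conv)
    then obtain x xs' where x: "xs = x # xs'" by (cases xs) auto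
    have word: "word_product (z # zs) = z * word_product xs"
      using \<open>zs \<noteq> []\<close> xs(3) by (simp add: word_product_Cons)
    show ?thesis
    proof (cases "z \<in> J")
      case True
      then show ?thesis
        using xs(1,2) word \<open>xs \<noteq> []\<close> by (intro exI[of _ "z # xs"]) (auto simp: word_product_Cons)
    next
      case False
      have "z * word_product (x # xs') = word_product (z * x # xs')"
        by (cases xs') (simp_all add: mult.assoc)
      then show ?thesis
        using False xs(1,2) word x J_mult(1) by (intro exI[of _ "z * x # xs'"]) auto
    qed
  next
    case False
    then have "z \<in> J" and f: "filter (\<lambda>z. z \<in> J) zs = []" using Cons.prems by (auto simp: filter_empty_conv)
    then have "word_product (z # zs) \<in> J" by (cases zs) (auto intro: J_mult(2))
    then show ?thesis
      using \<open>z \<in> J\<close> f by (intro exI[of _ "[word_product (z # zs)]"]) simp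
  qed
qed simp

lemma count_J_le:
  assumes "word_product zs \<noteq> 0"
  shows "length (filter (\<lambda>z. z \<in> J) zs) \<le> m"
proof (cases "\<exists>z\<in>set zs. z \<in> J")
  case True
  then obtain xs where "set xs \<subseteq> J" "length xs = length (filter (\<lambda>z. z \<in> J) zs)" "word_product zs = word_product xs"
    using word_product_collapse by blast
  then show ?thesis using J_nilpotent[of xs] assms by fastforce
next
  case False
  then have "filter (\<lambda>z. z \<in> J) zs = []" by (simp add: filter_empty_conv)
  then show ?thesis by (metis list.size(3) le0)
qed

lemma nonzero_on_span:
  assumes "Vector_Spaces.linear scale scale T" "x \<in> span S" "T x \<noteq> 0"
  shows "\<exists>z\<in>S. T z \<noteq> 0"
proof (rule ccontr)
  assume neg: "\<not> (\<exists>z\<in>S. T z \<noteq> 0)"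
  interpret T: Vector_Spaces.linear scale scale T by fact
  have "subspace {x. T x = 0}" by (rule subspaceI_closed) (simp_all add: T.zero T.add T.scale)
  then have "span S \<subseteq> {x. T x = 0}" using neg by (intro span_minimal) auto
  then show False using assms(2,3) by blast
qed

text \<open>A nonzero product remains nonzero after suitable replacement of its factors by members of sets
  which span them. The linear map \<open>T\<close> stands for multiplication by factors treated already.\<close>

lemma word_product_choice:
  assumes "Vector_Spaces.linear scale scale T" "list_all2 (\<lambda>x S. x \<in> span S) xs Ss" "xs \<noteq> []"
    and "T (word_product xs) \<noteq> 0"
  shows "\<exists>zs. list_all2 (\<in>) zs Ss \<and> T (word_product zs) \<noteq> 0"
  using assms
proof (induction xs arbitrary: T Ss)
  case (Cons x xs)
  obtain S Ss' where Ss: "Ss = S # Ss'" "x \<in> span S" "list_all2 (\<lambda>x S. x \<in> span S) xs Ss'"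
    using Cons.prems(2) by (auto simp: list_all2_Cons1)
  interpret T: Vector_Spaces.linear scale scale T by (rule Cons.prems(1))
  show ?case
  proof (cases "xs = []")
    case True
    then obtain z where "z \<in> S" "T z \<noteq> 0"
      using nonzero_on_span[OF Cons.prems(1) Ss(2)] Cons.prems(4) by auto
    then show ?thesis using True Ss by (intro exI[of _ "[z]"]) auto
  next
    case False
    have "Vector_Spaces.linear scale scale (\<lambda>y. T (y * word_product xs))"
      by (simp add: Vector_Spaces.linear_iff vector_space_axioms distrib_right T.add scale_mult_eq T.scale)
    then obtain z where z: "z \<in> S" "T (z * word_product xs) \<noteq> 0"
      using nonzero_on_span[of "\<lambda>y. T (y * word_product xs)" x S] Ss(2) Cons.prems(4) False
      by (auto simp: word_product_Cons)
    have "Vector_Spaces.linear scale scale (\<lambda>y. T (z * y))"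
      by (simp add: Vector_Spaces.linear_iff vector_space_axioms distrib_left T.add scale_mult_eq T.scale)
    then obtain zs where zs: "list_all2 (\<in>) zs Ss'" "T (z * word_product zs) \<noteq> 0"
      using Cons.IH[of "\<lambda>y. T (z * y)" Ss'] Ss(3) False z(2) by blast
    have "zs \<noteq> []" using zs(1) Ss(3) False by auto
    then show ?thesis
      using z(1) zs Ss(1) by (intro exI[of _ "z # zs"]) (simp add: word_product_Cons)
  qed
qed simp

end

locale block_action = split_algebra scale Basis C E J m + linear_action scale Basis G \<psi>
  for scale :: "'f::field \<Rightarrow> 'a::ring \<Rightarrow> 'a" and Basis C E J m and G :: "'g monoid" and \<psi> +
  assumes action_J: "g \<in> carrier G \<Longrightarrow> x \<in> J \<Longrightarrow> \<psi> g x \<in> J"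
    and action_block: "g \<in> carrier G \<Longrightarrow> V \<in> C \<Longrightarrow> x \<in> units V \<Longrightarrow> \<psi> g x \<in> span (units V \<union> J)"
begin

text \<open>If a monomial does not vanish on a tuple of matrix units and elements of \<open>J\<close>, then one of the
  terms of its expansion does not vanish. The blocks occurring in this term are admissible, and a
  position outside these blocks contributes a factor from \<open>J\<close>.\<close>

lemma nonvanishing_word:
  assumes w: "w \<in> multilinear_words G n" and n: "n \<ge> 1"
    and D: "\<And>k. k \<in> {1..n} \<Longrightarrow> a k \<in> (\<Union>V\<in>C. units V) \<union> J"
    and nz: "word_value \<psi> a w \<noteq> 0"
  shows "\<exists>I. admissible I \<and> card {k \<in> {1..n}. a k \<notin> (\<Union>V\<in>I. units V)} \<le> m"
proof -
  have w': "distinct (map fst w)" "set (map fst w) = {1..n}" "snd ` set w \<subseteq> carrier G"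
    using w by (auto simp: multilinear_words_def)
  have "w \<noteq> []" using w'(2) n by auto
  define S where "S d = J \<union> (\<Union>V\<in>{V\<in>C. d \<in> units V}. units V)" for d
  have span_S: "\<psi> g d \<in> span (S d)" if g: "g \<in> carrier G" and d: "d \<in> (\<Union>V\<in>C. units V) \<union> J" for g d
  proof (cases "d \<in> J")
    case True
    then have "\<psi> g d \<in> S d" using action_J[OF g] by (simp add: S_def)
    then show ?thesis by (rule span_base)
  next
    case False
    then obtain V where V: "V \<in> C" "d \<in> units V" using d by blast
    have "units V \<union> J \<subseteq> S d" using V by (auto simp: S_def)
    then show ?thesis using action_block[OF g V] span_mono by blast
  qed
  let ?xs = "map (\<lambda>(j, g). \<psi> g (a j)) w" and ?Ss = "map (\<lambda>(j, g). S (a j)) w"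
  have "list_all2 (\<lambda>x S. x \<in> span S) ?xs ?Ss"
    unfolding list_all2_conv_all_nth
  proof (intro conjI allI impI)
    fix i assume "i < length ?xs"
    then have i: "i < length w" by simp
    obtain j g where jg: "w ! i = (j, g)" by (rule prod.exhaust)
    have mem: "(j, g) \<in> set w" using nth_mem[OF i] jg by simp
    then have "fst (j, g) \<in> set (map fst w)" unfolding set_map by (rule imageI)
    then have "a j \<in> (\<Union>V\<in>C. units V) \<union> J" using D w'(2) by simp
    moreover have "g \<in> carrier G" using mem w'(3) by force
    ultimately have "\<psi> g (a j) \<in> span (S (a j))" by (intro span_S)
    then show "?xs ! i \<in> span (?Ss ! i)" using i jg by simp
  qed simp
  then have "\<exists>zs. list_all2 (\<in>) zs ?Ss \<and> word_product zs \<noteq> 0"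
    using nz \<open>w \<noteq> []\<close> unfolding word_value_def
    by (intro word_product_choice[where T = "\<lambda>x. x" and xs = ?xs]) (simp_all add: linear_ident)
  then obtain zs where zs: "list_all2 (\<in>) zs ?Ss" "word_product zs \<noteq> 0" by blast
  have len: "length zs = length w" using list_all2_lengthD[OF zs(1)] by simp
  define I where "I = {V\<in>C. \<exists>z\<in>set zs. z \<in> units V}"
  have "admissible I" using zs(2) by (auto simp: admissible_def I_def)
  have "{k \<in> {1..n}. a k \<notin> (\<Union>V\<in>I. units V)} \<subseteq> (\<lambda>i. fst (w ! i)) ` {i. i < length zs \<and> zs ! i \<in> J}"
  proof
    fix k assume "k \<in> {k \<in> {1..n}. a k \<notin> (\<Union>V\<in>I. units V)}"
    then have k: "k \<in> set (map fst w)" "a k \<notin> (\<Union>V\<in>I. units V)" using w'(2) by auto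
    then obtain i where i: "i < length w" "fst (w ! i) = k" by (auto simp: in_set_conv_nth)
    have "zs ! i \<in> ?Ss ! i" using list_all2_nthD2[OF zs(1), of i] i(1) by simp
    also have "?Ss ! i = S (a k)" using i by (simp add: split_beta)
    finally have z: "zs ! i \<in> S (a k)" .
    have "zs ! i \<in> J"
    proof (rule ccontr)
      assume "zs ! i \<notin> J"
      then obtain V where V: "V \<in> C" "a k \<in> units V" "zs ! i \<in> units V" using z by (auto simp: S_def)
      then have "V \<in> I" unfolding I_def using nth_mem[of i zs] i(1) len by auto
      then show False using k(2) V(2) by blast
    qed
    then show "k \<in> (\<lambda>i. fst (w ! i)) ` {i. i < length zs \<and> zs ! i \<in> J}" using i len by auto
  qed
  then have "card {k \<in> {1..n}. a k \<notin> (\<Union>V\<in>I. units V)} \<le> card {i. i < length zs \<and> zs ! i \<in> J}"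
    by (rule surj_card_le[rotated]) simp
  also have "\<dots> = length (filter (\<lambda>z. z \<in> J) zs)" by (rule length_filter_conv_card[symmetric])
  also have "\<dots> \<le> m" using zs(2) by (rule count_J_le)
  finally show ?thesis using \<open>admissible I\<close> by blast
qed

end

text \<open>Choose a set of at most \<open>m\<close> exceptional positions and then the values. The hypothesis \<open>n > m\<close>
  makes the bound hold for empty \<open>D'\<close> too, when both sides vanish.\<close>

lemma card_almost_in:
  fixes D D' :: "'a set"
  assumes "finite D" "D' \<subseteq> D" "n > m"
  shows "card {a \<in> {1..n} \<rightarrow>\<^sub>E D. card {k \<in> {1..n}. a k \<notin> D'} \<le> m}
    \<le> (n + 1) ^ m * (card D + 1) ^ m * card D' ^ n"
proof -
  let ?A = "{a \<in> {1..n} \<rightarrow>\<^sub>E D. card {k \<in> {1..n}. a k \<notin> D'} \<le> m}"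
  define Xs where "Xs = {X. X \<subseteq> {1..n} \<and> card X \<le> m}"
  define B where "B X = Pi\<^sub>E {1..n} (\<lambda>k. if k \<in> X then D else D')" for X
  have finB: "finite (B X)" for X
    unfolding B_def using assms(1,2) by (intro finite_PiE) (auto intro: finite_subset)
  have finXs: "finite Xs" unfolding Xs_def by simp
  have "?A \<subseteq> (\<Union>X\<in>Xs. B X)"
  proof
    fix a assume a: "a \<in> ?A"
    then have "{k \<in> {1..n}. a k \<notin> D'} \<in> Xs" "a \<in> B {k \<in> {1..n}. a k \<notin> D'}"
      by (auto simp: Xs_def B_def PiE_iff)
    then show "a \<in> (\<Union>X\<in>Xs. B X)" by blast
  qed
  then have "card ?A \<le> card (\<Union>X\<in>Xs. B X)" using finXs finB by (intro card_mono) auto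
  also have "\<dots> \<le> (\<Sum>X\<in>Xs. card (B X))" using finXs by (rule card_UN_le)
  also have "\<dots> \<le> (\<Sum>X\<in>Xs. (card D + 1) ^ m * card D' ^ n)"
  proof (rule sum_mono)
    fix X assume "X \<in> Xs"
    then have X: "X \<subseteq> {1..n}" "card X \<le> m" by (auto simp: Xs_def)
    have "card (B X) = (\<Prod>k\<in>{1..n}. if k \<in> X then card D else card D')"
      unfolding B_def by (simp add: card_PiE if_distrib)
    also have "\<dots> = card D ^ card X * card D' ^ card ({1..n} - X)"
      using X(1) by (simp add: prod.If_cases Int_absorb1 Diff_eq)
    also have "\<dots> \<le> (card D + 1) ^ m * card D' ^ n"
    proof (rule mult_le_mono)
      have "card D ^ card X \<le> (card D + 1) ^ card X" by (rule power_mono) simp_all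
      also have "\<dots> \<le> (card D + 1) ^ m" using X(2) by (rule power_increasing) simp
      finally show "card D ^ card X \<le> (card D + 1) ^ m" .
      have c: "card ({1..n} - X) = n - card X"
        using X(1) by (simp add: card_Diff_subset finite_subset)
      show "card D' ^ card ({1..n} - X) \<le> card D' ^ n"
      proof (cases "card D' = 0")
        case True
        then show ?thesis using c X(2) assms(3) by (simp add: zero_power)
      next
        case False
        then show ?thesis unfolding c by (intro power_increasing) auto
      qed
    qed
    finally show "card (B X) \<le> (card D + 1) ^ m * card D' ^ n" .
  qed
  also have "\<dots> = card Xs * ((card D + 1) ^ m * card D' ^ n)" by simp
  also have "card Xs \<le> (n + 1) ^ m"
  proof -
    let ?L = "{xs. set xs \<subseteq> {0..n} \<and> length xs = m}"
    have finL: "finite ?L" by (rule finite_lists_length_eq) simp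
    have "Xs \<subseteq> (\<lambda>xs. set xs - {0}) ` ?L"
    proof
      fix X assume "X \<in> Xs"
      then have X: "X \<subseteq> {1..n}" "card X \<le> m" by (auto simp: Xs_def)
      then obtain xs where xs: "set xs = X" "distinct xs"
        using finite_distinct_list[of X] finite_subset by blast
      have "length xs = card X" using distinct_card[OF xs(2)] xs(1) by simp
      then have "xs @ replicate (m - card X) 0 \<in> ?L" using X xs by auto
      moreover have "X = set (xs @ replicate (m - card X) 0) - {0}" using X xs by auto
      ultimately show "X \<in> (\<lambda>xs. set xs - {0}) ` ?L" by (rule rev_image_eqI)
    qed
    then have "card Xs \<le> card ?L" using finL by (rule surj_card_le[rotated])
    also have "\<dots> = (n + 1) ^ m" using card_lists_length_eq[of "{0..n}" m] by simp
    finally show ?thesis .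
  qed
  finally show ?thesis by (simp add: mult_ac)
qed

context block_action
begin

theorem codim_upper_bound: "\<exists>K. \<forall>n>m. codim_G scale G \<psi> n \<le> K * (n + 1) ^ m * exponent ^ n"
proof -
  obtain DJ where DJ: "DJ \<subseteq> J" "independent DJ" "J \<subseteq> span DJ"
    by (rule basis_exists)
  define U where "U = (\<Union>V\<in>C. units V)"
  define D where "D = U \<union> DJ"
  have finD: "finite D"
    unfolding D_def U_def using finite_C finite_units finiteI_independent[OF DJ(2)] by auto
  have span_D: "x \<in> span D" for x
  proof -
    have "U \<subseteq> span D" "J \<subseteq> span D"
      using span_superset[of D] order_trans[OF DJ(3) span_mono[of DJ D]] by (simp_all add: D_def)
    then have "span (U \<union> J) \<subseteq> span D" by (intro span_minimal) auto
    moreover have "x \<in> span (U \<union> J)" using spanning[of x] by (simp add: U_def units_def)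
    ultimately show ?thesis by blast
  qed
  define K where "K = 2 ^ card C * (card D + 1) ^ m * card Basis"
  have "codim_G scale G \<psi> n \<le> K * (n + 1) ^ m * exponent ^ n" if n: "n > m" for n
  proof -
    define A where "A = (\<Union>I\<in>{I. admissible I}. {a \<in> {1..n} \<rightarrow>\<^sub>E D. card {k \<in> {1..n}. a k \<notin> (\<Union>V\<in>I. units V)} \<le> m})"
    have A: "A \<subseteq> {1..n} \<rightarrow>\<^sub>E D" unfolding A_def by blast
    have "codim_G scale G \<psi> n \<le> card A * card Basis"
    proof (rule codim_bounds(1)[OF _ finD span_D A])
      show "n \<ge> 1" using n by simp
      fix a w assume a: "a \<in> ({1..n} \<rightarrow>\<^sub>E D) - A" and w: "w \<in> multilinear_words G n"
      have aD: "a k \<in> (\<Union>V\<in>C. units V) \<union> J" if "k \<in> {1..n}" for k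
        using a that DJ(1) by (auto simp: D_def U_def PiE_iff)
      show "word_value \<psi> a w = 0"
      proof (rule ccontr)
        assume nz: "word_value \<psi> a w \<noteq> 0"
        have "n \<ge> 1" using n by simp
        from nonvanishing_word[OF w this aD nz]
        obtain I where "admissible I" "card {k \<in> {1..n}. a k \<notin> (\<Union>V\<in>I. units V)} \<le> m"
          by blast
        then have "a \<in> A" using a by (auto simp: A_def)
        then show False using a by blast
      qed
    qed
    also have "card A \<le> (\<Sum>I\<in>{I. admissible I}. (n + 1) ^ m * (card D + 1) ^ m * exponent ^ n)"
      unfolding A_def
    proof (rule order_trans[OF card_UN_le[OF finite_admissible] sum_mono])
      fix I assume "I \<in> {I. admissible I}"
      then have I: "admissible I" "I \<subseteq> C" by (auto simp: admissible_def)
      have finI: "finite I" using I(2) finite_C by (rule finite_subset)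
      let ?D' = "\<Union>V\<in>I. units V"
      have "?D' \<subseteq> D" using I(2) by (auto simp: D_def U_def)
      from card_almost_in[OF finD this n]
      have "card {a \<in> {1..n} \<rightarrow>\<^sub>E D. card {k \<in> {1..n}. a k \<notin> ?D'} \<le> m}
        \<le> (n + 1) ^ m * (card D + 1) ^ m * card ?D' ^ n" .
      also have "card ?D' \<le> exponent"
      proof -
        have "card ?D' \<le> (\<Sum>V\<in>I. card (units V))" using finI by (rule card_UN_le)
        also have "\<dots> \<le> weight I"
          unfolding weight_def by (intro sum_mono card_units_le subsetD[OF I(2)])
        also have "\<dots> \<le> exponent" using I(1) by (rule weight_le_exponent)
        finally show ?thesis .
      qed
      then have "card ?D' ^ n \<le> exponent ^ n" by (rule power_mono) simp
      finally show "card {a \<in> {1..n} \<rightarrow>\<^sub>E D. card {k \<in> {1..n}. a k \<notin> ?D'} \<le> m}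
        \<le> (n + 1) ^ m * (card D + 1) ^ m * exponent ^ n" by simp
    qed
    also have "\<dots> \<le> 2 ^ card C * ((n + 1) ^ m * (card D + 1) ^ m * exponent ^ n)"
    proof -
      have "card {I. admissible I} \<le> card (Pow C)"
        using finite_C by (intro card_mono) (auto simp: admissible_def)
      then show ?thesis using finite_C by (simp add: card_Pow)
    qed
    finally show ?thesis by (simp add: K_def mult_ac)
  qed
  then show ?thesis by blast
qed

end

section \<open>The lower bound for the codimensions\<close>

context split_algebra
begin

text \<open>A term \<open>(V, b, g)\<close> stands for a slot at the vertex \<open>b\<close> of the block \<open>V\<close>, into which products
  of matrix units can be inserted, followed by the fixed element \<open>g\<close>.\<close>

definition slot_product :: "'a \<Rightarrow> ('a set \<times> 'a \<times> 'a) list \<Rightarrow> 'a" where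
  "slot_product = foldl (\<lambda>y (V, b, g). y * b * g)"

lemma slot_product_simps [simp]:
  "slot_product y [] = y" "slot_product y ((V, b, g) # ts) = slot_product (y * b * g) ts"
  by (simp_all add: slot_product_def)

lemma slot_product_mult: "slot_product (x * y) ts = x * slot_product y ts"
proof (induction ts arbitrary: y)
  case (Cons t ts)
  obtain V b g where "t = (V, b, g)" by (rule prod_cases3)
  then show ?case using Cons[of "y * b * g"] by (simp add: mult.assoc)
qed simp

lemma slot_product_0 [simp]: "slot_product 0 ts = 0"
  using slot_product_mult[of 0 0 ts] by simp

lemma foldl_mult: "foldl (*) (x * y) zs = x * foldl (*) y zs" for x y :: 'a
  by (induction zs arbitrary: y) (simp_all add: mult.assoc)

lemma word_product_foldl: "word_product (z # zs) = foldl (*) z zs" for z :: 'a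
proof (induction zs arbitrary: z)
  case (Cons y ys)
  then show ?case by (simp add: foldl_mult)
qed simp

lemma E_absorb:
  assumes "V \<in> C" "p \<in> V" "q \<in> V"
  shows "p * E p q = E p q" "E p q * q = E p q"
  using E_mult[OF assms(1,1), of p p p q] E_mult[OF assms(1,1), of p q q q] E_diag[OF assms(1)] assms by simp_all

lemma class_idem: "V \<in> C \<Longrightarrow> b \<in> V \<Longrightarrow> b * b = b"
  using E_absorb[of V b b] E_diag by simp

text \<open>As \<open>E p q = p (E p q)\<close>, a word can be cut in front of the first matrix unit from each block of
  \<open>I\<close>. The first slot is preceded by the prefix \<open>y\<close> and, unless the word is empty or starts with such
  a matrix unit, by a further factor \<open>h\<close>.\<close>

lemma word_with_slots:
  assumes "I \<subseteq> C"
  shows "\<exists>ts. distinct (map fst ts) \<and> set (map fst ts) = {V \<in> I. \<exists>z\<in>set zs. z \<in> units V} \<and>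
    (\<forall>(V, b, g)\<in>set ts. b \<in> V) \<and>
    ((\<forall>y. slot_product y ts = foldl (*) y zs) \<or> (\<exists>h. \<forall>y. slot_product (y * h) ts = foldl (*) y zs))"
  using assms
proof (induction zs arbitrary: I)
  case Nil
  show ?case by (rule exI[of _ "[]"]) simp
next
  case (Cons z zs)
  show ?case
  proof (cases "\<exists>V\<in>I. z \<in> units V")
    case False
    obtain ts where ts: "distinct (map fst ts)" "set (map fst ts) = {V \<in> I. \<exists>z\<in>set zs. z \<in> units V}"
        "\<forall>(V, b, g)\<in>set ts. b \<in> V"
      and val: "(\<forall>y. slot_product y ts = foldl (*) y zs) \<or> (\<exists>h. \<forall>y. slot_product (y * h) ts = foldl (*) y zs)"
      using Cons.IH[OF Cons.prems] by blast
    have "\<exists>h. \<forall>y. slot_product (y * h) ts = foldl (*) y (z # zs)"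
      using val
    proof
      assume "\<forall>y. slot_product y ts = foldl (*) y zs"
      then show ?thesis by (intro exI[of _ z]) simp
    next
      assume "\<exists>h. \<forall>y. slot_product (y * h) ts = foldl (*) y zs"
      then obtain h where "\<forall>y. slot_product (y * h) ts = foldl (*) y zs" by blast
      then show ?thesis by (intro exI[of _ "z * h"]) (simp add: mult.assoc[symmetric])
    qed
    moreover have "{V \<in> I. \<exists>z\<in>set (z # zs). z \<in> units V} = {V \<in> I. \<exists>z\<in>set zs. z \<in> units V}"
      using False by auto
    ultimately show ?thesis using ts by (intro exI[of _ ts]) simp
  next
    case True
    then obtain V where V: "V \<in> I" "z \<in> units V" by blast
    then have VC: "V \<in> C" using Cons.prems by blast
    obtain p q where z: "z = E p q" "p \<in> V" "q \<in> V" using V(2) by (auto simp: units_def)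
    obtain ts where ts: "distinct (map fst ts)" "set (map fst ts) = {W \<in> I - {V}. \<exists>z\<in>set zs. z \<in> units W}"
        "\<forall>(V, b, g)\<in>set ts. b \<in> V"
      and val: "(\<forall>y. slot_product y ts = foldl (*) y zs) \<or> (\<exists>h. \<forall>y. slot_product (y * h) ts = foldl (*) y zs)"
      using Cons.IH[of "I - {V}"] Cons.prems by blast
    have pz: "p * z = z" unfolding z(1) using E_absorb(1)[OF VC z(2,3)] .
    have "\<exists>g. \<forall>y. slot_product y ((V, p, g) # ts) = foldl (*) y (z # zs)"
      using val
    proof
      assume "\<forall>y. slot_product y ts = foldl (*) y zs"
      then show ?thesis using pz by (intro exI[of _ z]) (simp add: mult.assoc)
    next
      assume "\<exists>h. \<forall>y. slot_product (y * h) ts = foldl (*) y zs"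
      then obtain h where h: "\<And>y. slot_product (y * h) ts = foldl (*) y zs" by blast
      have "slot_product y ((V, p, z * h) # ts) = foldl (*) y (z # zs)" for y
      proof -
        have "p * (z * h) = z * h" using pz by (simp add: mult.assoc[symmetric])
        then show ?thesis using h[of "y * z"] by (simp add: mult.assoc)
      qed
      then show ?thesis by blast
    qed
    then obtain g where g: "\<forall>y. slot_product y ((V, p, g) # ts) = foldl (*) y (z # zs)" by blast
    have uniq: "W = V" if "W \<in> I" "z \<in> units W" for W
      using units_disjoint[OF subsetD[OF Cons.prems that(1)] VC that(2) V(2)] .
    have "(W \<in> {W \<in> I. \<exists>z\<in>set (z # zs). z \<in> units W}) =
        (W \<in> insert V {W \<in> I - {V}. \<exists>z\<in>set zs. z \<in> units W})" for W
    proof (cases "W = V")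
      case True
      then show ?thesis using V by simp
    next
      case False
      then show ?thesis using uniq[of W] by auto
    qed
    then have "{W \<in> I. \<exists>z\<in>set (z # zs). z \<in> units W} = insert V {W \<in> I - {V}. \<exists>z\<in>set zs. z \<in> units W}"
      by (rule Set.set_eqI)
    then show ?thesis
      using ts z(2) g by (intro exI[of _ "(V, p, g) # ts"] conjI) auto
  qed
qed

lemma admissible_slots:
  assumes "admissible I" "I \<noteq> {}"
  shows "\<exists>z y ts. distinct (map fst ts) \<and> set (map fst ts) = I \<and> (\<forall>(V, b, g)\<in>set ts. b \<in> V) \<and>
    z * slot_product y ts \<noteq> 0"
proof -
  have I: "I \<subseteq> C" using assms(1) by (simp add: admissible_def)
  obtain zs where zs: "word_product zs \<noteq> 0" "\<forall>V\<in>I. \<exists>z\<in>set zs. z \<in> units V"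
    using assms by (auto simp: admissible_def)
  (* Either the first letter can serve as the prefix, or it is a matrix unit E p q from a block in I
     and p can. *)
  have "\<exists>x xs. foldl (*) x xs \<noteq> 0 \<and> (\<forall>V\<in>I. \<exists>z\<in>set xs. z \<in> units V)"
  proof -
    obtain z0 zs' where z0: "zs = z0 # zs'" using zs(1) by (cases zs) auto
    show ?thesis
    proof (cases "\<exists>V\<in>I. z0 \<in> units V")
      case True
      then obtain V p q where "V \<in> C" "z0 = E p q" "p \<in> V" "q \<in> V"
        using I by (auto simp: units_def)
      then have "p * z0 = z0" using E_absorb(1) by blast
      then have "foldl (*) p zs \<noteq> 0" using zs(1) z0 by (simp add: word_product_foldl)
      then show ?thesis using zs(2) by blast
    next
      case False
      then show ?thesis using zs z0 by (intro exI[of _ z0] exI[of _ zs']) (auto simp: word_product_foldl)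
    qed
  qed
  then obtain x xs where x: "foldl (*) x xs \<noteq> 0" and xs: "\<forall>V\<in>I. \<exists>z\<in>set xs. z \<in> units V" by blast
  obtain ts where ts: "distinct (map fst ts)" "set (map fst ts) = {V \<in> I. \<exists>z\<in>set xs. z \<in> units V}"
      "\<forall>(V, b, g)\<in>set ts. b \<in> V"
    and val: "(\<forall>y. slot_product y ts = foldl (*) y xs) \<or> (\<exists>h. \<forall>y. slot_product (y * h) ts = foldl (*) y xs)"
    using word_with_slots[OF I] by blast
  have I_eq: "set (map fst ts) = I" using ts(2) xs by auto
  have "\<exists>z y. z * slot_product y ts \<noteq> 0"
    using val
  proof
    assume "\<forall>y. slot_product y ts = foldl (*) y xs"
    then have nz: "slot_product x ts \<noteq> 0" using x by simp
    (* Without a factor h the base vertex of the first slot, an idempotent, takes its place. *)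
    obtain V b g ts' where t: "ts = (V, b, g) # ts'" using I_eq assms(2) by (cases ts) auto
    then have "V \<in> C" "b \<in> V" using I I_eq ts(3) by auto
    then have "x * slot_product b ts = slot_product x ts"
      using class_idem unfolding t by (simp add: slot_product_mult[symmetric] mult.assoc)
    then show ?thesis using nz by metis
  next
    assume "\<exists>h. \<forall>y. slot_product (y * h) ts = foldl (*) y xs"
    then show ?thesis using x by (metis slot_product_mult)
  qed
  then show ?thesis using ts(1,3) I_eq by blast
qed

text \<open>The fixed elements, cut down by the idempotents at both neighbouring slots.\<close>

fun glue :: "'a \<Rightarrow> ('a set \<times> 'a \<times> 'a) list \<Rightarrow> 'a list" where
  "glue y [] = [y]"
| "glue y ((V, b, g) # ts) = y * b # glue (b * g) ts"

lemma length_glue [simp]: "length (glue y ts) = Suc (length ts)"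
  by (induction y ts rule: glue.induct) simp_all

end

text \<open>The words of \<open>ws\<close> fill the slots between the letters of \<open>ks\<close>.\<close>

fun weave :: "'i list \<Rightarrow> 'i list list \<Rightarrow> 'i list" where
  "weave (k # ks) (w # ws) = k # w @ weave ks ws"
| "weave ks ws = ks"

lemma set_weave: "length ks = Suc (length ws) \<Longrightarrow> set (weave ks ws) = set ks \<union> set (concat ws)"
  by (induction ks ws rule: weave.induct) auto

lemma distinct_weave:
  assumes "length ks = Suc (length ws)" "distinct ks" "distinct (concat ws)" "set ks \<inter> set (concat ws) = {}"
  shows "distinct (weave ks ws)"
  using assms
proof (induction ks ws rule: weave.induct)
  case (1 k ks w ws)
  have "set (weave ks ws) = set ks \<union> set (concat ws)" using 1(2) by (intro set_weave) simp
  moreover have "distinct (weave ks ws)" using 1 by (intro "1.IH") auto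
  ultimately show ?case using 1 by auto
qed auto

lemma append_first_occurrence:
  "xs @ x # ys = xs' @ x # ys' \<Longrightarrow> x \<notin> set xs \<Longrightarrow> x \<notin> set xs' \<Longrightarrow> xs = xs' \<and> ys = ys'"
proof (induction xs arbitrary: xs')
  case Nil
  then show ?case by (cases xs') auto
next
  case (Cons z xs)
  then show ?case by (cases xs') auto
qed

lemma weave_inj:
  assumes "weave ks ws = weave ks ws'" "length ks = Suc (length ws)" "length ks = Suc (length ws')"
    and "set ks \<inter> set (concat ws) = {}" "set ks \<inter> set (concat ws') = {}"
  shows "ws = ws'"
  using assms
proof (induction ks ws arbitrary: ws' rule: weave.induct)
  case (1 k ks w ws)
  obtain w' ws'' where ws': "ws' = w' # ws''" using "1.prems" by (cases ws') auto
  obtain k' ks' where ks: "ks = k' # ks'" using "1.prems" by (cases ks) auto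
  have hd: "\<exists>r. weave ks v = k' # r" for v
    unfolding ks by (cases v) auto
  obtain r r' where r: "weave ks ws = k' # r" "weave ks ws'' = k' # r'" using hd by blast
  have "w @ k' # r = w' @ k' # r'" using "1.prems"(1) r by (simp add: ws')
  moreover have "k' \<notin> set w" "k' \<notin> set w'" using "1.prems"(4,5) by (auto simp: ks ws')
  ultimately have "w = w' \<and> r = r'"
    by (rule append_first_occurrence)
  moreover from this have "ws = ws''"
    using "1.prems" r by (intro "1.IH") (auto simp: ws')
  ultimately show ?case using ws' by simp
qed auto

context split_algebra
begin

lemma trail_product:
  assumes "V \<in> C" "b \<in> V" "p \<in> V"
    and "\<And>x. x \<in> set w \<Longrightarrow> a x = E (fst (u x)) (snd (u x))"
    and "\<And>x. x \<in> set w \<Longrightarrow> \<exists>W\<in>C. fst (u x) \<in> W \<and> snd (u x) \<in> W"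
  shows "(\<exists>q\<in>V. trail p q (map u w) \<and> foldl (*) (z * E b p) (map a w) = z * E b q) \<or>
    ((\<forall>q. \<not> trail p q (map u w)) \<and> foldl (*) (z * E b p) (map a w) = 0)"
  using assms(3-5)
proof (induction w arbitrary: p)
  case (Cons x w)
  obtain W where W: "W \<in> C" "fst (u x) \<in> W" "snd (u x) \<in> W" using Cons.prems(3)[of x] by auto
  have ax: "a x = E (fst (u x)) (snd (u x))" using Cons.prems(2) by simp
  have prod: "E b p * a x = (if p = fst (u x) then E b (snd (u x)) else 0)"
    unfolding ax using E_mult[OF assms(1) W(1) assms(2) Cons.prems(1) W(2,3)] .
  show ?case
  proof (cases "p = fst (u x)")
    case True
    then have "W = V" using disjoint_classes[OF W(1) assms(1)] W(2) Cons.prems(1) by blast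
    then have "snd (u x) \<in> V" using W(3) by simp
    moreover have "z * E b p * a x = z * E b (snd (u x))" using prod True by (simp add: mult.assoc)
    ultimately show ?thesis using Cons.IH[of "snd (u x)"] Cons.prems True by simp
  next
    case False
    have "foldl (*) 0 ys = 0" for ys :: "'a list" by (induction ys) simp_all
    moreover have "z * E b p * a x = 0" using prod False by (simp add: mult.assoc)
    ultimately show ?thesis using False by simp
  qed
qed (use assms in auto)

text \<open>A product of matrix units inserted at the vertex \<open>b\<close> is nonzero only if the units form a trail
  starting at \<open>b\<close>, and it survives multiplication by the next fixed element only if this trail
  ends at \<open>b\<close>; then it acts as \<open>b\<close>.\<close>

lemma weave_value:
  assumes "\<forall>(V, b, g)\<in>set ts. V \<in> C \<and> b \<in> V" "length ws = length ts" "map a ks = glue y ts"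
    and "\<And>x. x \<in> set (concat ws) \<Longrightarrow> a x = E (fst (u x)) (snd (u x))"
    and "\<And>x. x \<in> set (concat ws) \<Longrightarrow> \<exists>W\<in>C. fst (u x) \<in> W \<and> snd (u x) \<in> W"
  shows "foldl (*) z (map a (weave ks ws)) =
    (if closed_trails (map (\<lambda>(V, b, g). (V, b)) ts) u ws then z * slot_product y ts else 0)"
  using assms
proof (induction ts arbitrary: z y ks ws)
  case Nil
  then show ?case by (auto simp: closed_trails_def)
next
  case (Cons t ts)
  obtain V b g where t: "t = (V, b, g)" by (rule prod_cases3)
  have V: "V \<in> C" "b \<in> V" using Cons.prems(1) t by auto
  obtain w ws' where ws: "ws = w # ws'" "length ws' = length ts" using Cons.prems(2) by (cases ws) auto
  obtain k ks' where ks: "ks = k # ks'" "a k = y * b" "map a ks' = glue (b * g) ts"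
    using Cons.prems(3) t by (cases ks) auto
  have bb: "b = E b b" using E_diag[OF V] by simp
  have start: "z * a k = (z * y) * E b b" using ks(2) bb by (simp add: mult.assoc)
  have zero: "foldl (*) 0 ys = 0" for ys :: "'a list" by (induction ys) simp_all
  have val: "foldl (*) z (map a (weave ks ws)) = foldl (*) (foldl (*) ((z * y) * E b b) (map a w)) (map a (weave ks' ws'))"
    using ws ks start by simp
  have rest: "foldl (*) z' (map a (weave ks' ws')) =
      (if closed_trails (map (\<lambda>(V, b, g). (V, b)) ts) u ws' then z' * slot_product (b * g) ts else 0)" for z'
    using Cons.prems ws ks t by (intro Cons.IH) auto
  have trails: "closed_trails (map (\<lambda>(V, b, g). (V, b)) (t # ts)) u ws \<longleftrightarrow>
      trail b b (map u w) \<and> closed_trails (map (\<lambda>(V, b, g). (V, b)) ts) u ws'"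
    by (simp add: closed_trails_def t ws)
  have slot: "slot_product y (t # ts) = y * slot_product (b * g) ts"
    by (simp add: t slot_product_mult[symmetric] mult.assoc)
  have "(\<exists>q\<in>V. trail b q (map u w) \<and> foldl (*) ((z * y) * E b b) (map a w) = (z * y) * E b q) \<or>
    ((\<forall>q. \<not> trail b q (map u w)) \<and> foldl (*) ((z * y) * E b b) (map a w) = 0)"
    using Cons.prems ws by (intro trail_product[OF V V(2)]) auto
  then show ?case
  proof
    assume "\<exists>q\<in>V. trail b q (map u w) \<and> foldl (*) ((z * y) * E b b) (map a w) = (z * y) * E b q"
    then obtain q where q: "q \<in> V" "trail b q (map u w)" "foldl (*) ((z * y) * E b b) (map a w) = (z * y) * E b q"
      by blast
    have unique: "trail p r es \<Longrightarrow> trail p r' es \<Longrightarrow> r = r'" for p r r' and es :: "('a \<times> 'a) list"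
      by (induction es arbitrary: p) auto
    have "E b q * slot_product (b * g) ts = (if q = b then slot_product (b * g) ts else 0)"
    proof -
      have "E b q * (b * g) = (E b q * E b b) * g" using bb by (simp add: mult.assoc)
      also have "E b q * E b b = (if q = b then b else 0)"
        using E_mult[OF V(1,1) V(2) q(1) V(2,2)] bb by simp
      finally show ?thesis by (simp add: slot_product_mult[symmetric])
    qed
    then have "(z * y) * E b q * slot_product (b * g) ts = (if q = b then z * (y * slot_product (b * g) ts) else 0)"
      by (simp add: mult.assoc)
    moreover have "trail b b (map u w) \<longleftrightarrow> q = b" using q(2) unique by blast
    ultimately show ?thesis unfolding val q(3) rest trails slot by (cases "q = b") simp_all
  next
    assume "(\<forall>q. \<not> trail b q (map u w)) \<and> foldl (*) ((z * y) * E b b) (map a w) = 0"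
    then show ?thesis unfolding val trails by (simp add: zero)
  qed
qed

end

context block_action
begin

text \<open>Independent rows of the incidence matrix of closed trails give words which are linearly
  independent modulo identities. The variables \<open>1, ..., N\<close> are substituted by matrix units and the
  last ones by the fixed elements between the slots.\<close>

lemma independent_trails_le_codim:
  fixes ts :: "('a set \<times> 'a \<times> 'a) list" and N :: nat
  defines "cs \<equiv> map (\<lambda>(V, b, g). (V, b)) ts"
  assumes one: "e \<in> carrier G" "\<psi> e = id"
    and ts: "\<forall>(V, b, g)\<in>set ts. V \<in> C \<and> b \<in> V" and nz: "z * slot_product y ts \<noteq> 0"
    and R: "finite R" "\<forall>ws\<in>R. length ws = length cs \<and> distinct (concat ws) \<and> set (concat ws) = {1..N}"
      "independent_rows R ({1..N} \<rightarrow>\<^sub>E coloured_edges cs) (\<lambda>ws u. if closed_trails cs u ws then 1 else 0 :: 'f)"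
  shows "card R \<le> codim_G scale G \<psi> (N + length ts + 2)"
proof -
  define r where "r = length ts"
  (* The variable N + 1 is substituted by z, and the r + 1 variables in ks by the fixed elements
     around the r slots. *)
  define n where "n = N + r + 2"
  define ks where "ks = [N + 2..<N + r + 3]"
  define word where "word ws = map (\<lambda>i. (i, e)) ((N + 1) # weave ks ws)" for ws
  define mon where "mon ws = (Poly_Mapping.single (word ws) 1 :: ('g, 'f) gpoly)" for ws
  have len_cs: "length cs = r" by (simp add: cs_def r_def)
  have len_ks: "length ks = Suc r" by (simp add: ks_def)
  have ks_disj: "set ks \<inter> {1..N} = {}" "N + 1 \<notin> set ks" by (auto simp: ks_def)
  have word_in: "word ws \<in> multilinear_words G n" if "ws \<in> R" for ws
  proof -
    have ws: "length ks = Suc (length ws)" "distinct (concat ws)" "set (concat ws) = {1..N}"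
      using that R(2) len_cs len_ks by auto
    have set_w: "set (weave ks ws) = set ks \<union> {1..N}" using set_weave[OF ws(1)] ws(3) by simp
    have "distinct (weave ks ws)"
      using ws ks_disj(1) by (intro distinct_weave) (auto simp: ks_def)
    then have "distinct ((N + 1) # weave ks ws)" using set_w ks_disj(2) by simp
    moreover have "set ((N + 1) # weave ks ws) = {1..n}"
      unfolding list.set set_w by (auto simp: ks_def n_def)
    moreover have "map fst (word ws) = (N + 1) # weave ks ws" by (simp add: word_def comp_def)
    moreover have "snd ` set (word ws) \<subseteq> carrier G" using one(1) by (auto simp: word_def)
    ultimately show ?thesis by (simp only: multilinear_words_def mem_Collect_eq simp_thms)
  qed
  have word_inj: "inj_on word R"
  proof (rule inj_onI)
    fix ws ws' assume R': "ws \<in> R" "ws' \<in> R" and eq: "word ws = word ws'"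
    have "map fst (word ws) = map fst (word ws')" using eq by simp
    then have "weave ks ws = weave ks ws'" by (simp add: word_def comp_def)
    then show "ws = ws'"
      using R' R(2) len_cs len_ks ks_disj(1) by (intro weave_inj[of ks]) auto
  qed
  have single_inj: "v = w" if "Poly_Mapping.single v (1 :: 'f) = Poly_Mapping.single w 1" for v w :: "(nat \<times> 'g) list"
    using arg_cong[OF that, of Poly_Mapping.keys] by simp
  have mon_inj: "inj_on mon R"
    using word_inj single_inj unfolding mon_def inj_on_def by blast
  define a where "a u i = (if i \<le> N then E (fst (u i)) (snd (u i)) else if i = N + 1 then z
      else glue y ts ! (i - (N + 2)))" for u :: "nat \<Rightarrow> 'a \<times> 'a" and i
  have val_mon: "substitute scale \<psi> (a u) (mon ws) = scale (if closed_trails cs u ws then 1 else 0) (z * slot_product y ts)"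
    if ws: "ws \<in> R" and u: "u \<in> {1..N} \<rightarrow>\<^sub>E coloured_edges cs" for ws u
  proof -
    have "substitute scale \<psi> (a u) (mon ws) = word_value \<psi> (a u) (word ws)"
      unfolding mon_def by (rule substitute_single)
    also have "\<dots> = word_product (map (a u) ((N + 1) # weave ks ws))"
      by (simp add: word_value_def word_def one(2) comp_def)
    also have "\<dots> = foldl (*) z (map (a u) (weave ks ws))"
      by (simp only: list.map word_product_foldl) (simp add: a_def)
    also have "\<dots> = (if closed_trails cs u ws then z * slot_product y ts else 0)"
      unfolding cs_def
    proof (rule weave_value[OF ts])
      show "length ws = length ts" using ws R(2) len_cs by (simp add: r_def)
      show "map (a u) ks = glue y ts"
        by (rule nth_equalityI) (auto simp: ks_def a_def r_def simp del: upt_Suc)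
      fix x assume "x \<in> set (concat ws)"
      then have x: "x \<in> {1..N}" using ws R(2) by blast
      then show "a u x = E (fst (u x)) (snd (u x))" by (simp add: a_def)
      have "u x \<in> coloured_edges cs" using u x by blast
      then obtain V b where "(V, b) \<in> set cs" "fst (u x) \<in> V" "snd (u x) \<in> V"
        by (auto simp: coloured_edges_def)
      moreover from this obtain g where "(V, b, g) \<in> set ts" by (auto simp: cs_def)
      ultimately show "\<exists>W\<in>C. fst (u x) \<in> W \<and> snd (u x) \<in> W"
        using ts by blast
    qed
    finally show ?thesis by simp
  qed
  have "independent_modulo gpoly_scale (multilinear_gpolys G n \<inter> Id_G scale G \<psi>) (mon ` R)"
    unfolding independent_modulo_def
  proof (intro allI impI ballI)
    fix S c v assume S: "finite S \<and> S \<subseteq> mon ` R \<and>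
        (\<Sum>v\<in>S. gpoly_scale (c v) v) \<in> multilinear_gpolys G n \<inter> Id_G scale G \<psi>" and v: "v \<in> S"
    define \<alpha> where "\<alpha> ws = (if mon ws \<in> S then c (mon ws) else 0)" for ws
    obtain ws0 where ws0: "ws0 \<in> R" "v = mon ws0" using S v by blast
    have "\<alpha> ws0 = 0"
    proof (rule independent_rowsD[OF R(3) _ ws0(1)])
      fix u assume u: "u \<in> {1..N} \<rightarrow>\<^sub>E coloured_edges cs"
      let ?val = "\<lambda>ws. if closed_trails cs u ws then 1 else 0 :: 'f"
      interpret s: Vector_Spaces.linear gpoly_scale scale "substitute scale \<psi> (a u)" by (rule substitute_linear)
      have "0 = substitute scale \<psi> (a u) (\<Sum>v\<in>S. gpoly_scale (c v) v)"
        using S by (simp add: Id_G_def)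
      also have "(\<Sum>v\<in>S. gpoly_scale (c v) v) = (\<Sum>v\<in>mon ` R. gpoly_scale (if v \<in> S then c v else 0) v)"
        using S R(1) by (intro sum.mono_neutral_cong_left) auto
      also have "\<dots> = (\<Sum>ws\<in>R. gpoly_scale (\<alpha> ws) (mon ws))"
        by (simp add: sum.reindex[OF mon_inj] \<alpha>_def)
      also have "substitute scale \<psi> (a u) \<dots> = (\<Sum>ws\<in>R. scale (\<alpha> ws) (substitute scale \<psi> (a u) (mon ws)))"
        by (simp add: s.sum s.scale)
      also have "\<dots> = (\<Sum>ws\<in>R. scale (\<alpha> ws * ?val ws) (z * slot_product y ts))"
        by (intro sum.cong refl) (simp only: val_mon[OF _ u] scale_scale)
      also have "\<dots> = scale (\<Sum>ws\<in>R. \<alpha> ws * ?val ws) (z * slot_product y ts)"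
        by (simp add: scale_sum_left)
      finally show "(\<Sum>ws\<in>R. \<alpha> ws * ?val ws) = 0"
        using nz by (metis scale_eq_0_iff)
    qed
    then show "c v = 0" using ws0 v by (simp add: \<alpha>_def)
  qed
  moreover have "mon ` R \<subseteq> multilinear_gpolys G n"
  proof
    fix v assume "v \<in> mon ` R"
    then have v: "v \<in> (\<lambda>w. Poly_Mapping.single w 1) ` multilinear_words G n"
      using word_in unfolding mon_def by blast
    show "v \<in> multilinear_gpolys G n"
      unfolding multilinear_gpolys_eq
      by (rule gp.span_base[OF v])
  qed
  moreover have "n \<ge> 1" by (simp add: n_def)
  moreover have "span Basis = UNIV" by (rule span_Basis)
  ultimately have "card (mon ` R) \<le> codim_G scale G \<psi> n"
    using codim_bounds(2)[of n Basis "{1..n} \<rightarrow>\<^sub>E Basis" "mon ` R"] finite_Basis by auto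
  then show ?thesis using card_image[OF mon_inj] by (simp add: n_def r_def)
qed

end

theorem codim_lower_bound:
  fixes scale :: "'f::field_char_0 \<Rightarrow> 'a::ring \<Rightarrow> 'a"
  assumes "block_action scale B C E J m G \<psi>" and one: "e \<in> carrier G" "\<psi> e = id"
  defines "d \<equiv> split_algebra.exponent C E"
  shows "\<exists>K L n0. \<forall>n\<ge>n0. d ^ n \<le> K * (n + 1) ^ L * codim_G scale G \<psi> n"
proof -
  interpret block_action scale B C E J m G \<psi> by fact
  obtain I where I: "admissible I" "weight I = d" using exponent_attained unfolding d_def by blast
  show ?thesis
  proof (cases "I = {}")
    case True
    then have "d = 0" using I(2) by (simp add: weight_def)
    then show ?thesis by (intro exI[of _ 0] exI[of _ 0] exI[of _ 1]) (auto simp: zero_power)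
  next
    case False
    obtain z y ts where ts: "distinct (map fst ts)" "set (map fst ts) = I" "\<forall>(V, b, g)\<in>set ts. b \<in> V"
      and nz: "z * slot_product y ts \<noteq> 0"
      using admissible_slots[OF I(1) False] by blast
    have IC: "I \<subseteq> C" using I(1) by (simp add: admissible_def)
    have tsC: "\<forall>(V, b, g)\<in>set ts. V \<in> C \<and> b \<in> V"
    proof
      fix t assume t: "t \<in> set ts"
      then have "fst t \<in> set (map fst ts)" unfolding set_map by (rule imageI)
      then have "fst t \<in> C" using IC ts(2) by blast
      then show "case t of (V, b, g) \<Rightarrow> V \<in> C \<and> b \<in> V" using ts(3) t by auto
    qed
    define cs where "cs = map (\<lambda>(V, b, g). (V, b)) ts"
    have "sorted_wrt (\<lambda>(V, _) (V', _). V \<inter> V' = {}) cs"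
      using ts(1) tsC unfolding cs_def
    proof (induction ts)
      case (Cons t ts)
      obtain V b g where t: "t = (V, b, g)" by (rule prod_cases3)
      have "V \<inter> V' = {}" if "(V', b', g') \<in> set ts" for V' b' g'
      proof -
        have "fst (V', b', g') \<in> set (map fst ts)" unfolding set_map using that by (rule imageI)
        then have "V \<noteq> V'" using Cons.prems(1) t by auto
        moreover have "V \<in> C" "V' \<in> C" using Cons.prems(2) that t by auto
        ultimately show ?thesis using disjoint_classes by simp
      qed
      then show ?case using Cons t by auto
    qed simp
    then have cols: "colour_system cs"
      using tsC finite_class by (auto simp: colour_system_def cs_def)
    have sum_cs: "(\<Sum>(V, b)\<leftarrow>cs. (card V)\<^sup>2) = d"
    proof -
      have "(\<Sum>(V, b)\<leftarrow>cs. (card V)\<^sup>2) = (\<Sum>V\<leftarrow>map fst ts. (card V)\<^sup>2)"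
        unfolding cs_def by (simp add: comp_def split_beta)
      also have "\<dots> = (\<Sum>V\<in>set (map fst ts). (card V)\<^sup>2)"
        by (rule sum_list_distinct_conv_sum_set[OF ts(1)])
      finally show ?thesis using I(2) ts(2) by (simp add: weight_def)
    qed
    define K where "K = (\<Prod>(V, b)\<leftarrow>cs. (card V)\<^sup>2)"
    define r where "r = length ts"
    have prod_cs: "(\<Prod>(V, b)\<leftarrow>cs. (card V)\<^sup>2 * (N + 1) ^ ((card V)\<^sup>2)) = K * (N + 1) ^ d" for N
      unfolding K_def sum_cs[symmetric] by (induction cs) (auto simp: power_add)
    have "d ^ n \<le> (K * d ^ (r + 2)) * (n + 1) ^ d * codim_G scale G \<psi> n" if n: "n \<ge> r + 2" for n
    proof -
      define N where "N = n - (r + 2)"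
      have n_eq: "n = N + r + 2" using n by (simp add: N_def)
      obtain R where R: "finite R"
          "\<forall>ws\<in>R. length ws = length cs \<and> distinct (concat ws) \<and> set (concat ws) = {1..N}"
          "independent_rows R ({1..N} \<rightarrow>\<^sub>E coloured_edges cs) (\<lambda>ws u. if closed_trails cs u ws then 1 else 0 :: 'f)"
        and card_R: "d ^ card {1..N} \<le> card R * (K * (card {1..N} + 1) ^ d)"
        using exists_independent_coloured_trails[OF finite_atLeastAtMost cols, of 1 N, where 'f = 'f]
        unfolding sum_cs prod_cs by blast
      have "card R \<le> codim_G scale G \<psi> n"
        unfolding n_eq r_def
        by (rule independent_trails_le_codim[OF one tsC nz R[unfolded cs_def]])
      moreover have "(N + 1) ^ d \<le> (n + 1) ^ d" by (rule power_mono) (simp_all add: n_eq)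
      ultimately have "card R * (K * (N + 1) ^ d) \<le> codim_G scale G \<psi> n * (K * (n + 1) ^ d)"
        by (intro mult_le_mono) auto
      moreover have "d ^ N \<le> card R * (K * (N + 1) ^ d)" using card_R by simp
      ultimately have "d ^ N \<le> codim_G scale G \<psi> n * (K * (n + 1) ^ d)" by (rule order_trans[rotated])
      then have "d ^ N * d ^ (r + 2) \<le> codim_G scale G \<psi> n * (K * (n + 1) ^ d) * d ^ (r + 2)"
        by (rule mult_le_mono1)
      moreover have "d ^ n = d ^ N * d ^ (r + 2)" by (simp add: n_eq power_add[symmetric])
      ultimately show ?thesis by (simp add: mult_ac)
    qed
    then show ?thesis by blast
  qed
qed

section \<open>Symmetries permute the blocks\<close>

lemma (in fd_algebra) separating_functional:
  assumes "subspace W" "x \<notin> W"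
  shows "\<exists>l. Vector_Spaces.linear scale (*) l \<and> (\<forall>w\<in>W. l w = 0) \<and> l x \<noteq> 0"
proof -
  interpret vector_space_pair scale "(*) :: 'f \<Rightarrow> 'f \<Rightarrow> 'f"
    using vector_space_axioms vector_space_mult by (rule vector_space_pair.intro)
  obtain B where B: "B \<subseteq> W" "independent B" "W \<subseteq> span B" by (rule basis_exists)
  have spanB: "span B \<subseteq> W" using B(1) assms(1) by (rule span_minimal)
  then have "x \<notin> span B" using assms(2) by blast
  then have "independent (insert x B)" using B(2) by (rule independent_insertI)
  then obtain l where l: "Vector_Spaces.linear scale (*) l" "\<forall>b\<in>insert x B. l b = (if b = x then 1 else 0)"
    using linear_independent_extend[of "insert x B" "\<lambda>b. if b = x then 1 else 0"] by blast
  have "x \<notin> B" using B(1) assms(2) by blast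
  have "l w = 0" if "w \<in> W" for w
  proof (rule linear_eq_0_on_span[OF l(1)])
    show "l b = 0" if "b \<in> B" for b using that l(2) \<open>x \<notin> B\<close> by auto
    show "w \<in> span B" using B(3) \<open>w \<in> W\<close> by blast
  qed
  then show ?thesis using l by (intro exI[of _ l]) auto
qed

context split_algebra
begin

definition block :: "'a set \<Rightarrow> 'a set" where
  "block V = span (units V \<union> J)"

lemma subspace_block: "subspace (block V)"
  by (simp add: block_def)

lemma J_subset_block: "J \<subseteq> block V"
  unfolding block_def using span_superset by (rule order_trans[rotated]) simp

lemma units_subset_block: "units V \<subseteq> block V"
  unfolding block_def using span_superset by (rule order_trans[rotated]) simp

lemma block_ideal:
  assumes V: "V \<in> C"
  shows "two_sided_ideal (block V)"
proof -
  let ?U = "(\<Union>W\<in>C. {E p q |p q. p \<in> W \<and> q \<in> W}) \<union> J"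
  have zero: "0 \<in> block V" by (rule subspace_0[OF subspace_block])
  have unit_unit: "x * y \<in> block V \<and> y * x \<in> block V"
    if "W \<in> C" "x \<in> units W" "y \<in> units V" for W x y
  proof -
    obtain p q where x: "x = E p q" "p \<in> W" "q \<in> W" using \<open>x \<in> units W\<close> by (auto simp: units_def)
    obtain r t where y: "y = E r t" "r \<in> V" "t \<in> V" using \<open>y \<in> units V\<close> by (auto simp: units_def)
    have "x * y \<in> block V"
    proof (cases "q = r")
      case True
      then have "W = V" using disjoint_classes[OF \<open>W \<in> C\<close> V] x y by blast
      then have "E p t \<in> units V" using x y by (auto simp: units_def)
      then show ?thesis
        using E_mult[OF \<open>W \<in> C\<close> V x(2,3) y(2,3)] True x(1) y(1) units_subset_block by auto
    next
      case False
      then show ?thesis using E_mult[OF \<open>W \<in> C\<close> V x(2,3) y(2,3)] x(1) y(1) zero by simp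
    qed
    moreover have "y * x \<in> block V"
    proof (cases "t = p")
      case True
      then have "W = V" using disjoint_classes[OF \<open>W \<in> C\<close> V] x y by blast
      then have "E r q \<in> units V" using x y by (auto simp: units_def)
      then show ?thesis
        using E_mult[OF V \<open>W \<in> C\<close> y(2,3) x(2,3)] True x(1) y(1) units_subset_block by auto
    next
      case False
      then show ?thesis using E_mult[OF V \<open>W \<in> C\<close> y(2,3) x(2,3)] x(1) y(1) zero by simp
    qed
    ultimately show ?thesis by blast
  qed
  have gen: "x * y \<in> block V \<and> y * x \<in> block V" if xy: "x \<in> ?U" "y \<in> units V \<union> J" for x y
  proof (cases "x \<in> J \<or> y \<in> J")
    case True
    then have "x * y \<in> J \<and> y * x \<in> J" using J_mult by blast
    then show ?thesis using J_subset_block by blast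
  next
    case False
    then obtain W where "W \<in> C" "x \<in> units W" using xy(1) by (auto simp: units_def)
    then show ?thesis using unit_unit False xy(2) by blast
  qed
  have left: "a * y \<in> block V \<and> y * a \<in> block V" if y: "y \<in> units V \<union> J" for a y
  proof -
    have "subspace {a. a * y \<in> block V \<and> y * a \<in> block V}"
      by (rule subspaceI_closed)
        (auto simp: zero distrib_left distrib_right scale_mult_eq
          intro: subspace_add[OF subspace_block] subspace_scale[OF subspace_block])
    then have "span ?U \<subseteq> {a. a * y \<in> block V \<and> y * a \<in> block V}"
      by (rule span_minimal[rotated]) (use gen[OF _ y] in blast)
    then show ?thesis using spanning[of a] by blast
  qed
  have "a * x \<in> block V \<and> x * a \<in> block V" if x: "x \<in> block V" for a x
  proof -
    have "subspace {x. a * x \<in> block V \<and> x * a \<in> block V}"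
      by (rule subspaceI_closed)
        (auto simp: zero distrib_left distrib_right scale_mult_eq
          intro: subspace_add[OF subspace_block] subspace_scale[OF subspace_block])
    then have "block V \<subseteq> {x. a * x \<in> block V \<and> x * a \<in> block V}"
      unfolding block_def[of V] by (rule span_minimal[rotated]) (use left in \<open>auto simp: block_def\<close>)
    then show ?thesis using x by blast
  qed
  then show ?thesis unfolding two_sided_ideal_def using subspace_block by blast
qed

lemma idempotent_in_J:
  assumes "x \<in> J" "x * x = x"
  shows "x = 0"
proof -
  have "word_product (replicate (Suc k) x) = x" for k
    by (induction k) (use assms(2) in \<open>simp_all\<close>)
  moreover have "word_product (replicate (Suc m) x) = 0"
    using assms(1) by (intro J_nilpotent) auto
  ultimately show ?thesis by simp
qed

lemma class_not_in_J: "V \<in> C \<Longrightarrow> p \<in> V \<Longrightarrow> p \<notin> J"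
  using idempotent_in_J[of p] class_idem class_nonzero by blast

lemma class_in_block: "V \<in> C \<Longrightarrow> p \<in> V \<Longrightarrow> p \<in> block V"
  using units_subset_block[of V] E_diag[of V p] by (force simp: units_def)

lemma class_in_other_block:
  assumes "V \<in> C" "W \<in> C" "p \<in> W" "p \<in> block V"
  shows "W = V"
proof (rule ccontr)
  assume "W \<noteq> V"
  have "subspace {x. p * x * p \<in> J}"
    by (rule subspaceI_closed)
      (auto simp: distrib_left distrib_right scale_mult_eq
        intro: subspace_0[OF subspace_J] subspace_add[OF subspace_J] subspace_scale[OF subspace_J])
  moreover have "p * x * p \<in> J" if xV: "x \<in> units V" for x
  proof -
    obtain r t where x: "x = E r t" "r \<in> V" "t \<in> V" using xV by (auto simp: units_def)
    have "p \<noteq> r" using disjoint_classes[OF assms(2,1) \<open>W \<noteq> V\<close>] assms(3) x by blast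
    then have "E p p * E r t = 0" using E_mult[OF assms(2,1,3,3) x(2,3)] by simp
    then have "p * x * p = 0" using E_diag[OF assms(2,3)] x(1) by simp
    then show ?thesis using subspace_0[OF subspace_J] by simp
  qed
  moreover have "p * x * p \<in> J" if "x \<in> J" for x using that J_mult by blast
  ultimately have "block V \<subseteq> {x. p * x * p \<in> J}"
    unfolding block_def by (intro span_minimal) auto
  then have "p \<in> J" using assms(4) class_idem[OF assms(2,3)] by auto
  then show False using class_not_in_J assms(2,3) by blast
qed

text \<open>So the ideals \<open>block V\<close> are the minimal ones properly containing \<open>J\<close>.\<close>

lemma ideal_contains_block:
  assumes I: "two_sided_ideal I" "J \<subseteq> I" "\<not> I \<subseteq> J"
  shows "\<exists>V\<in>C. block V \<subseteq> I"
proof -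
  obtain a where a: "a \<in> I" "a \<notin> J" using I(3) by blast
  obtain V p x y where V: "V \<in> C" "p \<in> V" "p * x * a * y * p = p" using not_in_J[OF a(2)] by blast
  have mult: "b * z \<in> I" "z * b \<in> I" if "z \<in> I" for b z
    using I(1) that unfolding two_sided_ideal_def by blast+
  have "p * x * a * y * p \<in> I" using mult a(1) by (simp add: mult.assoc)
  then have p: "p \<in> I" using V(3) by simp
  have "units V \<subseteq> I"
  proof
    fix z assume "z \<in> units V"
    then obtain r t where z: "z = E r t" "r \<in> V" "t \<in> V" by (auto simp: units_def)
    have "E r p * E p t = z" using E_mult[OF V(1,1) z(2) V(2,2) z(3)] z(1) by simp
    moreover have "E r p * p = E r p" using E_absorb(2)[OF V(1) z(2) V(2)] .
    ultimately have "z = E r p * p * E p t" by simp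
    then show "z \<in> I" using mult p by simp
  qed
  then have "block V \<subseteq> I"
    unfolding block_def using I unfolding two_sided_ideal_def by (intro span_minimal) auto
  then show ?thesis using V(1) by blast
qed

definition symmetry :: "('a \<Rightarrow> 'a) \<Rightarrow> bool" where
  "symmetry T \<longleftrightarrow> Vector_Spaces.linear scale scale T \<and> bij T \<and>
     ((\<forall>a b. T (a * b) = T a * T b) \<or> (\<forall>a b. T (a * b) = T b * T a))"

lemma symmetry_inv:
  assumes "symmetry T"
  shows "symmetry (inv_into UNIV T)"
proof -
  have T: "Vector_Spaces.linear scale scale T" "bij T" using assms by (simp_all add: symmetry_def)
  interpret T: Vector_Spaces.linear scale scale T by (rule T(1))
  have TI: "T (inv_into UNIV T x) = x" for x using T(2) by (simp add: bij_is_surj surj_f_inv_f)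
  have IT: "inv_into UNIV T y = x" if "T x = y" for x y
    using T(2) that by (auto simp: bij_is_inj inv_f_f)
  have "inv_into UNIV T (x + y) = inv_into UNIV T x + inv_into UNIV T y" "inv_into UNIV T (scale c x) = scale c (inv_into UNIV T x)" for x y c
    by (rule IT, simp add: T.add T.scale TI)+
  then have "Vector_Spaces.linear scale scale (inv_into UNIV T)"
    by (simp add: Vector_Spaces.linear_iff vector_space_axioms)
  moreover have "bij (inv_into UNIV T)" using T(2) by (rule bij_imp_bij_inv)
  moreover have "(\<forall>a b. inv_into UNIV T (a * b) = inv_into UNIV T a * inv_into UNIV T b) \<or> (\<forall>a b. inv_into UNIV T (a * b) = inv_into UNIV T b * inv_into UNIV T a)"
    using assms unfolding symmetry_def
  proof (elim conjE disjE)
    assume h: "\<forall>a b. T (a * b) = T a * T b"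
    have "inv_into UNIV T (a * b) = inv_into UNIV T a * inv_into UNIV T b" for a b by (rule IT) (simp add: h TI)
    then show ?thesis by blast
  next
    assume h: "\<forall>a b. T (a * b) = T b * T a"
    have "inv_into UNIV T (a * b) = inv_into UNIV T b * inv_into UNIV T a" for a b by (rule IT) (simp add: h TI)
    then show ?thesis by blast
  qed
  ultimately show ?thesis by (simp add: symmetry_def)
qed

lemma symmetry_ideal:
  assumes T: "symmetry T" and I: "two_sided_ideal I"
  shows "two_sided_ideal (T ` I)"
proof -
  have lin: "Vector_Spaces.linear scale scale T" and "bij T" using T by (simp_all add: symmetry_def)
  interpret T: Vector_Spaces.linear scale scale T by (rule lin)
  have mult: "a * x \<in> I" "x * a \<in> I" if "x \<in> I" for a x
    using I that unfolding two_sided_ideal_def by blast+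
  have "subspace (T ` I)" using I T.subspace_image unfolding two_sided_ideal_def by blast
  moreover have "a * T x \<in> T ` I \<and> T x * a \<in> T ` I" if x: "x \<in> I" for a x
  proof -
    obtain b where b: "a = T b" using \<open>bij T\<close> by (metis bij_pointE)
    consider "\<forall>a b. T (a * b) = T a * T b" | "\<forall>a b. T (a * b) = T b * T a"
      using T unfolding symmetry_def by blast
    then show ?thesis
    proof cases
      case 1
      then have "a * T x = T (b * x)" "T x * a = T (x * b)" using b by simp_all
      then show ?thesis using mult[OF x] by simp
    next
      case 2
      then have "a * T x = T (x * b)" "T x * a = T (b * x)" using b by simp_all
      then show ?thesis using mult[OF x] by simp
    qed
  qed
  ultimately show ?thesis unfolding two_sided_ideal_def by blast
qed

text \<open>The image of \<open>J\<close> is an ideal. If it were not contained in \<open>J\<close>, it would contain a nonzero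
  idempotent, and so would \<open>J\<close>.\<close>

lemma symmetry_J_subset:
  assumes T: "symmetry T"
  shows "T ` J \<subseteq> J"
proof (rule ccontr)
  assume "\<not> T ` J \<subseteq> J"
  then obtain a where a: "a \<in> T ` J" "a \<notin> J" by blast
  obtain V p x y where V: "V \<in> C" "p \<in> V" "p * x * a * y * p = p" using not_in_J[OF a(2)] by blast
  have "p * x * a * y * p \<in> T ` J"
    using symmetry_ideal[OF T J_ideal] a(1) unfolding two_sided_ideal_def by blast
  then obtain j where j: "j \<in> J" "p = T j" using V(3) by auto
  have "T (j * j) = T j * T j" using T unfolding symmetry_def by auto
  also have "\<dots> = T j" using class_idem[OF V(1,2)] j(2) by simp
  finally have "j * j = j" using T unfolding symmetry_def by (metis bij_pointE)
  then have "j = 0" using idempotent_in_J j(1) by blast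
  moreover have "T 0 = 0"
    using T module_hom.zero unfolding symmetry_def Vector_Spaces.linear_def by blast
  ultimately show False using class_nonzero[OF V(1,2)] j(2) by simp
qed

lemma symmetry_J:
  assumes T: "symmetry T"
  shows "T ` J = J"
proof
  show "T ` J \<subseteq> J" using symmetry_J_subset[OF T] .
  have "bij T" using T by (simp add: symmetry_def)
  then have "J = T ` (inv_into UNIV T ` J)" by (simp add: image_f_inv_f bij_is_surj)
  also have "\<dots> \<subseteq> T ` J" using symmetry_J_subset[OF symmetry_inv[OF T]] by (rule image_mono)
  finally show "J \<subseteq> T ` J" .
qed

lemma symmetry_block_contains_block:
  assumes T: "symmetry T" and V: "V \<in> C"
  shows "\<exists>W\<in>C. block W \<subseteq> T ` block V"
proof (rule ideal_contains_block)
  show "two_sided_ideal (T ` block V)" using symmetry_ideal[OF T block_ideal[OF V]] .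
  show "J \<subseteq> T ` block V" using symmetry_J[OF T] image_mono[OF J_subset_block, of T] by simp
  show "\<not> T ` block V \<subseteq> J"
  proof
    assume "T ` block V \<subseteq> J"
    then have "T ` block V \<subseteq> T ` J" using symmetry_J[OF T] by simp
    then have "block V \<subseteq> J" using T by (simp add: symmetry_def inj_image_subset_iff bij_is_inj)
    moreover obtain p where "p \<in> V" using class_nonempty[OF V] by blast
    ultimately show False using class_in_block[OF V] class_not_in_J[OF V] by blast
  qed
qed

lemma symmetry_permutes_blocks:
  assumes T: "symmetry T" and V: "V \<in> C"
  shows "\<exists>W\<in>C. T ` block V \<subseteq> block W"
proof -
  obtain W where W: "W \<in> C" "block W \<subseteq> T ` block V" using symmetry_block_contains_block[OF T V] by blast
  obtain V' where V': "V' \<in> C" "block V' \<subseteq> inv_into UNIV T ` block W"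
    using symmetry_block_contains_block[OF symmetry_inv[OF T] W(1)] by blast
  have bij: "bij T" using T by (simp add: symmetry_def)
  have "inv_into UNIV T ` block W \<subseteq> inv_into UNIV T ` (T ` block V)" using W(2) by (rule image_mono)
  also have "\<dots> = block V" using bij by (simp add: image_inv_f_f bij_is_inj)
  finally have sub: "block V' \<subseteq> block V" using V'(2) by (rule order_trans[rotated])
  obtain p where p: "p \<in> V'" using class_nonempty[OF V'(1)] by blast
  have "p \<in> block V" using class_in_block[OF V'(1) p] sub by (rule subsetD[rotated])
  then have "V' = V" using class_in_other_block[OF V V'(1) p] by blast
  then have "T ` block V \<subseteq> T ` (inv_into UNIV T ` block W)" using V'(2) by (intro image_mono) simp
  also have "\<dots> = block W" using bij by (simp add: image_f_inv_f bij_is_surj)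
  finally show ?thesis using W(1) by blast
qed

lemma symmetry_target_unique:
  assumes T: "symmetry T" and V: "V \<in> C" "W \<in> C" "W' \<in> C"
    and sub: "T ` block V \<subseteq> block W" "T ` block V \<subseteq> block W'"
  shows "W = W'"
proof -
  obtain W0 where W0: "W0 \<in> C" "block W0 \<subseteq> T ` block V" using symmetry_block_contains_block[OF T V(1)] by blast
  obtain p where p: "p \<in> W0" using class_nonempty[OF W0(1)] by blast
  have "p \<in> T ` block V" using class_in_block[OF W0(1) p] W0(2) by (rule subsetD[rotated])
  then have "p \<in> block W" "p \<in> block W'" using sub by blast+
  then have "W0 = W" "W0 = W'" using class_in_other_block[OF _ W0(1) p] V by blast+
  then show ?thesis by simp
qed

end

section \<open>Connected groups fix the blocks\<close>

text \<open>The blocks are finitely many, and for given \<open>V\<close> and \<open>W\<close> the elements of the group which move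
  \<open>V\<close> to \<open>W\<close> form a closed set.\<close>

lemma connected_group_fixes_blocks:
  fixes scale :: "'f::field \<Rightarrow> 'a::ring \<Rightarrow> 'a"
  assumes "split_algebra scale B C E J m"
    and G: "affine_algebraic_group n G" "connected_group n G"
    and rational: "rational_action scale n G \<psi>"
    and sym: "\<And>g. g \<in> carrier G \<Longrightarrow> split_algebra.symmetry scale (\<psi> g)"
    and one: "\<psi> \<one>\<^bsub>G\<^esub> = id"
    and V: "V \<in> C" and g: "g \<in> carrier G"
  shows "\<psi> g ` split_algebra.block scale E J V \<subseteq> split_algebra.block scale E J V"
proof -
  interpret split_algebra scale B C E J m by fact
  define T where "T W = {g \<in> carrier G. \<psi> g ` block V \<subseteq> block W}" for W
  have closed: "closedin (zariski n) (T W)" for W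
  proof -
    have "closedin (zariski n) (carrier G)" using G(1) by (simp add: affine_algebraic_group_def)
    then obtain S0 where S0: "S0 \<subseteq> polynomial_functions n" "carrier G = zero_locus n S0"
      unfolding closedin_zariski by blast
    define S1 where "S1 = {p \<in> polynomial_functions n. \<exists>v\<in>block V. \<exists>l. Vector_Spaces.linear scale (*) l \<and>
        (\<forall>w\<in>block W. l w = 0) \<and> (\<forall>x\<in>carrier G. l (\<psi> x v) = p x)}"
    have "T W = zero_locus n (S0 \<union> S1)"
    proof (intro equalityI subsetI)
      fix x assume x: "x \<in> T W"
      then have "x \<in> zero_locus n S0" using S0 by (simp add: T_def)
      moreover have "p x = 0" if "p \<in> S1" for p
        using that x unfolding S1_def T_def by force
      ultimately show "x \<in> zero_locus n (S0 \<union> S1)" by (auto simp: zero_locus_def)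
    next
      fix x assume x: "x \<in> zero_locus n (S0 \<union> S1)"
      then have xG: "x \<in> carrier G" using S0(2) by (auto simp: zero_locus_def)
      have "\<psi> x v \<in> block W" if v: "v \<in> block V" for v
      proof (rule ccontr)
        assume "\<psi> x v \<notin> block W"
        then obtain l where l: "Vector_Spaces.linear scale (*) l" "\<forall>w\<in>block W. l w = 0" "l (\<psi> x v) \<noteq> 0"
          using separating_functional[OF subspace_block] by blast
        have "(\<lambda>T. l (T v)) \<in> GL_regular_functions scale" using l(1) by (rule GL_regular_functions.entry)
        then have "regular_function n (carrier G) ((\<lambda>T. l (T v)) \<circ> \<psi>)"
          using rational unfolding rational_action_def by blast
        then obtain p where p: "p \<in> polynomial_functions n" "\<forall>x\<in>carrier G. l (\<psi> x v) = p x"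
          unfolding regular_function_def by auto
        then have "p \<in> S1" unfolding S1_def using v l(1,2) by blast
        then have "p x = 0" using x by (auto simp: zero_locus_def)
        then show False using p(2) xG l(3) by simp
      qed
      then show "x \<in> T W" using xG by (auto simp: T_def)
    qed
    moreover have "S0 \<union> S1 \<subseteq> polynomial_functions n" using S0(1) by (auto simp: S1_def)
    ultimately show ?thesis unfolding closedin_zariski by blast
  qed
  define T' where "T' = (\<Union>W\<in>C - {V}. T W)"
  have "closedin (zariski n) T'"
    unfolding T'_def using finite_C closed by (intro closedin_Union) auto
  moreover have "carrier G \<subseteq> T V \<union> T'"
  proof
    fix x assume x: "x \<in> carrier G"
    then obtain W where "W \<in> C" "\<psi> x ` block V \<subseteq> block W" using symmetry_permutes_blocks[OF sym V] by blast
    then show "x \<in> T V \<union> T'" using x by (auto simp: T_def T'_def)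
  qed
  moreover have "T V \<inter> T' \<inter> carrier G = {}"
    using symmetry_target_unique[OF sym V V] by (auto simp: T_def T'_def)
  moreover have "T V \<inter> carrier G \<noteq> {}"
  proof -
    have "group G" using G(1) by (simp add: affine_algebraic_group_def)
    then have "\<one>\<^bsub>G\<^esub> \<in> carrier G" by (simp add: group.is_monoid monoid.one_closed)
    then have "\<one>\<^bsub>G\<^esub> \<in> T V" using one by (simp add: T_def)
    then show ?thesis by (auto simp: T_def)
  qed
  ultimately have "T' \<inter> carrier G = {}"
    using G(2) closed[of V] unfolding connected_group_def connectedin_closedin by blast
  then have "g \<in> T V" using \<open>carrier G \<subseteq> T V \<union> T'\<close> g by blast
  then show ?thesis by (simp add: T_def)
qed

section \<open>Limits of roots\<close>

lemma root_linear_LIMSEQ: "(\<lambda>n. root n (K * real n ^ L)) \<longlonglongrightarrow> 1" if "K > 0"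
proof -
  have "(\<lambda>n. root n K * root n (real n) ^ L) \<longlonglongrightarrow> 1 * 1 ^ L"
    by (intro tendsto_mult tendsto_power LIMSEQ_root_const that LIMSEQ_root)
  moreover have "\<forall>\<^sub>F n in sequentially. root n K * root n (real n) ^ L = root n (K * real n ^ L)"
    using eventually_gt_at_top[of 0] by eventually_elim (simp add: real_root_mult real_root_power)
  ultimately show ?thesis by (simp add: filterlim_cong)
qed

text \<open>The \<open>n\<close>-th root of a polynomial in \<open>n\<close> tends to \<open>1\<close>.\<close>

lemma root_LIMSEQ_between:
  fixes c :: "nat \<Rightarrow> nat"
  assumes upper: "\<And>n. n > n0 \<Longrightarrow> c n \<le> K * (n + 1) ^ L * d ^ n"
    and lower: "\<And>n. n \<ge> n1 \<Longrightarrow> d ^ n \<le> K' * (n + 1) ^ L' * c n"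
  shows "(\<lambda>n. root n (real (c n))) \<longlonglongrightarrow> real d"
proof -
  have poly: "real (K * (n + 1) ^ L) \<le> (real K * 2 ^ L + 1) * real n ^ L" if n: "n > 0" for n K L
  proof -
    have "real (n + 1) ^ L \<le> (2 * real n) ^ L" using n by (intro power_mono) auto
    then have "real K * real (n + 1) ^ L \<le> real K * (2 * real n) ^ L" by (rule mult_left_mono) simp
    also have "\<dots> \<le> (real K * 2 ^ L + 1) * real n ^ L" by (simp add: power_mult_distrib algebra_simps)
    finally show ?thesis by simp
  qed
  let ?u = "\<lambda>n. root n ((real K * 2 ^ L + 1) * real n ^ L)"
  let ?l = "\<lambda>n. root n ((real K' * 2 ^ L' + 1) * real n ^ L')"
  have u: "?u \<longlonglongrightarrow> 1" and l: "?l \<longlonglongrightarrow> 1"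
    by (rule root_linear_LIMSEQ, simp add: add_nonneg_pos)+
  show ?thesis
  proof (rule tendsto_sandwich)
    show "(\<lambda>n. real d / ?l n) \<longlonglongrightarrow> real d"
      using tendsto_divide[OF tendsto_const l, of "real d"] by simp
    show "(\<lambda>n. ?u n * real d) \<longlonglongrightarrow> real d"
      using tendsto_mult[OF u tendsto_const, of "real d"] by simp
    show "\<forall>\<^sub>F n in sequentially. root n (real (c n)) \<le> ?u n * real d"
      using eventually_gt_at_top[of "max n0 0"]
    proof eventually_elim
      case (elim n)
      have "real (c n) \<le> real (K * (n + 1) ^ L * d ^ n)" using upper[of n] elim by (intro of_nat_mono) simp
      also have "\<dots> \<le> (real K * 2 ^ L + 1) * real n ^ L * real d ^ n"
        using poly[of n K L] elim by (simp add: mult_right_mono)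
      finally have "root n (real (c n)) \<le> root n ((real K * 2 ^ L + 1) * real n ^ L * real d ^ n)"
        using elim by (intro real_root_le_mono) auto
      also have "\<dots> = ?u n * real d"
        using elim by (simp only: real_root_mult) (simp add: real_root_power_cancel)
      finally show ?case .
    qed
    show "\<forall>\<^sub>F n in sequentially. real d / ?l n \<le> root n (real (c n))"
      using eventually_gt_at_top[of "max n1 0"]
    proof eventually_elim
      case (elim n)
      have "real (d ^ n) \<le> real (K' * (n + 1) ^ L' * c n)" using lower[of n] elim by (intro of_nat_mono) simp
      also have "\<dots> \<le> (real K' * 2 ^ L' + 1) * real n ^ L' * real (c n)"
        using poly[of n K' L'] elim by (simp add: mult_right_mono)
      finally have "root n (real d ^ n) \<le> root n ((real K' * 2 ^ L' + 1) * real n ^ L' * real (c n))"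
        using elim by (intro real_root_le_mono) auto
      then have "real d \<le> ?l n * root n (real (c n))"
        using elim by (simp only: real_root_mult) (simp add: real_root_power_cancel)
      moreover have "(real K' * 2 ^ L' + 1) * real n ^ L' > 0"
        using elim by (intro mult_pos_pos add_nonneg_pos) auto
      then have "?l n > 0" using elim by simp
      ultimately show ?case by (simp add: divide_le_eq mult.commute)
    qed
  qed
qed

lemma codim_root_LIMSEQ:
  fixes scale :: "'f::field_char_0 \<Rightarrow> 'a::ring \<Rightarrow> 'a"
  assumes "block_action scale B C E J m G \<psi>" "e \<in> carrier G" "\<psi> e = id"
  shows "(\<lambda>n. root n (real (codim_G scale G \<psi> n))) \<longlonglongrightarrow> real (split_algebra.exponent C E)"
proof -
  interpret block_action scale B C E J m G \<psi> by fact
  obtain K where "\<forall>n>m. codim_G scale G \<psi> n \<le> K * (n + 1) ^ m * exponent ^ n"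
    using codim_upper_bound by blast
  moreover obtain K' L' n1 where "\<forall>n\<ge>n1. exponent ^ n \<le> K' * (n + 1) ^ L' * codim_G scale G \<psi> n"
    using codim_lower_bound[OF assms] by blast
  ultimately show ?thesis by (intro root_LIMSEQ_between) blast+
qed

theorem theorem16:
  fixes scale :: "'f::{alg_closed_field, field_char_0} \<Rightarrow> 'a::ring \<Rightarrow> 'a"
    and Basis :: "'a set"
    and n :: nat
    and G :: "(nat \<Rightarrow> 'f) monoid"
    and \<psi> :: "(nat \<Rightarrow> 'f) \<Rightarrow> 'a \<Rightarrow> 'a"
  assumes "assoc_algebra scale"
    and "finite_dimensional_vector_space scale Basis"
    and "affine_algebraic_group n G"
    and "connected_group n G"
    and "reductive_group n G"
    and "acts_by_auts_and_anti_auts scale G \<psi>"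
    and "rational_action scale n G \<psi>"
  shows "convergent (\<lambda>k. root k (real (codim_G scale G \<psi> k)))
    \<and> convergent (\<lambda>k. root k (real (codim scale k)))
    \<and> PIexp_G scale G \<psi> = PIexp scale"
proof -
  interpret fd_algebra scale Basis
    using assms(1,2) by (simp add: fd_algebra_def)
  obtain C E J m where split: "split_algebra scale Basis C E J m"
    using exists_split alg_closed_imp_poly_has_root by blast
  then interpret split_algebra scale Basis C E J m .
  have group: "group G" using assms(3) by (simp add: affine_algebraic_group_def)
  have one: "\<one>\<^bsub>G\<^esub> \<in> carrier G" using group by (simp add: group.is_monoid monoid.one_closed)
  have hom: "\<psi> \<in> hom G (Aut_star scale)" using assms(6) by (simp add: acts_by_auts_and_anti_auts_def)
  have sym: "symmetry (\<psi> g)" if "g \<in> carrier G" for g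
    using hom_in_carrier[OF hom that]
    by (auto simp: Aut_star_def GL_def automorphism_def anti_automorphism_def symmetry_def)
  have psi_one: "\<psi> \<one>\<^bsub>G\<^esub> = id"
  proof -
    have "\<psi> (\<one>\<^bsub>G\<^esub> \<otimes>\<^bsub>G\<^esub> \<one>\<^bsub>G\<^esub>) = \<psi> \<one>\<^bsub>G\<^esub> \<circ> \<psi> \<one>\<^bsub>G\<^esub>"
      using hom_mult[OF hom one one] by (simp add: Aut_star_def GL_def)
    then have "\<psi> \<one>\<^bsub>G\<^esub> (\<psi> \<one>\<^bsub>G\<^esub> x) = \<psi> \<one>\<^bsub>G\<^esub> x" for x
      using group by (simp add: group.is_monoid monoid.l_one[OF _ one] fun_eq_iff)
    moreover have "inj (\<psi> \<one>\<^bsub>G\<^esub>)" using sym[OF one] by (simp add: symmetry_def bij_is_inj)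
    ultimately show ?thesis by (auto simp: inj_eq)
  qed
  have "block_action scale Basis C E J m G \<psi>"
  proof (intro block_action.intro linear_action.intro linear_action_axioms.intro block_action_axioms.intro
      split fd_algebra_axioms)
    show "Vector_Spaces.linear scale scale (\<psi> g)" if "g \<in> carrier G" for g
      using sym[OF that] by (simp add: symmetry_def)
    show "\<psi> g x \<in> J" if "g \<in> carrier G" "x \<in> J" for g x
      using symmetry_J_subset[OF sym[OF that(1)]] that(2) by blast
    show "\<psi> g x \<in> span (units V \<union> J)" if "g \<in> carrier G" "V \<in> C" "x \<in> units V" for g V x
      using connected_group_fixes_blocks[OF split assms(3,4,7) sym psi_one that(2,1)]
        units_subset_block[of V] that(3) unfolding block_def by blast
  qed
  from codim_root_LIMSEQ[OF this, OF one, OF psi_one]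
  have lim_G: "(\<lambda>k. root k (real (codim_G scale G \<psi> k))) \<longlonglongrightarrow> real exponent" .
  have "block_action scale Basis C E J m (singleton_group ()) (\<lambda>_. id)"
  proof (intro block_action.intro linear_action.intro linear_action_axioms.intro block_action_axioms.intro
      split fd_algebra_axioms)
    show "Vector_Spaces.linear scale scale id" by (rule linear_id)
    show "id x \<in> span (units V \<union> J)" if "x \<in> units V" for x V
      using that units_subset_block[of V] unfolding block_def by auto
  qed simp
  from codim_root_LIMSEQ[OF this, of "()"]
  have lim: "(\<lambda>k. root k (real (codim scale k))) \<longlonglongrightarrow> real exponent"
    by (simp add: codim_def singleton_group_def)
  show ?thesis
    using lim_G lim limI[OF lim_G] limI[OF lim]
    unfolding PIexp_G_def PIexp_def by (auto simp: convergentI)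
qed

end
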